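(* Let $x = T^{1/(\log\log T)^2}$ and let $k > 0$ be a real number. There is a constant $c_k$, depending only on $k$, with $0 < c_k \neq 1$, such that, uniformly in $\Delta \sim k \sqrt{\tfrac12 \log\log T}$, as $T \to \infty$, $$ \frac{1}{T} \, \mathrm{meas}\left\{ t \in [T, 2T] : \Re \sum_{p \leq x} \frac{1}{p^{\frac12 + i t}} \geq \Delta \cdot \sqrt{\tfrac12 \sum_{p \leq x} \frac1p} \right\} \sim c_k \int_{\Delta}^{\infty} e^{-u^2/2} \, \frac{du}{\sqrt{2\pi}}. $$ That is, for every real-valued function $\Delta = \Delta(T)$ with $\Delta(T) / \sqrt{\tfrac12 \log\log T} \to k$ as $T \to \infty$, the ratio of the two sides tends to $1$ as $T \to \infty$.
   Context: Sums over $p$ run over prime numbers. $\mathrm{meas}$ denotes Lebesgue measure on $\mathbb{R}$, and $\Re$ denotes the real part. *)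

theory Defs
  imports
    "HOL-Analysis.Analysis"
    "HOL-Computational_Algebra.Primes"
    "HOL-Library.Landau_Symbols"
begin

unbundle asymp_equiv_syntax

definition cutoff :: "real \<Rightarrow> real" where
  "cutoff T = T powr (1 / (ln (ln T))\<^sup>2)"

definition primes_le :: "real \<Rightarrow> nat set" where
  "primes_le x = {p. prime p \<and> real p \<le> x}"

definition prime_poly :: "real \<Rightarrow> real \<Rightarrow> complex" where
  "prime_poly x t = (\<Sum>p\<in>primes_le x. 1 / of_nat p powr (1 / 2 + \<i> * of_real t))"

end

theory Submission
  imports Defs "HOL-Probability.Probability" "HOL-Real_Asymp.Real_Asymp"
begin

text \<open>
  Let \<open>S(t)\<close> be the real part of the prime sum with cutoff \<open>x\<close>, \<open>\<sigma>\<^sup>2 = 1/2 \<Sum> 1/p\<close> its variance and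
  \<open>V = \<Delta> \<sigma>\<close> the threshold.  For \<open>t\<close> uniform in \<open>[T, 2T]\<close> the phases \<open>t ln p\<close> imitate independent
  uniform angles \<open>\<theta>_p\<close>, so \<open>S\<close> imitates \<open>X = \<Sum> cos \<theta>_p / sqrt p\<close>, whose exponential moments are
  \<open>E exp (z X) = \<Prod> I_0 (z / sqrt p) = exp (z\<^sup>2 \<sigma>\<^sup>2 / 2) P_x(z)\<close> with
  \<open>P_x(z) = \<Prod> I_0 (z / sqrt p) exp (- z\<^sup>2 / (4 p))\<close>.  Since \<open>I_0 w = 1 + w\<^sup>2/4 + O(w^4)\<close>, the product
  \<open>P_x\<close> converges locally uniformly as \<open>x\<close> grows: \<open>X\<close> converges to a Gaussian in the ``mod-Gaussian''
  sense.  The constant is \<open>c_k = lim P_x(k)\<close>; it lies strictly between 0 and 1 because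
  \<open>0 < I_0 w < exp (w\<^sup>2/4)\<close> for real \<open>w \<noteq> 0\<close> (\<open>prime_product_limit\<close>).

  Why \<open>c_k\<close> appears: put \<open>s = \<Delta> / \<sigma>\<close>, which tends to \<open>k\<close>, so that \<open>V = s \<sigma>\<^sup>2\<close>, and tilt the law of \<open>S\<close>
  by \<open>exp (s S)\<close>.  The tilted law is centred at \<open>V\<close>, has total mass \<open>exp (s\<^sup>2 \<sigma>\<^sup>2 / 2) P_x(s)\<close>, and near
  \<open>V\<close> it has, on the scale 1, the flat density of a Gaussian of width \<open>\<sigma>\<close>.  Undoing the tilt gives
  \<open>P(S \<ge> V) \<approx> exp (- \<Delta>\<^sup>2 / 2) c_k / (sqrt (2 pi) \<sigma> k)\<close>, that is, \<open>c_k\<close> times the Gaussian tail.  The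
  flatness is a local limit theorem; it is proved by Fourier analysis from the exponential moments
  of \<open>S\<close> at \<open>s + i u\<close> with \<open>u\<close> in a compact set (\<open>vague_limit\<close>, \<open>mod_gaussian_tail\<close>), where the
  Gaussian factor \<open>exp (- u\<^sup>2 \<sigma>\<^sup>2 / 2)\<close> suppresses everything but \<open>u\<close> of size \<open>1 / \<sigma>\<close>.

  It remains to show that \<open>S\<close> and \<open>X\<close> have nearly equal exponential moments.  Their power moments of
  order \<open>l\<close> differ by at most \<open>2 x^(2l) / T\<close>: expanding the \<open>l\<close>-th power, the terms with vanishing
  frequency agree by unique factorisation, and any other frequency is the logarithm of a fraction
  with terms up to \<open>x^l\<close>, hence at least \<open>x^(-l)\<close> (\<open>moments_close\<close>).  The choice \<open>x = T^(1/L\<^sup>2)\<close> with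
  \<open>L = ln ln T\<close> makes this negligible for \<open>l\<close> up to \<open>2 L^(3/2)\<close>.  For bounded \<open>z\<close>, that many Taylor terms
  of \<open>exp (z S)\<close> suffice while \<open>\<bar>S\<bar>\<close> is at most of order \<open>L^(13/10)\<close>, and a high even moment shows that
  larger values of \<open>S\<close> are too rare to matter (locale \<open>moment_match\<close>).  Finally
  \<open>\<sigma>\<^sup>2 ~ L / 2\<close> by the theorem of Mertens in the weak form \<open>\<Sum> 1/p ~ ln ln x\<close>
  (\<open>sum_inverse_primes_asymp\<close>).
\<close>

section \<open>The sum of reciprocals of the primes\<close>

text \<open>
  One step of the sieve of Eratosthenes: multiplying by \<open>1 - 1/q\<close> removes \<open>1/(q n)\<close> for every
  surviving \<open>n \<le> N\<close>, which covers all surviving multiples of \<open>q\<close> up to \<open>N\<close>.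
\<close>

lemma sum_harmonic_times_prod_primes_le_1:
  fixes P :: "nat set" and N :: nat
  assumes "finite P" "\<And>p. p \<in> P \<Longrightarrow> prime p"
  shows "(\<Sum>n\<in>{1..N}. 1 / real n) * (\<Prod>p\<in>P. 1 - 1 / real p)
           \<le> (\<Sum>n | n \<in> {1..N} \<and> (\<forall>p\<in>P. \<not> p dvd n). 1 / real n)"
  using assms
proof (induction P rule: finite_induct)
  case empty
  have "{n. n \<in> {1..N} \<and> (\<forall>p\<in>{}. \<not> p dvd n)} = {1..N}" by auto
  then show ?case by simp
next
  case (insert q P)
  let ?D = "\<lambda>P. {n \<in> {1..N}. \<forall>p\<in>P. \<not> p dvd n}"
  have q: "prime q" using insert.prems by simp
  then have q1: "q > 1" by (rule prime_gt_1_nat)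
  have IH: "(\<Sum>n\<in>{1..N}. 1 / real n) * (\<Prod>p\<in>P. 1 - 1 / real p) \<le> (\<Sum>n\<in>?D P. 1 / real n)"
    using insert by auto
  have split: "?D P = ?D (insert q P) \<union> {n \<in> ?D P. q dvd n}" by auto
  have sub: "{n \<in> ?D P. q dvd n} \<subseteq> (\<lambda>n. q * n) ` ?D P"
  proof
    fix n assume n: "n \<in> {n \<in> ?D P. q dvd n}"
    then obtain m where m: "n = q * m" by auto
    have "m \<le> n" using m q1 by simp
    then have "m \<le> N" using n by auto
    then have "m \<in> ?D P" using n m by (auto intro: Suc_leI order_trans)
    then show "n \<in> (\<lambda>n. q * n) ` ?D P" using m by blast
  qed
  have "(\<Sum>n\<in>{n \<in> ?D P. q dvd n}. 1 / real n) \<le> (\<Sum>n\<in>(\<lambda>n. q * n) ` ?D P. 1 / real n)"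
    by (rule sum_mono2) (use sub in auto)
  also have "\<dots> = (\<Sum>n\<in>?D P. 1 / real n) / real q"
    using q1 by (subst sum.reindex) (auto simp: inj_on_def sum_divide_distrib mult.commute)
  finally have A: "(\<Sum>n\<in>{n \<in> ?D P. q dvd n}. 1 / real n) \<le> (\<Sum>n\<in>?D P. 1 / real n) / real q" .
  have B: "(\<Sum>n\<in>?D P. 1 / real n) = (\<Sum>n\<in>?D (insert q P). 1 / real n) + (\<Sum>n\<in>{n \<in> ?D P. q dvd n}. 1 / real n)"
    by (subst split, rule sum.union_disjoint) auto
  have "(\<Sum>n\<in>{1..N}. 1 / real n) * (\<Prod>p\<in>insert q P. 1 - 1 / real p)
     = (1 - 1 / real q) * ((\<Sum>n\<in>{1..N}. 1 / real n) * (\<Prod>p\<in>P. 1 - 1 / real p))"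
    using insert by (simp add: algebra_simps)
  also have "\<dots> \<le> (1 - 1 / real q) * (\<Sum>n\<in>?D P. 1 / real n)"
    using q1 IH by (intro mult_left_mono) auto
  also have "\<dots> = (\<Sum>n\<in>?D P. 1 / real n) - (\<Sum>n\<in>?D P. 1 / real n) / real q"
    by (simp add: left_diff_distrib)
  also have "\<dots> \<le> (\<Sum>n\<in>?D (insert q P). 1 / real n)"
    using A B by linarith
  finally show ?case by simp
qed

lemma finite_primes_le [simp]: "finite (primes_le x)"
  unfolding primes_le_def by (rule finite_subset[of _ "{..nat \<lfloor>x\<rfloor>}"]) (auto simp: le_nat_floor)

lemma primes_le_prime: "p \<in> primes_le x \<Longrightarrow> prime p"
  by (simp add: primes_le_def)

lemma primes_le_ge2: "p \<in> primes_le x \<Longrightarrow> real p \<ge> 2"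
  using prime_ge_2_nat by (fastforce simp: primes_le_def)

text \<open>
  When \<open>P\<close> contains all primes up to \<open>N\<close>, only \<open>n = 1\<close> survives the sieve, so the product of the
  \<open>1 - 1/p\<close> is at most \<open>1 / ln x\<close>.
\<close>

lemma ln_ln_le_sum_inverse_primes:
  assumes "x \<ge> 2"
  shows "ln (ln x) - 2 * (\<Sum>n. 1 / (real n)\<^sup>2) \<le> (\<Sum>p\<in>primes_le x. 1 / real p)"
proof -
  define N where "N = nat \<lfloor>x\<rfloor>"
  let ?P = "primes_le x"
  have N1: "N \<ge> 1" using assms by (simp add: N_def le_nat_floor)
  have Nx: "real N \<le> x" "x < real N + 1" using assms unfolding N_def by linarith+
  have D: "{n \<in> {1..N}. \<forall>p\<in>?P. \<not> p dvd n} = {1}"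
  proof -
    have "n = 1" if "n \<in> {1..N}" "\<forall>p\<in>?P. \<not> p dvd n" for n
    proof (rule ccontr)
      assume "n \<noteq> 1"
      then obtain p where p: "prime p" "p dvd n" using prime_factor_nat by blast
      then have "p \<le> n" using that by (auto dest: dvd_imp_le)
      then have "real p \<le> x" using that Nx by auto
      then show False using p that by (auto simp: primes_le_def)
    qed
    then show ?thesis using N1 by (auto dest: primes_le_prime)
  qed
  have "harm N * (\<Prod>p\<in>?P. 1 - 1 / real p) \<le> 1"
    using sum_harmonic_times_prod_primes_le_1[of ?P N] unfolding D
    by (simp add: harm_def primes_le_prime inverse_eq_divide)
  moreover have "ln x \<le> harm N"
    using ln_le_harm[of N] Nx assms by (smt (verit) ln_mono)
  moreover have "(\<Prod>p\<in>?P. 1 - 1 / real p) > 0"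
    by (rule prod_pos) (auto dest: primes_le_ge2)
  ultimately have "ln x * (\<Prod>p\<in>?P. 1 - 1 / real p) \<le> 1"
    by (smt (verit) mult_right_mono)
  moreover have lnx: "ln x > 0" using assms by simp
  ultimately have "ln (ln x * (\<Prod>p\<in>?P. 1 - 1 / real p)) \<le> 0"
    using \<open>(\<Prod>p\<in>?P. 1 - 1 / real p) > 0\<close> by (simp add: ln_le_zero_iff)
  have L: "ln (\<Prod>p\<in>?P. 1 - 1 / real p) = (\<Sum>p\<in>?P. ln (1 - 1 / real p))"
    by (rule ln_prod) (use primes_le_ge2 in fastforce)+
  note \<open>ln (ln x * (\<Prod>p\<in>?P. 1 - 1 / real p)) \<le> 0\<close>
  then have "ln (ln x) \<le> - (\<Sum>p\<in>?P. ln (1 - 1 / real p))"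
    using lnx \<open>(\<Prod>p\<in>?P. 1 - 1 / real p) > 0\<close>
    by (subst (asm) ln_mult_pos) (auto simp: L)
  also have "\<dots> = (\<Sum>p\<in>?P. - ln (1 - 1 / real p))" by (simp add: sum_negf)
  also have "\<dots> \<le> (\<Sum>p\<in>?P. 1 / real p + 2 * (1 / (real p)\<^sup>2))"
  proof (rule sum_mono)
    fix p assume "p \<in> ?P"
    then have "real p \<ge> 2" by (rule primes_le_ge2)
    then show "- ln (1 - 1 / real p) \<le> 1 / real p + 2 * (1 / (real p)\<^sup>2)"
      using ln_one_minus_pos_lower_bound[of "1 / real p"] by (auto simp: power_divide)
  qed
  also have "\<dots> = (\<Sum>p\<in>?P. 1 / real p) + 2 * (\<Sum>p\<in>?P. 1 / (real p)\<^sup>2)"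
    by (simp add: sum.distrib sum_distrib_left)
  also have "(\<Sum>p\<in>?P. 1 / (real p)\<^sup>2) \<le> (\<Sum>n. 1 / (real n)\<^sup>2)"
    using inverse_power_summable[of 2, where 'a=real] by (intro sum_le_suminf) (auto simp: inverse_eq_divide)
  finally show ?thesis by simp
qed

lemma summable_on_powr:
  assumes "s > (1::real)"
  shows "(\<lambda>n. real n powr -s) summable_on A"
proof (rule summable_on_subset_banach)
  show "(\<lambda>n. real n powr -s) summable_on UNIV"
    using assms by (subst summable_on_UNIV_nonneg_real_iff) (auto simp: summable_real_powr_iff)
qed auto

text \<open>
  The same sieve for the full Dirichlet series, where it loses nothing; this replaces the Euler
  product of the zeta function.
\<close>

lemma infsum_coprime_powr:
  fixes P :: "nat set" and s :: real
  assumes "finite P" "\<And>p. p \<in> P \<Longrightarrow> prime p" "s > 1"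
  shows "(\<Sum>\<^sub>\<infinity>n | n > 0 \<and> (\<forall>p\<in>P. \<not> p dvd n). real n powr -s)
     = (\<Sum>\<^sub>\<infinity>n | n > 0. real n powr -s) * (\<Prod>p\<in>P. 1 - real p powr -s)"
  using assms(1,2)
proof (induction P rule: finite_induct)
  case empty
  then show ?case by simp
next
  case (insert q P)
  note summ = summable_on_powr[OF assms(3)]
  let ?D = "\<lambda>P. {n. n > 0 \<and> (\<forall>p\<in>P. \<not> p dvd n)}"
  have q: "prime q" using insert.prems by simp
  then have q1: "q > 1" by (rule prime_gt_1_nat)
  have cop: "\<not> p dvd q" "prime p" if "p \<in> P" for p
    using that insert q by (metis insertCI primes_dvd_imp_eq, auto)
  have split: "?D P = ?D (insert q P) \<union> (\<lambda>n. q * n) ` ?D P" (is "_ = ?R")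
  proof (intro equalityI subsetI)
    fix n assume n: "n \<in> ?D P"
    show "n \<in> ?R"
    proof (cases "q dvd n")
      case True
      then obtain m where m: "n = q * m" by auto
      then have "m \<in> ?D P" using n by auto
      then show ?thesis using m by blast
    qed (use n in auto)
  next
    fix n assume "n \<in> ?R"
    then show "n \<in> ?D P"
    proof
      assume "n \<in> (\<lambda>n. q * n) ` ?D P"
      then obtain m where m: "n = q * m" "m \<in> ?D P" by auto
      have "\<not> p dvd n" if "p \<in> P" for p
        using that cop[OF that] m by (auto simp: prime_dvd_mult_iff)
      then show ?thesis using m q1 by simp
    qed simp
  qed
  have "infsum (\<lambda>n. real n powr -s) (?D P) = infsum (\<lambda>n. real n powr -s) ?R"
    by (rule arg_cong[OF split])
  also have "\<dots> = infsum (\<lambda>n. real n powr -s) (?D (insert q P)) 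
      + infsum (\<lambda>n. real n powr -s) ((\<lambda>n. q * n) ` ?D P)"
    by (rule infsum_Un_disjoint) (use summ in auto)
  also have "infsum (\<lambda>n. real n powr -s) ((\<lambda>n. q * n) ` ?D P) = (\<Sum>\<^sub>\<infinity>n\<in>?D P. real q powr -s * real n powr -s)"
    using q1 by (subst infsum_reindex) (auto simp: inj_on_def o_def powr_mult)
  also have "\<dots> = real q powr -s * infsum (\<lambda>n. real n powr -s) (?D P)"
    by (rule infsum_cmult_right) (rule summ)
  finally have "infsum (\<lambda>n. real n powr -s) (?D (insert q P)) = (1 - real q powr -s) * infsum (\<lambda>n. real n powr -s) (?D P)"
    by (simp add: algebra_simps)
  also have "\<dots> = (1 - real q powr -s) * ((\<Sum>\<^sub>\<infinity>n | n > 0. real n powr -s) * (\<Prod>p\<in>P. 1 - real p powr -s))"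
    using insert by simp
  finally show ?case using insert by (simp add: mult_ac)
qed

lemma powr_neg_le_telescope:
  fixes d :: real and n :: nat
  assumes "d > 0" "n \<ge> 1"
  shows "real (Suc n) powr -(1+d) \<le> (real n powr -d - real (Suc n) powr -d) / d"
proof -
  have "\<exists>z>real n. z < real (Suc n) \<and> real (Suc n) powr -d - real n powr -d = (real (Suc n) - real n) * (-d * z powr (-d - 1))"
    using assms by (intro MVT2) (auto intro!: derivative_eq_intros simp: powr_diff)
  then obtain z where z: "z > real n" "z < real (Suc n)" "real (Suc n) powr -d - real n powr -d = -d * z powr (-d - 1)"
    by auto
  have e: "-(1+d) = -d-1" by simp
  have "real (Suc n) powr -(1+d) \<le> z powr -(1+d)"
    using z assms by (intro powr_mono2') auto
  then have "d * real (Suc n) powr -(1+d) \<le> d * z powr -(1+d)" using assms by simp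
  then have "d * real (Suc n) powr (-d-1) \<le> real n powr -d - real (Suc n) powr -d"
    unfolding e using z(3) by linarith
  then show ?thesis unfolding e using assms(1) by (simp add: pos_le_divide_eq mult.commute)
qed

lemma infsum_powr_le:
  fixes d :: real
  assumes "d > 0"
  shows "(\<Sum>\<^sub>\<infinity>n | n > 0. real n powr -(1+d)) \<le> 1 + 1 / d"
proof (rule infsum_le_finite_sums)
  show "(\<lambda>n. real n powr -(1+d)) summable_on {n. 0 < n}"
    by (rule summable_on_powr) (use assms in simp)
next
  fix F :: "nat set" assume F: "finite F" "F \<subseteq> {n. 0 < n}"
  obtain N where N: "F \<subseteq> {1..Suc N}"
  proof
    show "F \<subseteq> {1..Suc (Max F)}" using F Max_ge[OF F(1)] by (auto simp: le_SucI)
  qed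
  have *: "(\<Sum>n\<in>{1..Suc N}. real n powr -(1+d)) \<le> 1 + (1 - real (Suc N) powr -d) / d"
  proof (induction N)
    case 0 then show ?case by simp
  next
    case (Suc N)
    then show ?case using powr_neg_le_telescope[OF assms, of "Suc N"] by (simp add: diff_divide_distrib)
  qed
  have "(\<Sum>n\<in>F. real n powr -(1+d)) \<le> (\<Sum>n\<in>{1..Suc N}. real n powr -(1+d))"
    by (rule sum_mono2) (use N in auto)
  also note *
  also have "1 + (1 - real (Suc N) powr -d) / d \<le> 1 + 1 / d"
    using assms by (simp add: divide_right_mono)
  finally show "(\<Sum>n\<in>F. real n powr -(1+d)) \<le> 1 + 1/d" .
qed

text \<open>
  Keeping only \<open>n = 1\<close> in the sieved series bounds \<open>\<Sum> p^(-1-d)\<close> by the logarithm of \<open>1 + 1/d\<close>.  With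
  \<open>d = e / ln x\<close>, passing from the exponent \<open>1 + d\<close> back to 1 costs a factor \<open>p^d \<le> exp e\<close>.
\<close>

lemma sum_inverse_primes_le:
  assumes "x > 1" "e > 0"
  shows "(\<Sum>p\<in>primes_le x. 1 / real p) \<le> exp e * ln (1 + ln x / e)"
proof -
  define d where "d = e / ln x"
  have d: "d > 0" using assms by (simp add: d_def)
  let ?P = "primes_le x"
  have p1: "real p powr -(1+d) < 1" if "p \<in> ?P" for p
    using primes_le_ge2[OF that] d by (simp add: powr_less_one)
  have pos: "(\<Prod>p\<in>?P. 1 - real p powr -(1+d)) > 0"
    by (rule prod_pos) (use p1 in auto)
  have "(\<Sum>\<^sub>\<infinity>n\<in>{1}. real n powr -(1+d)) \<le> (\<Sum>\<^sub>\<infinity>n | n > 0 \<and> (\<forall>p\<in>?P. \<not> p dvd n). real n powr -(1+d))"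
  proof (rule infsum_mono_neutral)
    show "(\<lambda>n. real n powr -(1+d)) summable_on {n. n > 0 \<and> (\<forall>p\<in>?P. \<not> p dvd n)}"
      by (rule summable_on_powr) (use d in simp)
  qed (auto dest: primes_le_prime)
  also have "\<dots> = (\<Sum>\<^sub>\<infinity>n | n > 0. real n powr -(1+d)) * (\<Prod>p\<in>?P. 1 - real p powr -(1+d))"
    by (rule infsum_coprime_powr) (use d in \<open>auto dest: primes_le_prime\<close>)
  also have "\<dots> \<le> (1 + 1/d) * (\<Prod>p\<in>?P. 1 - real p powr -(1+d))"
    by (rule mult_right_mono) (use infsum_powr_le[OF d] pos in auto)
  also have "\<dots> \<le> (1 + 1/d) * (\<Prod>p\<in>?P. exp (- (real p powr -(1+d))))"
    using p1 d by (intro mult_left_mono prod_mono) (auto intro: less_imp_le exp_ge_add_one_self[of "- _", simplified])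
  also have "\<dots> = (1 + 1/d) * exp (- (\<Sum>p\<in>?P. real p powr -(1+d)))"
    by (simp flip: exp_sum add: sum_negf)
  finally have "exp (\<Sum>p\<in>?P. real p powr -(1+d)) \<le> 1 + 1/d"
    by (simp add: exp_minus field_simps)
  then have A: "(\<Sum>p\<in>?P. real p powr -(1+d)) \<le> ln (1 + 1/d)"
    using d by (subst ln_ge_iff) (auto simp: add_pos_pos)
  have "(\<Sum>p\<in>?P. 1 / real p) \<le> (\<Sum>p\<in>?P. exp e * real p powr -(1+d))"
  proof (rule sum_mono)
    fix p assume p: "p \<in> ?P"
    then have p2: "real p \<ge> 2" "real p \<le> x" using primes_le_ge2 by (auto simp: primes_le_def)
    have "d * ln (real p) \<le> d * ln x" using p2 d by (intro mult_left_mono) auto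
    also have "\<dots> = e" using assms by (simp add: d_def)
    finally have "exp (-e) \<le> real p powr -d" using p2 by (simp add: powr_def)
    then have "1 \<le> exp e * real p powr - d" by (simp add: exp_minus field_simps)
    then have "1 / real p \<le> (exp e * real p powr - d) / real p" using p2 by (intro divide_right_mono) auto
    also have "\<dots> = exp e * real p powr -(1+d)" using p2 by (simp add: powr_diff powr_minus field_simps powr_add)
    finally show "1 / real p \<le> exp e * real p powr -(1+d)" .
  qed
  also have "\<dots> \<le> exp e * ln (1 + 1/d)" using A by (simp flip: sum_distrib_left)
  finally show ?thesis by (simp add: d_def)
qed

text \<open>
  For the upper bound the free parameter is \<open>e = 1 / ln ln x\<close>: it makes \<open>exp e\<close> tend to 1 and adds
  only \<open>ln ln ln x\<close> inside the main term.
\<close>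

theorem sum_inverse_primes_asymp:
  "((\<lambda>x. (\<Sum>p\<in>primes_le x. 1 / real p) / ln (ln x)) \<longlongrightarrow> 1) at_top"
proof (rule real_tendsto_sandwich)
  define C where "C = 2 * (\<Sum>n. 1 / (real n)\<^sup>2)"
  show "((\<lambda>x. (ln (ln x) - C) / ln (ln x)) \<longlongrightarrow> 1) at_top" by real_asymp
  show "((\<lambda>x::real. exp (1 / ln (ln x)) * ln (1 + ln x / (1 / ln (ln x))) / ln (ln x)) \<longlongrightarrow> 1) at_top" by real_asymp
  have ev: "eventually (\<lambda>x::real. ln (ln x) > 0 \<and> x > 2) at_top"
    by (intro eventually_conj eventually_gt_at_top) real_asymp
  show "\<forall>\<^sub>F x in at_top. (ln (ln x) - C) / ln (ln x) \<le> (\<Sum>p\<in>primes_le x. 1 / real p) / ln (ln x)"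
    using ev by eventually_elim (use ln_ln_le_sum_inverse_primes in \<open>auto simp: C_def intro!: divide_right_mono\<close>)
  show "\<forall>\<^sub>F x in at_top. (\<Sum>p\<in>primes_le x. 1 / real p) / ln (ln x) \<le> exp (1 / ln (ln x)) * ln (1 + ln x / (1 / ln (ln x))) / ln (ln x)"
    using ev by eventually_elim (intro divide_right_mono sum_inverse_primes_le, auto)
qed

section \<open>The Bessel function and the limiting constant\<close>

definition interval_unif :: "real \<Rightarrow> real \<Rightarrow> real measure" where
  "interval_unif a b = density lborel (\<lambda>t. ennreal (indicator {a..b} t / (b - a)))"

lemma sets_interval_unif [simp, measurable_cong]: "sets (interval_unif a b) = sets borel"
  by (simp add: interval_unif_def)

lemma space_interval_unif [simp]: "space (interval_unif a b) = UNIV"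
  by (simp add: interval_unif_def)

lemma emeasure_interval_unif:
  assumes "a < b" "A \<in> sets borel"
  shows "emeasure (interval_unif a b) A = emeasure lborel (A \<inter> {a..b}) / ennreal (b - a)"
proof -
  have "emeasure (interval_unif a b) A = (\<integral>\<^sup>+t. ennreal (1 / (b - a)) * indicator (A \<inter> {a..b}) t \<partial>lborel)"
    unfolding interval_unif_def using assms
    by (subst emeasure_density) (auto intro!: nn_integral_cong simp: indicator_def)
  also have "\<dots> = ennreal (1 / (b - a)) * emeasure lborel (A \<inter> {a..b})"
    using assms by (intro nn_integral_cmult_indicator) auto
  finally show ?thesis using assms by (simp add: divide_ennreal_def mult.commute inverse_ennreal inverse_eq_divide)
qed

lemma prob_space_interval_unif: "a < b \<Longrightarrow> prob_space (interval_unif a b)"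
  by (intro prob_spaceI) (simp add: emeasure_interval_unif ennreal_divide_self)

lemma prob_interval_unif:
  assumes "a < b" "A \<in> sets borel"
  shows "measure (interval_unif a b) A = measure lborel (A \<inter> {a..b}) / (b - a)"
proof -
  have "emeasure lborel (A \<inter> {a..b}) < \<infinity>"
    by (rule le_less_trans[OF emeasure_mono[of _ "{a..b}"]]) (use assms in auto)
  then have "emeasure (interval_unif a b) A = ennreal (measure lborel (A \<inter> {a..b}) / (b - a))"
    using assms by (simp add: emeasure_interval_unif divide_ennreal emeasure_eq_ennreal_measure[of lborel])
  then show ?thesis using assms by (intro measure_eq_emeasure_eq_ennreal) auto
qed

lemma expectation_iexp_interval_unif:
  assumes "a < b" "w \<noteq> 0"
  shows "integral\<^sup>L (interval_unif a b) (\<lambda>t. iexp (w * t))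
     = (iexp (w * b) - iexp (w * a)) / (\<i> * of_real (w * (b - a)))"
proof -
  let ?F = "\<lambda>t. iexp (w * t) / (\<i> * of_real w)"
  have "(\<integral>t. indicator {a..b} t *\<^sub>R iexp (w * t) \<partial>lborel) = ?F b - ?F a"
  proof (rule integral_FTC_Icc)
    fix x
    have "((\<lambda>z. exp (\<i> * of_real w * z) / (\<i> * of_real w)) has_field_derivative exp (\<i> * of_real w * of_real x)) (at (of_real x))"
      using assms by (auto intro!: derivative_eq_intros)
    from has_vector_derivative_real_field[OF this]
    show "(?F has_vector_derivative iexp (w * x)) (at x within {a..b})"
      by (auto simp: mult.assoc intro: has_vector_derivative_at_within)
  qed (use assms in \<open>auto intro!: continuous_intros\<close>)
  moreover have "integral\<^sup>L (interval_unif a b) (\<lambda>t. iexp (w * t))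
    = (\<integral>t. (indicator {a..b} t / (b - a)) *\<^sub>R iexp (w * t) \<partial>lborel)"
    unfolding interval_unif_def by (subst integral_density) (use assms in auto)
  moreover have "\<dots> = (\<integral>t. (1 / (b - a)) *\<^sub>R (indicator {a..b} t *\<^sub>R iexp (w * t)) \<partial>lborel)"
    by simp
  ultimately have "integral\<^sup>L (interval_unif a b) (\<lambda>t. iexp (w * t)) = (1 / (b - a)) *\<^sub>R (?F b - ?F a)"
    by (simp only: integral_scaleR_right)
  then show ?thesis by (simp add: scaleR_conv_of_real diff_divide_distrib mult_ac)
qed

lemma norm_expectation_iexp_interval_unif_le:
  assumes "a < b" "w \<noteq> 0"
  shows "norm (integral\<^sup>L (interval_unif a b) (\<lambda>t. iexp (w * t))) \<le> 2 / ((b - a) * \<bar>w\<bar>)"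
proof -
  have "norm (iexp (w * b) - iexp (w * a)) \<le> 1 + 1"
    by (rule order_trans[OF norm_triangle_ineq4]) simp
  moreover have "norm (\<i> * of_real (w * (b - a)) :: complex) = (b - a) * \<bar>w\<bar>"
    using assms by (simp only: norm_mult norm_of_real norm_ii abs_mult) simp
  ultimately show ?thesis unfolding expectation_iexp_interval_unif[OF assms] norm_divide
    using assms by (auto intro!: divide_right_mono)
qed

abbreviation circle :: "real measure" where "circle \<equiv> interval_unif 0 (2 * pi)"

interpretation circle: prob_space circle
  by (rule prob_space_interval_unif) simp

lemma expectation_circle_character:
  "integral\<^sup>L circle (\<lambda>t. iexp (of_int n * t)) = (if n = 0 then 1 else 0)"
proof (cases "n = 0")
  case True
  then show ?thesis using circle.prob_space by simp
next
  case False
  have "iexp (of_int n * (2 * pi)) = 1"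
    using exp_integer_2pi[of "of_int n"] by (simp add: mult_ac)
  then show ?thesis using False
    by (subst expectation_iexp_interval_unif) auto
qed

text \<open>
  The modified Bessel function \<open>I_0\<close>, over the reals and over the complex numbers at once.
\<close>

definition bessel0 :: "'a::{real_normed_field,banach} \<Rightarrow> 'a" where
  "bessel0 w = (\<Sum>n. (w / 2) ^ (2 * n) / (fact n)\<^sup>2)"

lemma exp_sums_field: "(\<lambda>n. (x::'a::{banach,real_normed_field}) ^ n / fact n) sums exp x"
  using exp_converges[of x] by (simp add: scaleR_conv_of_real field_simps)

lemma norm_bessel0_term_le:
  "norm ((w / 2) ^ (2 * n) / (fact n)\<^sup>2 :: 'a::real_normed_field) \<le> ((norm w)\<^sup>2 / 4) ^ n / fact n"
proof -
  have "norm ((w / 2) ^ (2 * n) / (fact n)\<^sup>2) = ((norm w)\<^sup>2 / 4) ^ n / (fact n)\<^sup>2"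
    by (simp add: norm_divide norm_power norm_mult power_mult power_divide)
  also have "\<dots> \<le> ((norm w)\<^sup>2 / 4) ^ n / fact n"
    by (rule divide_left_mono) (auto simp: power2_eq_square fact_ge_1)
  finally show ?thesis .
qed

lemma bessel0_sums: "(\<lambda>n. (w / 2) ^ (2 * n) / (fact n)\<^sup>2) sums bessel0 w"
  unfolding bessel0_def
  by (rule summable_sums, rule summable_comparison_test'[OF sums_summable[OF exp_sums_field[of "(norm w)\<^sup>2 / 4"]], of 0])
     (rule norm_bessel0_term_le)

lemma bessel0_of_real: "bessel0 (of_real x :: complex) = of_real (bessel0 x)"
proof -
  have "(\<lambda>n. of_real ((x / 2) ^ (2 * n) / (fact n)\<^sup>2) :: complex) sums of_real (bessel0 x)"
    by (rule sums_of_real[OF bessel0_sums])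
  moreover have "(\<lambda>n. of_real ((x / 2) ^ (2 * n) / (fact n)\<^sup>2) :: complex) sums bessel0 (of_real x)"
    using bessel0_sums[of "of_real x :: complex"] by simp
  ultimately show ?thesis by (rule sums_unique2[symmetric])
qed

lemma bessel0_pos: "bessel0 (x::real) > 0"
  unfolding bessel0_def
proof (rule suminf_pos2[of _ 0])
  show "summable (\<lambda>n. (x / 2) ^ (2 * n) / (fact n)\<^sup>2)" using bessel0_sums by (rule sums_summable)
qed auto

lemma bessel0_le_exp: "bessel0 (x::real) \<le> exp (x\<^sup>2 / 4)"
  by (rule sums_le[OF _ bessel0_sums exp_sums_field[of "x\<^sup>2 / 4"]])
     (use norm_bessel0_term_le[of x] in auto)

lemma bessel0_less_exp:
  assumes "x \<noteq> (0::real)"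
  shows "bessel0 x < exp (x\<^sup>2 / 4)"
proof -
  let ?f = "\<lambda>n. (x\<^sup>2 / 4) ^ n / fact n - (x / 2) ^ (2 * n) / (fact n)\<^sup>2"
  have s: "?f sums (exp (x\<^sup>2 / 4) - bessel0 x)"
    by (intro sums_diff bessel0_sums exp_sums_field)
  have "suminf ?f > 0"
  proof (rule suminf_pos2[of _ 2])
    show "summable ?f" using s by (rule sums_summable)
    show "0 \<le> ?f n" for n using norm_bessel0_term_le[of x n] by auto
    have "?f 2 = x ^ 4 / 64" by (simp add: fact_numeral power_divide eval_nat_numeral)
    moreover have "x ^ 4 / 64 > 0" using assms by (simp add: zero_less_power_eq)
    ultimately show "0 < ?f 2" by (simp only:)
  qed
  then show ?thesis using s by (simp add: sums_iff)
qed

lemma continuous_on_bessel0: "continuous_on UNIV (bessel0 :: complex \<Rightarrow> complex)"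
proof -
  have "continuous_on (cball 0 r) (bessel0 :: complex \<Rightarrow> complex)" for r
  proof (rule uniform_limit_theorem)
    show "uniform_limit (cball 0 r) (\<lambda>n w. \<Sum>i<n. (w / 2) ^ (2 * i) / (fact i)\<^sup>2) (bessel0::complex \<Rightarrow> complex) sequentially"
      unfolding bessel0_def
    proof (rule Weierstrass_m_test)
      show "summable (\<lambda>n. (r\<^sup>2 / 4) ^ n / fact n)" using exp_sums_field by (rule sums_summable)
      fix n and w :: complex assume "w \<in> cball 0 r"
      then have "((norm w)\<^sup>2 / 4) ^ n / fact n \<le> (r\<^sup>2 / 4) ^ n / fact n"
        by (intro divide_right_mono power_mono) auto
      then show "norm ((w / 2) ^ (2 * n) / (fact n)\<^sup>2) \<le> (r\<^sup>2 / 4) ^ n / fact n"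
        using norm_bessel0_term_le[of w n] by linarith
    qed
  qed (auto intro!: always_eventually continuous_intros)
  then have "continuous_on (ball 0 r) (bessel0 :: complex \<Rightarrow> complex)" for r
    by (rule continuous_on_subset) (rule ball_subset_cball)
  then have "isCont (bessel0 :: complex \<Rightarrow> complex) w" for w
    by (rule continuous_on_interior[of "ball 0 (norm w + 1)"]) (simp add: interior_open)
  then show ?thesis by (simp add: continuous_at_imp_continuous_on)
qed

lemma expectation_cos_power:
  "integral\<^sup>L circle (\<lambda>t. of_real ((2 * cos t) ^ n) :: complex) = (if even n then of_nat (n choose (n div 2)) else 0)"
proof -
  have "of_real ((2 * cos t) ^ n) = (\<Sum>k\<le>n. of_nat (n choose k) * iexp (of_int (2 * int k - int n) * t))" for t
  proof -
    have "complex_of_real (2 * cos t) = iexp t + exp (- \<i> * of_real t)"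
      by (simp add: cos_exp_eq flip: cos_of_real)
    then have "of_real ((2 * cos t) ^ n) = (iexp t + exp (- \<i> * of_real t)) ^ n"
      by (simp only: of_real_power)
    also have "\<dots> = (\<Sum>k\<le>n. of_nat (n choose k) * iexp t ^ k * exp (- \<i> * of_real t) ^ (n - k))"
      by (rule binomial_ring)
    also have "\<dots> = (\<Sum>k\<le>n. of_nat (n choose k) * iexp (of_int (2 * int k - int n) * t))"
    proof (rule sum.cong)
      fix k assume "k \<in> {..n}"
      then have "iexp t ^ k * exp (- \<i> * of_real t) ^ (n - k) = iexp (of_int (2 * int k - int n) * t)"
        by (simp add: exp_of_nat_mult[symmetric] exp_add[symmetric] of_nat_diff algebra_simps)
      then show "of_nat (n choose k) * iexp t ^ k * exp (- \<i> * of_real t) ^ (n - k) 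
        = of_nat (n choose k) * iexp (of_int (2 * int k - int n) * t)" by (simp only: mult.assoc)
    qed simp
    finally show ?thesis .
  qed
  then have "integral\<^sup>L circle (\<lambda>t. of_real ((2 * cos t) ^ n) :: complex)
    = (\<Sum>k\<le>n. integral\<^sup>L circle (\<lambda>t. of_nat (n choose k) * iexp (of_int (2 * int k - int n) * t)))"
    by (simp only:) (intro Bochner_Integration.integral_sum integrable_mult_right circle.integrable_const_bound[where B=1], auto)
  also have "\<dots> = (\<Sum>k\<le>n. if k = n div 2 \<and> even n then of_nat (n choose k) else 0)"
    by (intro sum.cong refl) (simp only: integral_mult_right_zero expectation_circle_character, auto, presburger)
  also have "\<dots> = (if even n then of_nat (n choose (n div 2)) else 0)"
    by simp
  finally show ?thesis .
qed

text \<open>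
  Expanding \<open>(2 cos t)^n\<close> in characters leaves the central binomial coefficient, and
  \<open>(2m choose m) / (2m)! = 1 / (m!)\<^sup>2\<close> turns the exponential series into the Bessel series.
\<close>

lemma expectation_exp_cos: "integral\<^sup>L circle (\<lambda>t. exp (w * of_real (cos t))) = bessel0 (w::complex)"
proof -
  let ?f = "\<lambda>n t. (w * of_real (cos t)) ^ n / fact n"
  have bnd: "norm (?f n t) \<le> norm w ^ n / fact n" for n t
    by (auto simp: norm_divide norm_power norm_mult power_mult_distrib mult_left_le power_le_one intro!: divide_right_mono)
  have int: "integrable circle (?f n)" for n
    by (rule circle.integrable_const_bound[where B="norm w ^ n / fact n"]) (use bnd in auto)
  have "(\<lambda>n. integral\<^sup>L circle (?f n)) sums (\<integral>t. (\<Sum>n. ?f n t) \<partial>circle)"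
  proof (rule sums_integral[OF int])
    show "AE t in circle. summable (\<lambda>n. norm (?f n t))"
      using bnd by (intro AE_I2 summable_comparison_test'[OF sums_summable[OF exp_sums_field[of "norm w"]], of 0]) auto
    show "summable (\<lambda>n. \<integral>t. norm (?f n t) \<partial>circle)"
    proof (rule summable_comparison_test'[OF sums_summable[OF exp_sums_field[of "norm w"]], of 0])
      fix n
      have "(\<integral>t. norm (?f n t) \<partial>circle) \<le> (\<integral>t. norm w ^ n / fact n \<partial>circle)"
        by (rule integral_mono) (use int bnd in auto)
      then show "norm (\<integral>t. norm (?f n t) \<partial>circle) \<le> norm w ^ n / fact n"
        using circle.prob_space by simp
    qed
  qed
  moreover have "(\<Sum>n. ?f n t) = exp (w * of_real (cos t))" for t
    by (rule sums_unique[OF exp_sums_field, symmetric])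
  moreover have "integral\<^sup>L circle (?f n) = (if even n then (w / 2) ^ n / (fact (n div 2))\<^sup>2 else 0)" for n
  proof -
    have "?f n t = (w / 2) ^ n / fact n * of_real ((2 * cos t) ^ n)" for t
      by (simp add: power_mult_distrib power_divide)
    then have "integral\<^sup>L circle (?f n) = (w / 2) ^ n / fact n * integral\<^sup>L circle (\<lambda>t. of_real ((2 * cos t) ^ n))"
      by (simp only: integral_mult_right_zero)
    also have "\<dots> = (if even n then (w / 2) ^ n / (fact (n div 2))\<^sup>2 else 0)"
    proof (cases "even n")
      case True
      then obtain m where m: "n = 2 * m" by auto
      have "of_nat (n choose m) = (fact n / (fact m * fact m) :: complex)"
        unfolding m by (subst binomial_fact) (auto simp: mult_2)
      then show ?thesis using m unfolding expectation_cos_power by (simp add: power2_eq_square)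
    qed (use expectation_cos_power[of n] in simp)
    finally show ?thesis .
  qed
  ultimately have "(\<lambda>n. if even n then (w / 2) ^ n / (fact (n div 2))\<^sup>2 else 0) sums integral\<^sup>L circle (\<lambda>t. exp (w * of_real (cos t)))"
    by simp
  then have "(\<lambda>n. (if even (2 * n) then (w / 2) ^ (2 * n) / (fact (2 * n div 2))\<^sup>2 else 0)) sums integral\<^sup>L circle (\<lambda>t. exp (w * of_real (cos t)))"
    by (subst sums_mono_reindex[of "\<lambda>n. 2 * n"]) (auto simp: strict_mono_def elim: oddE evenE)
  then have "(\<lambda>n. (w / 2) ^ (2 * n) / (fact n)\<^sup>2) sums integral\<^sup>L circle (\<lambda>t. exp (w * of_real (cos t)))" by simp
  then show ?thesis using bessel0_sums by (rule sums_unique2)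
qed

text \<open>
  The quotient of the exponential moment of \<open>cos \<theta> / sqrt p\<close> by that of a Gaussian variable of
  the same variance \<open>1 / (2 p)\<close>.
\<close>

definition local_factor :: "nat \<Rightarrow> complex \<Rightarrow> complex" where
  "local_factor p z = bessel0 (z / of_real (sqrt p)) * exp (- (z\<^sup>2 / (4 * of_nat p)))"

lemma norm_bessel0_minus_quadratic_le:
  "norm (bessel0 w - (1 + w\<^sup>2 / 4)) \<le> norm w ^ 4 * exp ((norm w)\<^sup>2 / 4)" for w :: complex
proof -
  let ?g = "\<lambda>n. (w / 2) ^ (2 * n) / (fact n)\<^sup>2"
  let ?h = "\<lambda>n. norm w ^ 4 * (((norm w)\<^sup>2 / 4) ^ n / fact n)"
  have "(\<lambda>n. ?g (n + 2)) sums (bessel0 w - (\<Sum>i<2. ?g i))"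
    using bessel0_sums by (rule sums_split_initial_segment)
  also have "(\<Sum>i<2. ?g i) = 1 + w\<^sup>2 / 4" by (simp add: numeral_2_eq_2 power_divide)
  finally have s: "(\<lambda>n. ?g (n + 2)) sums (bessel0 w - (1 + w\<^sup>2 / 4))" .
  have h: "?h sums (norm w ^ 4 * exp ((norm w)\<^sup>2 / 4))"
    by (intro sums_mult exp_sums_field)
  have "norm (?g (n + 2)) \<le> ?h n" for n
  proof -
    have "norm (?g (n + 2)) \<le> ((norm w)\<^sup>2 / 4) ^ (n + 2) / fact (n + 2)"
      by (rule norm_bessel0_term_le)
    also have "\<dots> \<le> ((norm w)\<^sup>2 / 4) ^ (n + 2) / fact n"
      by (intro divide_left_mono fact_mono) auto
    also have "\<dots> = norm w ^ 4 / 16 * (((norm w)\<^sup>2 / 4) ^ n / fact n)"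
      by (simp add: power_divide power_add power_mult_distrib eval_nat_numeral)
    also have "\<dots> \<le> ?h n" by (intro mult_right_mono) auto
    finally show ?thesis .
  qed
  then show ?thesis
    unfolding sums_unique[OF s] sums_unique[OF h]
    by (intro norm_suminf_le sums_summable[OF h])
qed

lemma norm_exp_minus_linear_le: "norm (exp q - (1 + q)) \<le> (norm q)\<^sup>2 * exp (norm q)" for q :: complex
proof -
  have "(\<lambda>n. q ^ (n + 2) / fact (n + 2)) sums (exp q - (\<Sum>i<2. q ^ i / fact i))"
    using exp_sums_field by (rule sums_split_initial_segment)
  also have "(\<Sum>i<2. q ^ i / fact i) = 1 + q" by (simp add: numeral_2_eq_2)
  finally have s: "(\<lambda>n. q ^ (n + 2) / fact (n + 2)) sums (exp q - (1 + q))" .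
  have h: "(\<lambda>n. (norm q)\<^sup>2 * (norm q ^ n / fact n)) sums ((norm q)\<^sup>2 * exp (norm q))"
    by (intro sums_mult exp_sums_field)
  have "norm (q ^ (n + 2) / fact (n + 2)) \<le> (norm q)\<^sup>2 * (norm q ^ n / fact n)" for n
  proof -
    have "norm (q ^ (n + 2) / fact (n + 2)) = norm q ^ (n + 2) / fact (n + 2)"
      by (simp only: norm_divide norm_power norm_fact)
    also have "\<dots> \<le> norm q ^ (n + 2) / fact n"
      by (intro divide_left_mono fact_mono) auto
    finally show ?thesis by (simp only: power_add mult.commute times_divide_eq_right)
  qed
  then show ?thesis
    unfolding sums_unique[OF s] sums_unique[OF h]
    by (intro norm_suminf_le sums_summable[OF h])
qed

text \<open>
  With \<open>w = z / sqrt p\<close> and \<open>q = w\<^sup>2/4\<close>, both \<open>bessel0 w\<close> and \<open>exp q\<close> are \<open>1 + q\<close> up to \<open>O(w^4)\<close>, and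
  \<open>w^4\<close> is of order \<open>1/p\<^sup>2\<close>, which is summable over the primes.
\<close>

lemma norm_local_factor_minus_1_le:
  assumes "norm z \<le> K" "p \<ge> 1"
  shows "norm (local_factor p z - 1) \<le> 3 * K ^ 4 * exp (K\<^sup>2) / (real p)\<^sup>2"
proof -
  define w where "w = z / of_real (sqrt p)"
  define q where "q = w\<^sup>2 / 4"
  have K0: "K \<ge> 0" using assms norm_ge_zero[of z] by linarith
  have w2: "w\<^sup>2 = z\<^sup>2 / of_nat p"
    by (simp add: w_def power_divide flip: of_real_power)
  have nw2: "(norm w)\<^sup>2 = (norm z)\<^sup>2 / real p"
    by (simp add: w_def power_divide norm_divide)
  have nw4: "norm w ^ 4 = norm z ^ 4 / (real p)\<^sup>2"
    using arg_cong[OF nw2, of "\<lambda>x. x\<^sup>2"] by (simp add: power_divide)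
  have lf: "local_factor p z = bessel0 w * exp (- q)"
    by (simp add: local_factor_def w_def[symmetric] q_def w2 mult.commute)
  have le: "(norm w)\<^sup>2 \<le> K\<^sup>2"
  proof -
    have "(norm w)\<^sup>2 \<le> (norm z)\<^sup>2 / 1" unfolding nw2 using assms by (intro divide_left_mono) auto
    also have "\<dots> \<le> K\<^sup>2" using assms by (simp add: power_mono)
    finally show ?thesis .
  qed
  have nq: "norm q = (norm w)\<^sup>2 / 4" by (simp add: q_def norm_divide norm_power)
  have A: "norm (bessel0 w - (1 + q)) \<le> norm w ^ 4 * exp (K\<^sup>2 / 4)"
    using norm_bessel0_minus_quadratic_le[of w] le unfolding q_def
    by (smt (verit, best) exp_le_cancel_iff divide_right_mono mult_left_mono zero_le_power norm_ge_zero)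
  have e: "norm (exp (- q)) \<le> exp (K\<^sup>2 / 4)"
    using complex_Re_le_cmod[of "- q"] nq le by simp
  have B: "norm ((1 + q) * exp (- q) - 1) \<le> norm w ^ 4 * exp (K\<^sup>2)"
  proof -
    have "(1 + q) * exp (- q) - 1 = - (exp (- q) * (exp q - (1 + q)))"
      by (simp add: algebra_simps flip: exp_add)
    then have "norm ((1 + q) * exp (- q) - 1) = norm (exp (- q)) * norm (exp q - (1 + q))"
      by (simp add: norm_mult)
    also have "\<dots> \<le> exp (K\<^sup>2 / 4) * ((norm q)\<^sup>2 * exp (norm q))"
      by (intro mult_mono e norm_exp_minus_linear_le) auto
    also have "\<dots> \<le> exp (K\<^sup>2 / 4) * (norm w ^ 4 * exp (K\<^sup>2 / 4))"
      using le by (intro mult_left_mono mult_mono) (auto simp: nq power_divide)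
    also have "\<dots> = norm w ^ 4 * exp (K\<^sup>2 / 4 + K\<^sup>2 / 4)" unfolding exp_add by simp
    also have "\<dots> \<le> norm w ^ 4 * exp (K\<^sup>2)" by (intro mult_left_mono) auto
    finally show ?thesis .
  qed
  have "local_factor p z - 1 = (bessel0 w - (1 + q)) * exp (- q) + ((1 + q) * exp (- q) - 1)"
    unfolding lf by (simp add: algebra_simps)
  also have "norm \<dots> \<le> norm (bessel0 w - (1 + q)) * norm (exp (- q)) + norm ((1 + q) * exp (- q) - 1)"
    by (rule order_trans[OF norm_triangle_ineq]) (simp add: norm_mult)
  also have "\<dots> \<le> (norm w ^ 4 * exp (K\<^sup>2 / 4)) * exp (K\<^sup>2 / 4) + norm w ^ 4 * exp (K\<^sup>2)"
    by (intro add_mono mult_mono A B e) auto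
  also have "\<dots> \<le> norm w ^ 4 * exp (K\<^sup>2) + norm w ^ 4 * exp (K\<^sup>2)"
    unfolding mult.assoc exp_add[symmetric] by (intro add_mono mult_left_mono order_refl) auto
  also have "\<dots> \<le> 3 * (norm w ^ 4 * exp (K\<^sup>2))" by simp
  also have "\<dots> = 3 * norm z ^ 4 * exp (K\<^sup>2) / (real p)\<^sup>2" by (simp add: nw4)
  also have "\<dots> \<le> 3 * K ^ 4 * exp (K\<^sup>2) / (real p)\<^sup>2"
    using assms by (intro divide_right_mono mult_right_mono mult_left_mono power_mono) auto
  finally show ?thesis .
qed

definition prime_product :: "real \<Rightarrow> complex \<Rightarrow> complex" where
  "prime_product x z = (\<Prod>p\<in>primes_le x. local_factor p z)"

lemma continuous_on_local_factor: "continuous_on A (local_factor p)"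
  unfolding local_factor_def
proof (intro continuous_on_mult)
  show "continuous_on A (\<lambda>z. bessel0 (z / of_real (sqrt p)))"
    by (rule continuous_on_compose2[OF continuous_on_bessel0]) (cases "p = 0", auto intro!: continuous_intros)
  show "continuous_on A (\<lambda>z. exp (- (z\<^sup>2 / (4 * of_nat p))))"
    by (cases "p = 0") (auto intro!: continuous_intros)
qed

text \<open>
  Indexing the product by all natural numbers makes the convergence theorems for infinite products
  applicable.
\<close>

definition padded_factor :: "nat \<Rightarrow> complex \<Rightarrow> complex" where
  "padded_factor n z = (if prime n then local_factor n z else 1)"

lemma prime_product_eq_lessThan:
  assumes "x \<ge> 0"
  shows "prime_product x z = (\<Prod>n<nat \<lfloor>x\<rfloor> + 1. padded_factor n z)"
proof -
  have "n \<le> nat \<lfloor>x\<rfloor> \<longleftrightarrow> real n \<le> x" for n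
    using assms by (simp add: le_nat_iff le_floor_iff)
  then have "primes_le x = {n \<in> {..<nat \<lfloor>x\<rfloor> + 1}. prime n}"
    by (auto simp: primes_le_def less_Suc_eq_le)
  then show ?thesis
    unfolding prime_product_def padded_factor_def by (simp only: prod.inter_filter finite_lessThan)
qed

abbreviation factor_majorant :: "real \<Rightarrow> nat \<Rightarrow> real" where
  "factor_majorant K n \<equiv> 3 * K ^ 4 * exp (K\<^sup>2) * (1 / (real n)\<^sup>2)"

lemma norm_padded_factor_minus_1_le:
  assumes "norm z \<le> K"
  shows "norm (padded_factor n z - 1) \<le> factor_majorant K n"
  using norm_local_factor_minus_1_le[OF assms, of n] prime_ge_1_nat[of n] by (auto simp: padded_factor_def)

lemma summable_padded_majorant: "summable (\<lambda>n. factor_majorant K n)"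
  using inverse_power_summable[of 2, where 'a=real] by (intro summable_mult) (auto simp: inverse_eq_divide)

lemma prime_product_bounded:
  "\<exists>B. \<forall>x (z::complex). norm z \<le> K \<longrightarrow> norm (prime_product x z) \<le> B"
proof (intro exI allI impI)
  fix x and z :: complex assume z: "norm z \<le> K"
  let ?m = "factor_majorant K"
  have "norm (prime_product x z) = (\<Prod>p\<in>primes_le x. norm (padded_factor p z))"
    unfolding prime_product_def by (auto simp: prod_norm padded_factor_def primes_le_def intro!: prod.cong)
  also have "\<dots> \<le> (\<Prod>p\<in>primes_le x. exp (?m p))"
  proof (rule prod_mono, intro conjI)
    fix p
    have "norm (padded_factor p z) \<le> 1 + norm (padded_factor p z - 1)"
      using norm_triangle_ineq[of 1 "padded_factor p z - 1"] by simp
    also have "\<dots> \<le> 1 + ?m p" using norm_padded_factor_minus_1_le[OF z] by simp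
    also have "\<dots> \<le> exp (?m p)" by (rule exp_ge_add_one_self)
    finally show "norm (padded_factor p z) \<le> exp (?m p)" .
  qed simp
  also have "\<dots> = exp (\<Sum>p\<in>primes_le x. ?m p)" by (rule exp_sum[symmetric]) simp
  also have "\<dots> \<le> exp (suminf ?m)"
    unfolding exp_le_cancel_iff by (rule sum_le_suminf[OF summable_padded_majorant]) auto
  finally show "norm (prime_product x z) \<le> exp (suminf ?m)" .
qed

lemma uniformly_convergent_prime_product:
  "uniformly_convergent_on (cball 0 K) (\<lambda>N z. \<Prod>n<N. padded_factor n z)"
proof (rule uniformly_convergent_on_prod')
  show "continuous_on (cball 0 K) (padded_factor n)" for n
    by (cases "prime n") (auto simp: padded_factor_def[abs_def] continuous_on_local_factor)
  show "uniformly_convergent_on (cball 0 K) (\<lambda>N z. \<Sum>n<N. norm (padded_factor n z - 1))"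
    unfolding uniformly_convergent_on_def
    by (rule exI, rule Weierstrass_m_test[OF _ summable_padded_majorant[of K]])
       (use norm_padded_factor_minus_1_le in auto)
qed simp

text \<open>
  The argument \<open>z\<close> may move with \<open>x\<close> because the convergence is uniform on a disc around 0 that contains
  \<open>k\<close> in its interior.  The limit is nonzero because the product converges absolutely and has nonzero
  factors, and it is at most the factor of the prime 2, which is below 1.
\<close>

theorem prime_product_limit:
  assumes "k > (0::real)"
  shows "\<exists>c::real. 0 < c \<and> c < 1 \<and> (\<forall>(F :: 'f filter) x z. filterlim x at_top F \<longrightarrow> (z \<longlongrightarrow> of_real k) F \<longrightarrow>
            ((\<lambda>n. prime_product (x n) (z n)) \<longlongrightarrow> of_real c) F)"
proof -
  define D where "D = cball (0::complex) (k + 1)"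
  define f where "f = (\<lambda>n. if prime n then bessel0 (k / sqrt n) * exp (- (k\<^sup>2 / (4 * real n))) else 1)"
  obtain L where L: "uniform_limit D (\<lambda>N z. \<Prod>n<N. padded_factor n z) L sequentially"
    using uniformly_convergent_prime_product[of "k+1"] unfolding uniformly_convergent_on_def D_def by blast
  have pf: "padded_factor n (of_real k) = of_real (f n)" for n
  proof -
    have "- ((of_real k)\<^sup>2 / (4 * of_nat n)) = complex_of_real (- (k\<^sup>2 / (4 * real n)))" by simp
    then show ?thesis
      unfolding padded_factor_def f_def local_factor_def
      by (simp only: of_real_divide[symmetric] bessel0_of_real exp_of_real of_real_mult of_real_1 split: if_split) simp
  qed
  have fpos: "f n > 0" for n
    unfolding f_def using bessel0_pos by auto
  have f1: "f n < 1" if "prime n" for n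
  proof -
    have n: "real n > 0" using that prime_gt_0_nat by simp
    then have "bessel0 (k / sqrt n) < exp ((k / sqrt n)\<^sup>2 / 4)" using assms by (intro bessel0_less_exp) auto
    also have "(k / sqrt n)\<^sup>2 / 4 = k\<^sup>2 / (4 * real n)" using n by (simp add: power_divide)
    finally show ?thesis using that by (simp add: f_def exp_minus field_simps)
  qed
  then have fle: "f n \<le> 1" for n by (cases "prime n") (auto simp: f_def less_imp_le)
  have summ: "summable (\<lambda>n. norm (f n - 1))"
  proof (rule summable_comparison_test'[OF summable_padded_majorant[of k], of 0])
    fix n
    have "norm (f n - 1) = norm (padded_factor n (of_real k) - 1)"
      unfolding pf by (metis norm_of_real of_real_1 of_real_diff real_norm_def)
    then show "norm (norm (f n - 1)) \<le> factor_majorant k n"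
      using norm_padded_factor_minus_1_le[of "of_real k" k n] assms by simp
  qed
  have conv: "convergent_prod f"
    by (intro abs_convergent_prod_imp_convergent_prod summable_imp_abs_convergent_prod summ)
  define c where "c = prodinf f"
  have lim: "(\<lambda>N. \<Prod>n<N. f n) \<longlonglongrightarrow> c"
    unfolding c_def by (intro has_prod_imp_tendsto' convergent_prod_has_prod conv)
  have c0: "c \<noteq> 0" unfolding c_def by (rule prodinf_nonzero[OF conv]) (use fpos in \<open>simp add: less_imp_neq[symmetric]\<close>)
  have "c \<ge> 0" by (rule tendsto_lowerbound[OF lim]) (auto intro!: always_eventually prod_nonneg simp: fpos less_imp_le)
  with c0 have c_pos: "c > 0" by simp
  have "c \<le> f 2"
  proof (rule tendsto_upperbound[OF lim])
    show "\<forall>\<^sub>F N in sequentially. (\<Prod>n<N. f n) \<le> f 2"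
      using eventually_gt_at_top[of 2]
    proof eventually_elim
      case (elim N)
      have "(\<Prod>n<N. f n) = f 2 * (\<Prod>n\<in>{..<N} - {2}. f n)"
        using elim by (subst prod.remove[of _ 2]) auto
      also have "\<dots> \<le> f 2 * 1"
        using fpos fle by (intro mult_left_mono prod_le_1) (auto simp: less_imp_le)
      finally show ?case by simp
    qed
  qed simp
  also have "\<dots> < 1" by (rule f1) simp
  finally have c_lt: "c < 1" .
  have kD: "of_real k \<in> interior D" using assms by (simp add: D_def)
  have "(\<lambda>N. \<Prod>n<N. padded_factor n (of_real k)) \<longlonglongrightarrow> L (of_real k)"
    using tendsto_uniform_limitI[OF L] kD interior_subset by blast
  moreover have "(\<lambda>N. \<Prod>n<N. padded_factor n (of_real k)) \<longlonglongrightarrow> of_real c"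
    using tendsto_of_real[OF lim, where 'a=complex] by (simp add: pf)
  ultimately have Lk: "L (of_real k) = of_real c" by (rule LIMSEQ_unique)
  have contL: "continuous_on D L"
  proof (rule uniform_limit_theorem[OF _ L])
    show "\<forall>\<^sub>F N in sequentially. continuous_on D (\<lambda>z. \<Prod>n<N. padded_factor n z)"
    proof (intro always_eventually allI continuous_on_prod)
      show "continuous_on D (padded_factor n)" for n
        by (cases "prime n") (auto simp: padded_factor_def[abs_def] continuous_on_local_factor)
    qed
  qed simp
  have "((\<lambda>n. prime_product (x n) (z n)) \<longlongrightarrow> of_real c) F"
    if x: "filterlim x at_top F" and z: "(z \<longlongrightarrow> of_real k) F" for F :: "'f filter" and x z
  proof -
    have zD: "\<forall>\<^sub>F n in F. z n \<in> D"
      using topological_tendstoD[OF z _ kD] interior_subset[of D] by (auto elim: eventually_mono)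
    have "((\<lambda>n. L (z n)) \<longlongrightarrow> of_real c) F"
      using isCont_tendsto_compose[OF continuous_on_interior[OF contL kD] z] Lk by simp
    moreover have "((\<lambda>n. dist (prime_product (x n) (z n)) (L (z n))) \<longlongrightarrow> 0) F"
    proof (rule tendstoI)
      fix e :: real assume e: "e > 0"
      have "\<forall>\<^sub>F N in sequentially. \<forall>z\<in>D. dist (\<Prod>n<N. padded_factor n z) (L z) < e"
        using uniform_limitD[OF L e] .
      then obtain N0 where N0: "\<And>N z. N \<ge> N0 \<Longrightarrow> z \<in> D \<Longrightarrow> dist (\<Prod>n<N. padded_factor n z) (L z) < e"
        unfolding eventually_sequentially by blast
      have "\<forall>\<^sub>F n in F. x n \<ge> real N0" using x by (simp add: filterlim_at_top)
      then show "\<forall>\<^sub>F n in F. dist (dist (prime_product (x n) (z n)) (L (z n))) 0 < e"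
        using zD
      proof eventually_elim
        case (elim n)
        then have "x n \<ge> 0" using of_nat_0_le_iff order_trans by blast
        moreover have "nat \<lfloor>x n\<rfloor> + 1 \<ge> N0" using elim by linarith
        then have "dist (\<Prod>m<nat \<lfloor>x n\<rfloor> + 1. padded_factor m (z n)) (L (z n)) < e"
          using elim(2) by (rule N0)
        ultimately show ?case
          by (simp only: prime_product_eq_lessThan dist_real_def diff_0_right abs_of_nonneg zero_le_dist)
      qed
    qed
    ultimately show ?thesis
      by (rule Lim_transform[OF _ iffD1[OF tendsto_norm_zero_iff, of "\<lambda>n. prime_product (x n) (z n) - L (z n)", folded dist_norm]])
  qed
  then show ?thesis using c_pos c_lt by blast
qed

section \<open>Random phases and the moments of the prime sum\<close>

text \<open>
  One function of the phases serves both models: the prime sum at height \<open>t\<close> has phases \<open>t ln p\<close>, and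
  the random model has independent uniform phases.
\<close>

definition prime_cos_sum :: "real \<Rightarrow> (nat \<Rightarrow> real) \<Rightarrow> real" where
  "prime_cos_sum x \<theta> = (\<Sum>p\<in>primes_le x. cos (\<theta> p) / sqrt p)"

definition prime_variance :: "real \<Rightarrow> real" where
  "prime_variance x = 1 / 2 * (\<Sum>p\<in>primes_le x. 1 / real p)"

definition phase_space :: "real \<Rightarrow> (nat \<Rightarrow> real) measure" where
  "phase_space x = PiM (primes_le x) (\<lambda>_. circle)"

lemma Re_prime_poly: "Re (prime_poly x t) = prime_cos_sum x (\<lambda>p. t * ln p)"
  unfolding prime_poly_def prime_cos_sum_def Re_sum
proof (rule sum.cong[OF refl])
  fix p assume "p \<in> primes_le x"
  then have p: "real p > 0" using primes_le_ge2 by fastforce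
  have "1 / complex_of_nat p powr (1 / 2 + \<i> * of_real t) = exp (- ((1 / 2 + \<i> * of_real t) * of_real (ln p)))"
    using p by (simp add: powr_def exp_minus inverse_eq_divide Ln_of_nat)
  also have "Re \<dots> = exp (- (ln p / 2)) * cos (t * ln p)"
    by (simp add: Re_exp)
  also have "exp (- (ln p / 2)) = 1 / sqrt p"
    using p by (simp add: exp_minus inverse_eq_divide ln_sqrt[symmetric])
  finally show "Re (1 / of_nat p powr (1 / 2 + \<i> * of_real t)) = cos (t * ln p) / sqrt p" by simp
qed

interpretation phases: product_prob_space "\<lambda>_::nat. circle" "primes_le x" for x
  by unfold_locales

lemma prob_space_phase_space: "prob_space (phase_space x)"
  unfolding phase_space_def by (rule prob_space_PiM) (rule circle.prob_space_axioms)

lemma prime_cos_sum_measurable [measurable]: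
  "prime_cos_sum x \<in> borel_measurable (phase_space x)"
  unfolding prime_cos_sum_def[abs_def] phase_space_def by measurable

lemma abs_prime_cos_sum_le: "\<bar>prime_cos_sum x \<theta>\<bar> \<le> (\<Sum>p\<in>primes_le x. 1 / sqrt p)"
  unfolding prime_cos_sum_def by (rule sum_abs[THEN order_trans], rule sum_mono) (auto simp: abs_mult intro!: divide_right_mono)

lemma expectation_exp_prime_cos_sum_eq_prod:
  fixes z :: complex
  shows "integral\<^sup>L (phase_space x) (\<lambda>\<theta>. exp (z * of_real (prime_cos_sum x \<theta>))) = (\<Prod>p\<in>primes_le x. bessel0 (z / of_real (sqrt p)))"
proof -
  have "integral\<^sup>L (phase_space x) (\<lambda>\<theta>. exp (z * of_real (prime_cos_sum x \<theta>)))
     = integral\<^sup>L (phase_space x) (\<lambda>\<theta>. \<Prod>p\<in>primes_le x. exp (z / of_real (sqrt p) * of_real (cos (\<theta> p))))"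
    by (simp add: prime_cos_sum_def sum_distrib_left exp_sum)
  also have "\<dots> = (\<Prod>p\<in>primes_le x. integral\<^sup>L circle (\<lambda>t. exp (z / of_real (sqrt p) * of_real (cos t))))"
    unfolding phase_space_def
  proof (rule phases.product_integral_prod)
    fix p
    show "integrable circle (\<lambda>t. exp (z / of_real (sqrt p) * of_real (cos t)))"
    proof (rule circle.integrable_const_bound[where B="exp (norm (z / of_real (sqrt p)))"], rule AE_I2)
      fix t
      have "Re (z / of_real (sqrt p) * of_real (cos t)) \<le> norm (z / of_real (sqrt p) * of_real (cos t))"
        by (rule complex_Re_le_cmod)
      also have "\<dots> \<le> norm (z / of_real (sqrt p))"
        unfolding norm_mult by (rule mult_left_le) auto
      finally show "norm (exp (z / of_real (sqrt p) * of_real (cos t))) \<le> exp (norm (z / of_real (sqrt p)))" by simp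
    qed measurable
  qed simp
  finally show ?thesis by (simp only: expectation_exp_cos)
qed

lemma expectation_exp_prime_cos_sum:
  fixes z :: complex
  shows "integral\<^sup>L (phase_space x) (\<lambda>\<theta>. exp (z * of_real (prime_cos_sum x \<theta>)))
     = exp (z\<^sup>2 * of_real (prime_variance x) / 2) * prime_product x z"
proof -
  have "exp (z\<^sup>2 * of_real (prime_variance x) / 2) = exp (\<Sum>p\<in>primes_le x. z\<^sup>2 / (4 * of_nat p))"
    by (simp add: prime_variance_def sum_distrib_left sum_divide_distrib)
  then have "exp (z\<^sup>2 * of_real (prime_variance x) / 2) * prime_product x z
     = (\<Prod>p\<in>primes_le x. exp (z\<^sup>2 / (4 * of_nat p)) * local_factor p z)"
    by (simp add: exp_sum prime_product_def prod.distrib)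
  also have "\<dots> = (\<Prod>p\<in>primes_le x. bessel0 (z / of_real (sqrt p)))"
    by (intro prod.cong refl) (simp add: local_factor_def exp_minus)
  finally show ?thesis by (simp add: expectation_exp_prime_cos_sum_eq_prod)
qed

text \<open>
  This is where the inequality \<open>bessel0 x \<le> exp (x\<^sup>2/4)\<close> is used at full strength: the random model is
  dominated by the Gaussian with the same variance, which controls all its moments.
\<close>

lemma prime_cos_sum_subgaussian:
  "integral\<^sup>L (phase_space x) (\<lambda>\<theta>. exp (r * prime_cos_sum x \<theta>)) \<le> exp (r\<^sup>2 * prime_variance x / 2)"
proof -
  have "complex_of_real (integral\<^sup>L (phase_space x) (\<lambda>\<theta>. exp (r * prime_cos_sum x \<theta>)))
    = integral\<^sup>L (phase_space x) (\<lambda>\<theta>. exp (of_real r * of_real (prime_cos_sum x \<theta>)))"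
    by (simp flip: integral_complex_of_real exp_of_real)
  also have "\<dots> = of_real (\<Prod>p\<in>primes_le x. bessel0 (r / sqrt p))"
    unfolding expectation_exp_prime_cos_sum_eq_prod of_real_prod by (simp flip: bessel0_of_real)
  finally have "integral\<^sup>L (phase_space x) (\<lambda>\<theta>. exp (r * prime_cos_sum x \<theta>)) = (\<Prod>p\<in>primes_le x. bessel0 (r / sqrt p))"
    by (simp only: of_real_eq_iff)
  also have "\<dots> \<le> (\<Prod>p\<in>primes_le x. exp ((r / sqrt p)\<^sup>2 / 4))"
    by (intro prod_mono) (auto intro: bessel0_le_exp less_imp_le[OF bessel0_pos])
  also have "\<dots> = exp (r\<^sup>2 * prime_variance x / 2)"
    by (simp add: exp_sum[symmetric] power_divide prime_variance_def sum_distrib_left sum_distrib_right sum_divide_distrib mult_ac)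
  finally show ?thesis .
qed

text \<open>
  A term of the expanded \<open>l\<close>-th power picks \<open>l\<close> signed primes \<open>f 0, ..., f (l-1)\<close>, and a sign \<open>e\<close>
  contributes the phase \<open>e \<theta>_p\<close>; the total phase depends on \<open>f\<close> only through these multiplicities.
\<close>

definition net_exponent :: "nat \<Rightarrow> (nat \<Rightarrow> nat \<times> int) \<Rightarrow> nat \<Rightarrow> int" where
  "net_exponent l f p = (\<Sum>i<l. if fst (f i) = p then snd (f i) else 0)"

abbreviation signed_primes :: "real \<Rightarrow> (nat \<times> int) set" where
  "signed_primes x \<equiv> primes_le x \<times> {1, -1}"

abbreviation prime_choices :: "real \<Rightarrow> nat \<Rightarrow> (nat \<Rightarrow> nat \<times> int) set" where
  "prime_choices x l \<equiv> PiE {..<l} (\<lambda>_. signed_primes x)"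

abbreviation net_phase :: "real \<Rightarrow> nat \<Rightarrow> (nat \<Rightarrow> nat \<times> int) \<Rightarrow> (nat \<Rightarrow> real) \<Rightarrow> real" where
  "net_phase x l f \<theta> \<equiv> (\<Sum>p\<in>primes_le x. of_int (net_exponent l f p) * \<theta> p)"

lemma sum_net_exponent:
  assumes "f \<in> prime_choices x l"
  shows "net_phase x l f \<alpha> = (\<Sum>i<l. of_int (snd (f i)) * \<alpha> (fst (f i)) :: real)"
proof -
  have "net_phase x l f \<alpha>
     = (\<Sum>p\<in>primes_le x. \<Sum>i<l. if fst (f i) = p then of_int (snd (f i)) * \<alpha> p else 0)"
    by (simp add: net_exponent_def sum_distrib_right if_distrib[of real_of_int] if_distrib[of "\<lambda>x. x * _"] cong: if_cong)
  also have "\<dots> = (\<Sum>i<l. \<Sum>p\<in>primes_le x. if fst (f i) = p then of_int (snd (f i)) * \<alpha> p else 0)"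
    by (rule sum.swap)
  also have "\<dots> = (\<Sum>i<l. of_int (snd (f i)) * \<alpha> (fst (f i)))"
    by (intro sum.cong refl) (use assms in \<open>force simp: PiE_def Pi_def\<close>)
  finally show ?thesis .
qed

lemma multiplicity_prod_primes:
  assumes "finite I" "\<And>i. i \<in> I \<Longrightarrow> prime (g i)" "prime (q::nat)"
  shows "multiplicity q (\<Prod>i\<in>I. g i) = card {i \<in> I. g i = q}"
proof -
  have n0: "0 \<notin> g ` I" using assms(2) by (metis imageE not_prime_0)
  have "multiplicity q (\<Prod>i\<in>I. g i) = (\<Sum>i\<in>I. multiplicity q (g i))"
    using assms n0 by (subst prime_elem_multiplicity_prod_distrib) auto
  also have "\<dots> = (\<Sum>i\<in>I. if g i = q then 1 else 0)"
    using assms by (intro sum.cong refl) (auto simp: prime_multiplicity_other)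
  also have "\<dots> = card {i \<in> I. g i = q}" using assms by (simp add: sum.If_cases Int_def)
  finally show ?thesis .
qed

lemma abs_ln_diff_ge:
  fixes A B :: nat
  assumes "A \<noteq> B" "A > 0" "B > 0" "real A \<le> Y" "real B \<le> Y"
  shows "\<bar>ln A - ln B\<bar> \<ge> 1 / Y"
proof -
  have *: "ln a - ln b \<ge> 1 / Y" if "a > b" "b > 0" "real a \<le> Y" for a b :: nat
  proof -
    have "1 / Y \<le> 1 / real a" using that by (intro divide_left_mono) auto
    also have "\<dots> \<le> 1 - b / a" using that by (simp add: field_simps)
    also have "\<dots> \<le> - ln (b / a)" using ln_le_minus_one[of "b / a"] that by simp
    also have "\<dots> = ln a - ln b" using that by (simp add: ln_div)
    finally show ?thesis .
  qed
  show ?thesis using *[of A B] *[of B A] assms by (cases A B rule: linorder_cases) auto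
qed

text \<open>
  The frequency is \<open>ln A - ln B\<close>, where \<open>A\<close> and \<open>B\<close> are the products of the primes taken with sign \<open>1\<close>
  and \<open>-1\<close>.  Unique factorisation gives \<open>A \<noteq> B\<close>, and both are integers of size at most \<open>x^l\<close>.
\<close>

lemma abs_log_frequency_ge:
  assumes f: "f \<in> prime_choices x l" and x: "x \<ge> 1"
    and q: "q \<in> primes_le x" "net_exponent l f q \<noteq> 0"
  shows "\<bar>net_phase x l f (\<lambda>p. ln (real p))\<bar> \<ge> 1 / x ^ l"
proof -
  define I where "I = (\<lambda>e::int. {i \<in> {..<l}. snd (f i) = e})"
  define A where "A = (\<lambda>e. \<Prod>i\<in>I e. fst (f i))"
  have fi: "fst (f i) \<in> primes_le x" "snd (f i) = 1 \<or> snd (f i) = -1" if "i < l" for i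
    using f that by (auto simp: PiE_def Pi_def mem_Times_iff)
  have I_fin: "finite (I e)" for e by (simp add: I_def)
  have split: "{..<l} = I 1 \<union> I (-1)" "I 1 \<inter> I (-1) = {}" using fi(2) by (auto simp: I_def)
  have pr: "prime (fst (f i))" "fst (f i) > 0" "real (fst (f i)) \<le> x" if "i \<in> I e" for i e
  proof -
    show "prime (fst (f i))" "real (fst (f i)) \<le> x"
      using fi(1)[of i] that by (auto simp: I_def primes_le_def)
    then show "fst (f i) > 0" by (intro prime_gt_0_nat)
  qed
  have Apos: "A e > 0" for e unfolding A_def using pr by (intro prod_pos) auto
  have Ale: "real (A e) \<le> x ^ l" for e
  proof -
    have "real (A e) \<le> (\<Prod>i\<in>I e. x)" unfolding A_def of_nat_prod using pr by (intro prod_mono) auto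
    also have "\<dots> = x ^ card (I e)" by simp
    also have "\<dots> \<le> x ^ l" using card_mono[of "{..<l}" "I e"] x by (intro power_increasing) (auto simp: I_def)
    finally show ?thesis .
  qed
  have lnA: "ln (A e) = (\<Sum>i\<in>I e. ln (fst (f i)))" for e
    unfolding A_def of_nat_prod by (rule ln_prod) (use I_fin pr in auto)
  have "net_phase x l f (\<lambda>p. ln (real p)) = (\<Sum>i<l. of_int (snd (f i)) * ln (fst (f i)))"
    by (rule sum_net_exponent[OF f])
  also have "\<dots> = (\<Sum>i\<in>I 1. of_int (snd (f i)) * ln (fst (f i))) + (\<Sum>i\<in>I (-1). of_int (snd (f i)) * ln (fst (f i)))"
    unfolding split(1) by (rule sum.union_disjoint) (use I_fin split in auto)
  also have "\<dots> = ln (A 1) - ln (A (-1))"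
    unfolding lnA by (simp add: I_def sum_negf)
  finally have eq: "net_phase x l f (\<lambda>p. ln (real p)) = ln (A 1) - ln (A (-1))" .
  have "A 1 \<noteq> A (-1)"
  proof
    assume AA: "A 1 = A (-1)"
    have "multiplicity q (A e) = card {i \<in> I e. fst (f i) = q}" for e
      unfolding A_def by (rule multiplicity_prod_primes[OF I_fin pr(1) primes_le_prime[OF q(1)]])
    from this[of 1] this[of "-1"] AA have c: "card {i \<in> I 1. fst (f i) = q} = card {i \<in> I (-1). fst (f i) = q}"
      by (simp only:)
    have "net_exponent l f q = (\<Sum>i\<in>I 1. if fst (f i) = q then snd (f i) else 0) + (\<Sum>i\<in>I (-1). if fst (f i) = q then snd (f i) else 0)"
      unfolding net_exponent_def split(1) by (rule sum.union_disjoint) (use I_fin split in auto)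
    also have "\<dots> = (\<Sum>i\<in>I 1. if fst (f i) = q then 1 else 0) + (\<Sum>i\<in>I (-1). if fst (f i) = q then -1 else 0)"
      by (intro arg_cong2[where f="(+)"] sum.cong refl) (auto simp: I_def)
    also have "\<dots> = 0" using c I_fin by (simp add: sum.If_cases Int_def)
    finally show False using q by simp
  qed
  then show ?thesis unfolding eq by (rule abs_ln_diff_ge[OF _ Apos Apos Ale Ale])
qed

definition term_weight :: "nat \<Rightarrow> (nat \<Rightarrow> nat \<times> int) \<Rightarrow> real" where
  "term_weight l f = (\<Prod>i<l. 1 / (2 * sqrt (fst (f i))))"

lemma prime_cos_sum_power_expand:
  "of_real (prime_cos_sum x \<theta> ^ l) = (\<Sum>f\<in>prime_choices x l.
      of_real (term_weight l f) * iexp (net_phase x l f \<theta>))"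
proof -
  let ?g = "\<lambda>j::nat \<times> int. of_real (1 / (2 * sqrt (real (fst j)))) * iexp (of_int (snd j) * \<theta> (fst j))"
  have "complex_of_real (prime_cos_sum x \<theta>) = (\<Sum>p\<in>primes_le x. \<Sum>e\<in>{1,-1}. ?g (p, e))"
    unfolding prime_cos_sum_def of_real_sum
    by (intro sum.cong refl) (simp add: cos_of_real[symmetric] cos_exp_eq add_divide_distrib)
  also have "\<dots> = (\<Sum>j\<in>signed_primes x. ?g j)"
    unfolding sum.cartesian_product by (rule sum.cong) auto
  finally have "of_real (prime_cos_sum x \<theta> ^ l) = (\<Prod>i<l. \<Sum>j\<in>signed_primes x. ?g j)"
    by simp
  also have "\<dots> = (\<Sum>f\<in>prime_choices x l. \<Prod>i<l. ?g (f i))"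
    by (rule prod_sum_PiE) auto
  also have "\<dots> = (\<Sum>f\<in>prime_choices x l.
      of_real (term_weight l f) * iexp (net_phase x l f \<theta>))"
  proof (intro sum.cong refl)
    fix f assume f: "f \<in> prime_choices x l"
    show "(\<Prod>i<l. ?g (f i)) = of_real (term_weight l f) * iexp (net_phase x l f \<theta>)"
      unfolding sum_net_exponent[OF f] prod.distrib term_weight_def of_real_prod of_real_sum sum_distrib_left by (simp add: exp_sum)
  qed
  finally show ?thesis .
qed

lemma sum_term_weight: "(\<Sum>f\<in>prime_choices x l. term_weight l f) = (\<Sum>p\<in>primes_le x. 1 / sqrt p) ^ l"
proof -
  have "(\<Sum>p\<in>primes_le x. 1 / sqrt p) = (\<Sum>p\<in>primes_le x. \<Sum>e\<in>{1,-1::int}. 1 / (2 * sqrt p))"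
    by (intro sum.cong refl) simp
  also have "\<dots> = (\<Sum>j\<in>signed_primes x. 1 / (2 * sqrt (real (fst j))))"
    unfolding sum.cartesian_product by (rule sum.cong) auto
  finally have "(\<Sum>p\<in>primes_le x. 1 / sqrt p) ^ l = (\<Prod>i<l. \<Sum>j\<in>signed_primes x. 1 / (2 * sqrt (real (fst j))))"
    by simp
  also have "\<dots> = (\<Sum>f\<in>prime_choices x l. \<Prod>i<l. 1 / (2 * sqrt (fst (f i))))"
    by (rule prod_sum_PiE) auto
  finally show ?thesis by (simp add: term_weight_def)
qed

lemma sum_inverse_sqrt_primes_le: "x \<ge> 1 \<Longrightarrow> (\<Sum>p\<in>primes_le x. 1 / sqrt p) \<le> x"
proof -
  assume x: "x \<ge> 1"
  have "(\<Sum>p\<in>primes_le x. 1 / sqrt p) \<le> (\<Sum>p\<in>primes_le x. 1)"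
  proof (rule sum_mono)
    fix p assume "p \<in> primes_le x"
    then have "real p \<ge> 1" using primes_le_ge2 by fastforce
    then show "1 / sqrt p \<le> 1" by simp
  qed
  also have "\<dots> = real (card (primes_le x))" by simp
  also have "\<dots> \<le> real (card {1..nat \<lfloor>x\<rfloor>})"
    using x by (intro of_nat_mono card_mono) (auto simp: primes_le_def le_nat_floor dest: prime_ge_1_nat)
  also have "\<dots> \<le> x" using x by simp
  finally show ?thesis .
qed

text \<open>
  Terms with vanishing net exponents contribute equally to both sides.  All others have mean 0 in
  the random model and mean \<open>O(x^l / T)\<close> over \<open>[T, 2T]\<close>; the weights add up to at most \<open>x^l\<close>.
\<close>

theorem moments_close:
  assumes x: "x \<ge> 1" and T: "T > 0"
  shows "\<bar>integral\<^sup>L (interval_unif T (2 * T)) (\<lambda>t. prime_cos_sum x (\<lambda>p. t * ln p) ^ l)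
          - integral\<^sup>L (phase_space x) (\<lambda>\<theta>. prime_cos_sum x \<theta> ^ l)\<bar> \<le> 2 * x ^ (2 * l) / T"
proof -
  let ?U = "interval_unif T (2 * T)"
  let ?F = "prime_choices x l"
  interpret U: prob_space ?U by (rule prob_space_interval_unif) (use T in simp)
  interpret Ph: prob_space "phase_space x" by (rule prob_space_phase_space)
  define a where "a = (\<lambda>f. integral\<^sup>L ?U (\<lambda>t. iexp (net_phase x l f (\<lambda>p. t * ln p))))"
  define b where "b = (\<lambda>f. integral\<^sup>L (phase_space x) (\<lambda>\<theta>. iexp (net_phase x l f \<theta>)))"
  have A: "of_real (integral\<^sup>L ?U (\<lambda>t. prime_cos_sum x (\<lambda>p. t * ln p) ^ l)) = (\<Sum>f\<in>?F. of_real (term_weight l f) * a f)"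
    unfolding a_def integral_complex_of_real[symmetric] prime_cos_sum_power_expand
  proof (subst Bochner_Integration.integral_sum)
    fix f
    show "integrable ?U (\<lambda>t. of_real (term_weight l f) * iexp (net_phase x l f (\<lambda>p. t * ln p)))"
      by (intro integrable_mult_right U.integrable_const_bound[where B=1] AE_I2) (simp only: norm_exp_i_times order_refl, measurable)
  qed (simp only: integral_mult_right_zero)
  have m: "(\<lambda>\<theta>. iexp (net_phase x l f \<theta>)) \<in> borel_measurable (phase_space x)" for f
    unfolding phase_space_def by measurable
  have B: "of_real (integral\<^sup>L (phase_space x) (\<lambda>\<theta>. prime_cos_sum x \<theta> ^ l)) = (\<Sum>f\<in>?F. of_real (term_weight l f) * b f)"
    unfolding b_def integral_complex_of_real[symmetric] prime_cos_sum_power_expand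
  proof (subst Bochner_Integration.integral_sum)
    fix f
    show "integrable (phase_space x) (\<lambda>\<theta>. of_real (term_weight l f) * iexp (net_phase x l f \<theta>))"
      by (intro integrable_mult_right Ph.integrable_const_bound[where B=1] AE_I2 m) (simp only: norm_exp_i_times order_refl)
  qed (simp only: integral_mult_right_zero)
  have b_eq: "b f = (\<Prod>p\<in>primes_le x. if net_exponent l f p = 0 then 1 else 0)" for f
  proof -
    have "b f = integral\<^sup>L (phase_space x) (\<lambda>\<theta>. \<Prod>p\<in>primes_le x. iexp (of_int (net_exponent l f p) * \<theta> p))"
      unfolding b_def of_real_sum sum_distrib_left by (simp only: exp_sum finite_primes_le)
    also have "\<dots> = (\<Prod>p\<in>primes_le x. integral\<^sup>L circle (\<lambda>t. iexp (of_int (net_exponent l f p) * t)))"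
      unfolding phase_space_def
      by (rule phases.product_integral_prod) (auto intro!: circle.integrable_const_bound[where B=1])
    finally show ?thesis by (simp only: expectation_circle_character)
  qed
  have ab: "norm (a f - b f) \<le> 2 * x ^ l / T" if f: "f \<in> ?F" for f
  proof (cases "\<forall>p\<in>primes_le x. net_exponent l f p = 0")
    case True
    then have "a f = 1" using U.prob_space by (simp add: a_def)
    moreover have "b f = 1" using True by (simp add: b_eq)
    ultimately show ?thesis using x T by simp
  next
    case False
    then obtain q where q: "q \<in> primes_le x" "net_exponent l f q \<noteq> 0" by blast
    define w where "w = net_phase x l f (\<lambda>p. ln (real p))"
    have w: "\<bar>w\<bar> \<ge> 1 / x ^ l" unfolding w_def by (rule abs_log_frequency_ge[OF f x q])
    have xl: "x ^ l > 0" using x by simp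
    then have "1 / x ^ l > 0" by simp
    then have w0: "\<bar>w\<bar> > 0" using w by linarith
    have "a f = integral\<^sup>L ?U (\<lambda>t. iexp (w * t))"
    proof -
      have "(net_phase x l f (\<lambda>p. t * ln p)) = w * t" for t
        unfolding w_def sum_distrib_right by (intro sum.cong refl) simp
      then show ?thesis by (simp only: a_def)
    qed
    then have "norm (a f) \<le> 2 / ((2 * T - T) * \<bar>w\<bar>)"
      using norm_expectation_iexp_interval_unif_le[of T "2 * T" w] T w0 by simp
    also have "\<dots> \<le> 2 / (T * (1 / x ^ l))"
    proof (rule divide_left_mono)
      show "T * (1 / x ^ l) \<le> (2 * T - T) * \<bar>w\<bar>"
        using mult_left_mono[OF w, of T] T by simp
      show "0 < (2 * T - T) * \<bar>w\<bar> * (T * (1 / x ^ l))"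
        using w0 T xl by simp
    qed simp
    also have "\<dots> = 2 * x ^ l / T" by simp
    moreover have "b f = 0" using q unfolding b_eq by auto
    ultimately show ?thesis by simp
  qed
  have "\<bar>integral\<^sup>L ?U (\<lambda>t. prime_cos_sum x (\<lambda>p. t * ln p) ^ l) - integral\<^sup>L (phase_space x) (\<lambda>\<theta>. prime_cos_sum x \<theta> ^ l)\<bar>
    = norm (\<Sum>f\<in>?F. of_real (term_weight l f) * (a f - b f))"
    unfolding right_diff_distrib sum_subtractf A[symmetric] B[symmetric] by (simp flip: of_real_diff)
  also have "\<dots> \<le> (\<Sum>f\<in>?F. term_weight l f * (2 * x ^ l / T))"
  proof (rule sum_norm_le)
    fix f assume "f \<in> ?F"
    moreover have "term_weight l f \<ge> 0" by (auto simp: term_weight_def intro!: prod_nonneg)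
    ultimately show "norm (of_real (term_weight l f) * (a f - b f)) \<le> term_weight l f * (2 * x ^ l / T)"
      using mult_left_mono[OF ab[of f], of "term_weight l f"] by (simp add: norm_mult)
  qed
  also have "\<dots> = (\<Sum>p\<in>primes_le x. 1 / sqrt p) ^ l * (2 * x ^ l / T)"
    by (simp only: sum_term_weight flip: sum_distrib_right)
  also have "\<dots> \<le> x ^ l * (2 * x ^ l / T)"
  proof (rule mult_right_mono)
    show "(\<Sum>p\<in>primes_le x. 1 / sqrt p) ^ l \<le> x ^ l"
      by (rule power_mono[OF sum_inverse_sqrt_primes_le[OF x]]) (simp add: sum_nonneg)
  qed (use x T in simp)
  also have "\<dots> = 2 * (x ^ l * x ^ l) / T" by simp
  also have "x ^ l * x ^ l = x ^ (2 * l)" by (simp only: mult_2 power_add)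
  finally show ?thesis .
qed

section \<open>From moments to truncated exponential moments\<close>

lemma norm_lebesgue_integral_le:
  fixes f :: "'a \<Rightarrow> 'b::{banach, second_countable_topology}"
  assumes "integrable M g" "\<And>x. norm (f x) \<le> g x" "integrable M f"
  shows "norm (integral\<^sup>L M f) \<le> integral\<^sup>L M g"
  by (rule order_trans[OF integral_norm_bound integral_mono[OF integrable_norm[OF assms(3)] assms(1)]])
     (rule assms(2))

definition exp_poly :: "nat \<Rightarrow> complex \<Rightarrow> complex" where
  "exp_poly N w = (\<Sum>l\<le>N. w ^ l / fact l)"

text \<open>
  Every term of order above \<open>N\<close> gains the factor \<open>exp (- N)\<close> when \<open>w\<close> is replaced by \<open>e w\<close>.
\<close>

lemma norm_exp_minus_exp_poly_le:
  "norm (exp w - exp_poly N w) \<le> exp (- real N) * exp (exp 1 * norm w)"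
proof -
  have a: "(\<lambda>n. w ^ (n + Suc N) / fact (n + Suc N)) sums (exp w - exp_poly N w)"
    using exp_sums_field[of w] unfolding exp_poly_def lessThan_Suc_atMost[symmetric] by (rule sums_split_initial_segment)
  define b where "b = (\<lambda>n. exp (- real N) * ((exp 1 * norm w) ^ n / fact n))"
  have b: "b sums (exp (- real N) * exp (exp 1 * norm w))"
    unfolding b_def by (intro sums_mult exp_sums_field)
  have b': "summable (\<lambda>n. b (n + Suc N))"
    using b by (subst summable_iff_shift) (rule sums_summable)
  have bnd: "norm (w ^ (n + Suc N) / fact (n + Suc N)) \<le> b (n + Suc N)" for n
  proof -
    have "1 \<le> exp (- real N) * exp 1 ^ (n + Suc N)"
      by (simp flip: exp_of_nat_mult exp_add)
    then have "1 * (norm w ^ (n + Suc N) / fact (n + Suc N)) \<le> exp (- real N) * exp 1 ^ (n + Suc N) * (norm w ^ (n + Suc N) / fact (n + Suc N))"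
      by (rule mult_right_mono) auto
    then show ?thesis
      unfolding b_def norm_divide norm_power norm_fact power_mult_distrib by (simp only: mult_1 mult.assoc times_divide_eq_right)
  qed
  have "norm (exp w - exp_poly N w) \<le> (\<Sum>n. b (n + Suc N))"
    unfolding sums_unique[OF a] by (rule norm_suminf_le[OF bnd b'])
  also have "\<dots> \<le> suminf b"
    using suminf_minus_initial_segment[OF sums_summable[OF b], of "Suc N"]
     sum_nonneg[of "{..<Suc N}" b] by (auto simp: b_def)
  also have "\<dots> = exp (- real N) * exp (exp 1 * norm w)" using b by (simp add: sums_iff)
  finally show ?thesis .
qed

lemma exp_partial_sum_le_exp: "(\<Sum>l\<le>N. x ^ l / fact l) \<le> exp x" if "x \<ge> 0" for x :: real
  unfolding sums_unique[OF exp_sums_field[of x]]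
  by (rule sum_le_suminf[OF sums_summable[OF exp_sums_field]]) (use that in auto)

text \<open>
  The coupling \<open>2 e K R = N\<close> balances the two cases: for \<open>y\<close> up to \<open>R\<close> the Taylor remainder is at
  most \<open>exp (- N/2)\<close>, while beyond \<open>R\<close> each Taylor term is at most its value at \<open>R\<close> times \<open>(y/R)^N\<close>.
\<close>

lemma truncated_exp_approx:
  fixes y K R :: real and z :: complex
  assumes K: "K > 0" "norm z \<le> K" and R: "R > 0" "2 * exp 1 * K * R = real N" and N: "even N"
  shows "norm (exp (z * of_real y) * indicator {-R..R} y - exp_poly N (z * of_real y))
           \<le> exp (- real N / 2) + exp (real N / 2) * (y / R) ^ N"
proof (cases "y \<in> {-R..R}")
  case True
  have "norm z * \<bar>y\<bar> \<le> K * R" using True K R by (intro mult_mono) auto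
  then have "exp 1 * norm (z * of_real y) \<le> exp 1 * (K * R)" by (simp add: norm_mult)
  also have "\<dots> = real N / 2" using R by simp
  finally have *: "exp (exp 1 * norm (z * of_real y)) \<le> exp (real N / 2)" by simp
  have "norm (exp (z * of_real y) - exp_poly N (z * of_real y)) \<le> exp (- real N) * exp (real N / 2)"
    using norm_exp_minus_exp_poly_le * by (meson order_trans mult_left_mono exp_ge_zero)
  also have "\<dots> = exp (- real N / 2)" by (simp flip: exp_add)
  moreover have "exp (real N / 2) * (y / R) ^ N \<ge> 0" using N by (simp add: zero_le_even_power)
  ultimately show ?thesis using True by simp
next
  case False
  then have y: "\<bar>y\<bar> > R" by auto
  have "norm (exp_poly N (z * of_real y)) \<le> (\<Sum>l\<le>N. norm ((z * of_real y) ^ l / fact l))"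
    unfolding exp_poly_def by (rule norm_sum)
  also have "\<dots> \<le> (\<Sum>l\<le>N. (y / R) ^ N * ((K * R) ^ l / fact l))"
  proof (rule sum_mono)
    fix l assume l: "l \<in> {..N}"
    have "\<bar>y\<bar> ^ l = R ^ l * (\<bar>y\<bar> / R) ^ l" using R by (simp add: power_divide)
    also have "\<dots> \<le> R ^ l * (\<bar>y\<bar> / R) ^ N" 
      using l y R by (intro mult_left_mono power_increasing) auto
    also have "(\<bar>y\<bar> / R) ^ N = (y / R) ^ N" using N R by (simp add: power_divide power_even_abs)
    finally have "norm z ^ l * \<bar>y\<bar> ^ l \<le> K ^ l * (R ^ l * (y / R) ^ N)"
      using K by (intro mult_mono power_mono) auto
    then have "norm z ^ l * \<bar>y\<bar> ^ l / fact l \<le> K ^ l * (R ^ l * (y / R) ^ N) / fact l"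
      by (rule divide_right_mono) simp
    then show "norm ((z * of_real y) ^ l / fact l) \<le> (y / R) ^ N * ((K * R) ^ l / fact l)"
      by (simp add: norm_divide norm_power norm_mult power_mult_distrib mult_ac)
  qed
  also have "\<dots> \<le> (y / R) ^ N * exp (K * R)"
    unfolding sum_distrib_left[symmetric] using N K R by (intro mult_left_mono exp_partial_sum_le_exp) (auto simp: zero_le_even_power)
  also have "\<dots> \<le> (y / R) ^ N * exp (real N / 2)"
  proof (rule mult_left_mono)
    have "1 * (K * R) \<le> exp 1 * (K * R)" using K R by (intro mult_right_mono) auto
    then show "exp (K * R) \<le> exp (real N / 2)" using R by simp
  qed (use N in \<open>auto simp: zero_le_even_power\<close>)
  also have "\<dots> \<le> exp (- real N / 2) + exp (real N / 2) * (y / R) ^ N" by (simp add: mult.commute)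
  finally show ?thesis using False by simp
qed

lemma (in prob_space) integrable_exp_bounded:
  fixes X :: "'a \<Rightarrow> real"
  assumes [measurable]: "X \<in> borel_measurable M" and bdd: "\<And>\<omega>. \<bar>X \<omega>\<bar> \<le> B"
  shows "integrable M (\<lambda>\<omega>. exp (r * X \<omega>))"
proof (rule integrable_const_bound[where B="exp (\<bar>r\<bar> * B)"], rule AE_I2)
  fix \<omega>
  have "r * X \<omega> \<le> \<bar>r\<bar> * \<bar>X \<omega>\<bar>" by (metis abs_ge_self abs_mult)
  also have "\<dots> \<le> \<bar>r\<bar> * B" by (rule mult_left_mono) (use bdd in auto)
  finally show "norm (exp (r * X \<omega>)) \<le> exp (\<bar>r\<bar> * B)" by simp
qed simp

text \<open>
  The bound \<open>(b X)^N / N! \<le> exp (b \<bar>X\<bar>)\<close> is used with a parameter \<open>b\<close> that is free to be optimised.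
\<close>

lemma (in prob_space) expectation_even_power_le:
  fixes X :: "'a \<Rightarrow> real"
  assumes [measurable]: "X \<in> borel_measurable M" and bdd: "\<And>\<omega>. \<bar>X \<omega>\<bar> \<le> B"
    and sub: "\<And>r. expectation (\<lambda>\<omega>. exp (r * X \<omega>)) \<le> exp (r\<^sup>2 * v / 2)"
    and "even N" "b > 0"
  shows "expectation (\<lambda>\<omega>. X \<omega> ^ N) \<le> (real N / b) ^ N * (2 * exp (b\<^sup>2 * v / 2))"
proof -
  note i1 = integrable_exp_bounded[OF assms(1) bdd]
  have i2: "integrable M (\<lambda>\<omega>. X \<omega> ^ N)"
    by (rule integrable_const_bound[where B="B ^ N"]) (use bdd in \<open>auto simp: power_abs intro!: power_mono\<close>)
  have pt: "X \<omega> ^ N \<le> (real N / b) ^ N * (exp (b * X \<omega>) + exp (- b * X \<omega>))" for \<omega>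
  proof -
    have "(b * \<bar>X \<omega>\<bar>) ^ N / fact N \<le> (\<Sum>l\<le>N. (b * \<bar>X \<omega>\<bar>) ^ l / fact l)"
      using assms by (intro member_le_sum) auto
    also have "\<dots> \<le> exp (b * \<bar>X \<omega>\<bar>)" using assms by (intro exp_partial_sum_le_exp) auto
    also have "\<dots> \<le> exp (b * X \<omega>) + exp (- b * X \<omega>)" by (simp add: abs_if)
    finally have 1: "(b * \<bar>X \<omega>\<bar>) ^ N / fact N \<le> exp (b * X \<omega>) + exp (- b * X \<omega>)" .
    have "X \<omega> ^ N = (fact N / b ^ N) * ((b * \<bar>X \<omega>\<bar>) ^ N / fact N)"
      using assms by (simp add: power_mult_distrib power_even_abs)
    also have "\<dots> \<le> (real N ^ N / b ^ N) * (exp (b * X \<omega>) + exp (- b * X \<omega>))"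
    proof (rule mult_mono[OF divide_right_mono 1])
      show "fact N \<le> real N ^ N" using fact_le_power[of N, where 'a=real] by simp
    qed (use assms in auto)
    finally show ?thesis by (simp add: power_divide)
  qed
  have "expectation (\<lambda>\<omega>. X \<omega> ^ N) \<le> expectation (\<lambda>\<omega>. (real N / b) ^ N * (exp (b * X \<omega>) + exp (- b * X \<omega>)))"
    by (rule integral_mono[OF i2 _ pt]) (intro integrable_mult_right Bochner_Integration.integrable_add i1)
  also have "\<dots> = (real N / b) ^ N * (expectation (\<lambda>\<omega>. exp (b * X \<omega>)) + expectation (\<lambda>\<omega>. exp (- b * X \<omega>)))"
    using i1[of b] i1[of "-b"] by simp
  also have "\<dots> \<le> (real N / b) ^ N * (2 * exp (b\<^sup>2 * v / 2))"
  proof (rule mult_left_mono)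
    show "expectation (\<lambda>\<omega>. exp (b * X \<omega>)) + expectation (\<lambda>\<omega>. exp (- b * X \<omega>)) \<le> 2 * exp (b\<^sup>2 * v / 2)"
      using sub[of b] sub[of "-b"] unfolding power2_minus by linarith
  qed (use \<open>b > 0\<close> in auto)
  finally show ?thesis .
qed

definition truncated_mgf :: "'a measure \<Rightarrow> ('a \<Rightarrow> real) \<Rightarrow> real \<Rightarrow> complex \<Rightarrow> complex" where
  "truncated_mgf M S R z = (\<integral>t. exp (z * of_real (S t)) * indicator {-R..R} (S t) \<partial>M)"

text \<open>
  All that the comparison of the prime sum with its random model uses.  Boundedness supplies
  integrability, and \<open>v\<close> is a variance proxy.
\<close>

locale moment_match = S: prob_space M1 + X: prob_space M2
  for M1 :: "'a measure" and M2 :: "'b measure" +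
  fixes S :: "'a \<Rightarrow> real" and X :: "'b \<Rightarrow> real" and N :: nat and \<epsilon> v B1 B2 :: real
  assumes S_meas [measurable]: "S \<in> borel_measurable M1" and S_bdd: "\<And>t. \<bar>S t\<bar> \<le> B1"
    and X_meas [measurable]: "X \<in> borel_measurable M2" and X_bdd: "\<And>\<omega>. \<bar>X \<omega>\<bar> \<le> B2"
    and subgaussian: "\<And>r. X.expectation (\<lambda>\<omega>. exp (r * X \<omega>)) \<le> exp (r\<^sup>2 * v / 2)"
    and moments: "\<And>l. l \<le> N \<Longrightarrow> \<bar>S.expectation (\<lambda>t. S t ^ l) - X.expectation (\<lambda>\<omega>. X \<omega> ^ l)\<bar> \<le> \<epsilon>"
    and even_N: "even N" and v_nonneg: "v \<ge> 0"
begin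

abbreviation growth :: "real \<Rightarrow> real" where
  "growth K \<equiv> exp ((2 * (exp 1)\<^sup>2 * K)\<^sup>2 * v / 2)"

lemma integrable_power:
  "integrable M1 (\<lambda>t. S t ^ l)" "integrable M2 (\<lambda>\<omega>. X \<omega> ^ l)"
  by (rule S.integrable_const_bound[where B="B1 ^ l"], use S_bdd in \<open>auto simp: power_abs intro!: power_mono\<close>)
     (rule X.integrable_const_bound[where B="B2 ^ l"], use X_bdd in \<open>auto simp: power_abs intro!: power_mono\<close>)

lemma eps_nonneg: "\<epsilon> \<ge> 0"
  using moments[of 0] by simp

text \<open>
  With \<open>b = 2 e\<^sup>2 K\<close> in the moment bound, \<open>N / (b R) = 1/e\<close>, whose \<open>N\<close>-th power is \<open>exp (- N)\<close>.
\<close>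

lemma scaled_even_moment_le:
  assumes K: "K > 0" and R: "2 * exp 1 * K * R = real N" "R \<ge> 1"
  shows "S.expectation (\<lambda>t. (S t / R) ^ N) \<le> \<epsilon> + 2 * exp (- real N) * growth K"
proof -
  define b where "b = 2 * (exp 1)\<^sup>2 * K"
  have b: "b > 0" using K by (simp add: b_def)
  have NbR: "real N / (b * R) = exp (- 1)"
    using K R by (simp add: b_def field_simps power2_eq_square exp_minus flip: R(1))
  have "S.expectation (\<lambda>t. S t ^ N) \<le> \<epsilon> + X.expectation (\<lambda>\<omega>. X \<omega> ^ N)"
    using moments[of N] by auto
  also have "X.expectation (\<lambda>\<omega>. X \<omega> ^ N) \<le> (real N / b) ^ N * (2 * exp (b\<^sup>2 * v / 2))"
    by (rule X.expectation_even_power_le[OF X_meas X_bdd subgaussian even_N b])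
  finally have "S.expectation (\<lambda>t. S t ^ N) / R ^ N \<le> (\<epsilon> + (real N / b) ^ N * (2 * exp (b\<^sup>2 * v / 2))) / R ^ N"
    using R by (intro divide_right_mono) auto
  also have "\<dots> = \<epsilon> / R ^ N + (real N / (b * R)) ^ N * (2 * exp (b\<^sup>2 * v / 2))"
    by (simp add: add_divide_distrib power_divide power_mult_distrib)
  also have "\<epsilon> / R ^ N \<le> \<epsilon>"
    using R eps_nonneg by (simp add: divide_le_eq mult_le_cancel_left1 one_le_power)
  also have "(real N / (b * R)) ^ N = exp (- real N)"
    unfolding NbR by (simp flip: exp_of_nat_mult)
  finally show ?thesis by (simp add: power_divide b_def)
qed

lemma prob_gt_le:
  assumes K: "K > 0" and R: "2 * exp 1 * K * R = real N" "R \<ge> 1"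
  shows "S.prob {t \<in> space M1. S t \<notin> {-R..R}} \<le> \<epsilon> + 2 * exp (- real N) * growth K"
proof -
  have "S.prob {t \<in> space M1. S t \<notin> {-R..R}} = S.expectation (indicator {t \<in> space M1. S t \<notin> {-R..R}})"
    by simp
  also have "\<dots> \<le> S.expectation (\<lambda>t. (S t / R) ^ N)"
  proof (rule integral_mono)
    have "{t \<in> space M1. S t \<notin> {-R..R}} \<in> sets M1" by measurable
    then show "integrable M1 (indicat_real {t \<in> space M1. S t \<notin> {-R..R}})"
      by (rule integrable_real_indicator) (simp add: S.emeasure_eq_measure del: Int_iff)
    show "integrable M1 (\<lambda>t. (S t / R) ^ N)" by (simp add: power_divide integrable_power)
    fix t
    show "indicator {t \<in> space M1. S t \<notin> {-R..R}} t \<le> (S t / R) ^ N"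
    proof (cases "S t \<in> {-R..R}")
      case False
      then have "1 \<le> (\<bar>S t\<bar> / R) ^ N" using R by (intro one_le_power) auto
      also have "\<dots> = (S t / R) ^ N" using even_N by (simp add: power_divide power_even_abs)
      finally show ?thesis by (simp add: indicator_def)
    qed (use even_N in \<open>auto simp: zero_le_even_power\<close>)
  qed
  also note scaled_even_moment_le[OF assms]
  finally show ?thesis .
qed

text \<open>
  The polynomial \<open>exp_poly\<close> mediates: its means under \<open>S\<close> and \<open>X\<close> differ by the matched moments, and
  on each side it differs from the exponential by the previous estimates.
\<close>

lemma truncated_exp_moment_close:
  fixes z :: complex
  assumes K: "K > 0" "norm z \<le> K" and R: "2 * exp 1 * K * R = real N" "R \<ge> 1"
  shows "norm (truncated_mgf M1 S R z
               - X.expectation (\<lambda>\<omega>. exp (z * of_real (X \<omega>))))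
     \<le> 5 * exp (- real N / 2) * growth K + \<epsilon> * (exp (real N / 2) + exp K)"
proof -
  define b where "b = 2 * (exp 1)\<^sup>2 * K"
  define G where "G = exp (b\<^sup>2 * v / 2)"
  have b: "b > 0" using K by (simp add: b_def)
  have G1: "G \<ge> 1" using v_nonneg by (simp add: G_def)
  have poly_int: "integrable M1 (\<lambda>t. exp_poly N (z * of_real (S t)))" "integrable M2 (\<lambda>\<omega>. exp_poly N (z * of_real (X \<omega>)))"
    unfolding exp_poly_def power_mult_distrib of_real_power[symmetric]
    by (intro Bochner_Integration.integrable_sum integrable_divide integrable_mult_right integrable_of_real integrable_power)+
  have poly_eq: "S.expectation (\<lambda>t. exp_poly N (z * of_real (S t))) = (\<Sum>l\<le>N. z ^ l / fact l * of_real (S.expectation (\<lambda>t. S t ^ l)))"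
      "X.expectation (\<lambda>\<omega>. exp_poly N (z * of_real (X \<omega>))) = (\<Sum>l\<le>N. z ^ l / fact l * of_real (X.expectation (\<lambda>\<omega>. X \<omega> ^ l)))"
    unfolding exp_poly_def power_mult_distrib of_real_power[symmetric]
    by (subst Bochner_Integration.integral_sum;
        (intro integrable_divide integrable_mult_right integrable_of_real integrable_power | simp del: of_real_power))+
  have 1: "norm (S.expectation (\<lambda>t. exp_poly N (z * of_real (S t))) - X.expectation (\<lambda>\<omega>. exp_poly N (z * of_real (X \<omega>)))) \<le> \<epsilon> * exp K"
  proof -
    have "norm (S.expectation (\<lambda>t. exp_poly N (z * of_real (S t))) - X.expectation (\<lambda>\<omega>. exp_poly N (z * of_real (X \<omega>))))
      = norm (\<Sum>l\<le>N. z ^ l / fact l * of_real (S.expectation (\<lambda>t. S t ^ l) - X.expectation (\<lambda>\<omega>. X \<omega> ^ l)))"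
      unfolding poly_eq sum_subtractf[symmetric] by (simp add: algebra_simps)
    also have "\<dots> \<le> (\<Sum>l\<le>N. K ^ l / fact l * \<epsilon>)"
    proof (rule sum_norm_le)
      fix l assume "l \<in> {..N}"
      then show "norm (z ^ l / fact l * of_real (S.expectation (\<lambda>t. S t ^ l) - X.expectation (\<lambda>\<omega>. X \<omega> ^ l))) \<le> K ^ l / fact l * \<epsilon>"
        unfolding norm_mult norm_of_real norm_divide norm_power norm_fact
        using K moments[of l] by (intro mult_mono divide_right_mono power_mono) auto
    qed
    also have "\<dots> \<le> \<epsilon> * exp K"
      unfolding sum_distrib_right[symmetric] using exp_partial_sum_le_exp[of K N] K eps_nonneg
      by (simp add: mult.commute mult_left_mono)
    finally show ?thesis .
  qed
  have int1: "integrable M1 (\<lambda>t. exp (z * of_real (S t)) * indicator {-R..R} (S t))"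
  proof (rule S.integrable_const_bound[where B="exp (K * B1)"], rule AE_I2)
    fix t
    have "Re (z * of_real (S t)) \<le> norm (z * of_real (S t))" by (rule complex_Re_le_cmod)
    also have "\<dots> \<le> K * B1" unfolding norm_mult using K S_bdd[of t] by (intro mult_mono) auto
    finally show "norm (exp (z * of_real (S t)) * indicator {-R..R} (S t)) \<le> exp (K * B1)"
      by (auto simp: indicator_def)
  qed measurable
  have 2: "norm (truncated_mgf M1 S R z - S.expectation (\<lambda>t. exp_poly N (z * of_real (S t))))
     \<le> exp (- real N / 2) + exp (real N / 2) * (\<epsilon> + 2 * exp (- real N) * G)"
  proof -
    have "norm (truncated_mgf M1 S R z - S.expectation (\<lambda>t. exp_poly N (z * of_real (S t))))
       = norm (S.expectation (\<lambda>t. exp (z * of_real (S t)) * indicator {-R..R} (S t) - exp_poly N (z * of_real (S t))))"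
      unfolding truncated_mgf_def by (subst Bochner_Integration.integral_diff[OF int1 poly_int(1)]) simp
    also have "\<dots> \<le> S.expectation (\<lambda>t. exp (- real N / 2) + exp (real N / 2) * (S t / R) ^ N)"
    proof (rule norm_lebesgue_integral_le)
      show "integrable M1 (\<lambda>t. exp (- real N / 2) + exp (real N / 2) * (S t / R) ^ N)"
        by (simp add: power_divide integrable_power)
      show "norm (exp (z * of_real (S t)) * indicator {-R..R} (S t) - exp_poly N (z * of_real (S t)))
          \<le> exp (- real N / 2) + exp (real N / 2) * (S t / R) ^ N" for t
        using truncated_exp_approx[OF K _ R(1) even_N, of "S t"] R(2) by simp
    qed (use int1 poly_int in auto)
    also have "\<dots> = exp (- real N / 2) + exp (real N / 2) * S.expectation (\<lambda>t. (S t / R) ^ N)"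
      by (simp add: power_divide integrable_power S.prob_space)
    also have "\<dots> \<le> exp (- real N / 2) + exp (real N / 2) * (\<epsilon> + 2 * exp (- real N) * G)"
      using scaled_even_moment_le[OF K(1) R] by (simp add: G_def b_def)
    finally show ?thesis .
  qed
  note intX = X.integrable_exp_bounded[OF X_meas X_bdd]
  have int2: "integrable M2 (\<lambda>\<omega>. exp (z * of_real (X \<omega>)))"
  proof (rule Bochner_Integration.integrable_bound[OF intX[of "Re z"]])
    show "(\<lambda>\<omega>. exp (z * complex_of_real (X \<omega>))) \<in> borel_measurable M2" by measurable
  qed simp
  have 3: "norm (X.expectation (\<lambda>\<omega>. exp (z * of_real (X \<omega>))) - X.expectation (\<lambda>\<omega>. exp_poly N (z * of_real (X \<omega>)))) \<le> exp (- real N) * (2 * G)"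
  proof -
    define r where "r = exp 1 * K"
    have "norm (X.expectation (\<lambda>\<omega>. exp (z * of_real (X \<omega>))) - X.expectation (\<lambda>\<omega>. exp_poly N (z * of_real (X \<omega>))))
       = norm (X.expectation (\<lambda>\<omega>. exp (z * of_real (X \<omega>)) - exp_poly N (z * of_real (X \<omega>))))"
      by (subst Bochner_Integration.integral_diff[OF int2 poly_int(2)]) simp
    also have "\<dots> \<le> X.expectation (\<lambda>\<omega>. exp (- real N) * (exp (r * X \<omega>) + exp (- r * X \<omega>)))"
    proof (rule norm_lebesgue_integral_le)
      fix \<omega>
      have "norm (exp (z * of_real (X \<omega>)) - exp_poly N (z * of_real (X \<omega>))) \<le> exp (- real N) * exp (exp 1 * norm (z * of_real (X \<omega>)))"
        by (rule norm_exp_minus_exp_poly_le)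
      also have "\<dots> \<le> exp (- real N) * exp (r * \<bar>X \<omega>\<bar>)"
        using K by (auto simp: r_def norm_mult mult.assoc intro!: mult_mono)
      also have "\<dots> \<le> exp (- real N) * (exp (r * X \<omega>) + exp (- r * X \<omega>))" by (simp add: abs_if)
      finally show "norm (exp (z * of_real (X \<omega>)) - exp_poly N (z * of_real (X \<omega>))) \<le> \<dots>" .
    qed (intro integrable_mult_right Bochner_Integration.integrable_add Bochner_Integration.integrable_diff intX int2 poly_int(2))+
    also have "\<dots> = exp (- real N) * (X.expectation (\<lambda>\<omega>. exp (r * X \<omega>)) + X.expectation (\<lambda>\<omega>. exp (- r * X \<omega>)))"
      using intX[of r] intX[of "-r"] by simp
    also have "\<dots> \<le> exp (- real N) * (2 * exp (r\<^sup>2 * v / 2))"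
      using subgaussian[of r] subgaussian[of "-r"] unfolding power2_minus by (intro mult_left_mono) (linarith, simp)
    also have "\<dots> \<le> exp (- real N) * (2 * G)"
    proof -
      have "exp 1 * 1 \<le> exp 1 * (2 * exp (1::real))" using exp_ge_add_one_self[of 1] by (intro mult_left_mono) auto
      then have "r \<le> b" using K unfolding r_def b_def power2_eq_square by (intro mult_right_mono) (auto simp: mult_ac)
      then have "r\<^sup>2 \<le> b\<^sup>2" using K by (intro power_mono) (auto simp: r_def)
      then show ?thesis using v_nonneg by (auto simp: G_def intro!: mult_right_mono)
    qed
    finally show ?thesis .
  qed
  have e: "exp (real N / 2) * exp (- real N) = exp (- real N / 2)" "exp (- real N) \<le> exp (- real N / 2)"
    by (auto simp flip: exp_add)
  have "norm (truncated_mgf M1 S R z - X.expectation (\<lambda>\<omega>. exp (z * of_real (X \<omega>))))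
     \<le> (exp (- real N / 2) + exp (real N / 2) * (\<epsilon> + 2 * exp (- real N) * G)) + \<epsilon> * exp K + exp (- real N) * (2 * G)"
    using norm_triangle_le_diff[OF add_mono[OF order_refl order_refl]] 1 2 3
    by (smt (verit) norm_minus_commute norm_triangle_sub diff_add_cancel add_diff_eq norm_triangle_ineq4 norm_diff_triangle_ineq norm_diff_triangle_le)
  also have "\<dots> \<le> (exp (- real N / 2) * G + exp (real N / 2) * (\<epsilon> + 2 * exp (- real N) * G)) + \<epsilon> * exp K + exp (- real N / 2) * (2 * G)"
    using e(2) G1 by (intro add_mono mult_right_mono order_refl) auto
  also have "\<dots> = 5 * exp (- real N / 2) * G + \<epsilon> * (exp (real N / 2) + exp K)"
    unfolding distrib_left mult.assoc using e(1) by (simp add: algebra_simps)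
  finally show ?thesis by (simp add: G_def b_def)
qed

end

section \<open>A positive test function with compactly supported Fourier transform\<close>

text \<open>
  The square of the triangle function.  The triangle itself has the Fejer kernel as its transform,
  which has zeros; squaring removes them.
\<close>

definition bump :: "real \<Rightarrow> real" where
  "bump u = (max 0 (1 - \<bar>u\<bar>))\<^sup>2"

definition bump_hat :: "real \<Rightarrow> real" where
  "bump_hat y = (if y = 0 then 2 / 3 else 4 * (y - sin y) / y ^ 3)"

lemma bump_nonneg [simp]: "0 \<le> bump u" and bump_le_1: "bump u \<le> 1"
  by (auto simp: bump_def max_def abs_le_iff intro!: power_le_one)

lemma bump_eq_0: "\<bar>u\<bar> > 1 \<Longrightarrow> bump u = 0"
  by (simp add: bump_def)

lemma bump_minus [simp]: "bump (- u) = bump u"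
  by (simp add: bump_def)

lemma bump_0 [simp]: "bump 0 = 1"
  by (simp add: bump_def)

lemma bump_le_indicator: "bump u \<le> indicator {-1..1} u"
  using bump_le_1[of u] bump_eq_0[of u] by (auto simp: indicator_def abs_if split: if_splits)

lemma continuous_on_bump: "continuous_on A bump"
  unfolding bump_def[abs_def] by (intro continuous_intros)

lemma bump_measurable [measurable]: "bump \<in> borel_measurable borel"
  by (rule borel_measurable_continuous_onI[OF continuous_on_bump])

lemma integrable_bump: "integrable lborel bump"
  by (rule Bochner_Integration.integrable_bound[of _ "indicator {-1..1::real}"])
     (use bump_le_indicator in auto)

lemma half_bump_integral:
  "(\<integral>u. indicator {0..1} u *\<^sub>R (of_real ((1 - u)\<^sup>2) * iexp (u * y)) \<partial>lborel)
    = (if y = 0 then 1 / 3 else \<i> / y + 2 / y\<^sup>2 - 2 * \<i> / y ^ 3 + 2 * \<i> * exp (\<i> * y) / y ^ 3)"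
proof (cases "y = 0")
  case True
  have "(\<integral>u. indicator {0..1} u *\<^sub>R ((1 - u)\<^sup>2) \<partial>lborel) = - ((1 - 1) ^ 3 / 3) - (- ((1 - 0) ^ 3 / 3 :: real))"
    by (rule integral_FTC_Icc)
       (auto intro!: derivative_eq_intros continuous_intros simp flip: has_real_derivative_iff_has_vector_derivative simp: power2_eq_square)
  then have "(\<integral>u. indicator {0..1} u *\<^sub>R ((1 - u)\<^sup>2) \<partial>lborel) = (1 / 3 :: real)" by (simp only:) simp
  moreover have "(\<integral>u. indicator {0..1} u *\<^sub>R (of_real ((1 - u)\<^sup>2) * iexp (u * y)) \<partial>lborel)
     = complex_of_real (\<integral>u. indicator {0..1} u *\<^sub>R ((1 - u)\<^sup>2) \<partial>lborel)"
    unfolding integral_complex_of_real[symmetric]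
    by (intro Bochner_Integration.integral_cong refl) (simp add: True scaleR_conv_of_real)
  ultimately show ?thesis using True by (simp only:) simp
next
  case False
  \<comment> \<open>The antiderivative that results from integrating by parts twice.\<close>
  define F where "F = (\<lambda>u::complex. exp (\<i> * y * u) * ((1 - u)\<^sup>2 / (\<i> * y) + 2 * (1 - u) / (\<i> * y)\<^sup>2 + 2 / (\<i> * y) ^ 3))"
  have "(\<integral>u. indicator {0..1} u *\<^sub>R (of_real ((1 - u)\<^sup>2) * iexp (u * y)) \<partial>lborel) = F (of_real 1) - F (of_real 0)"
  proof (rule integral_FTC_Icc)
    fix u :: real
    have "(F has_field_derivative (1 - of_real u)\<^sup>2 * exp (\<i> * y * of_real u)) (at (of_real u))"
      unfolding F_def using False
      by (auto intro!: derivative_eq_intros simp: field_simps power2_eq_square power3_eq_cube)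
    from has_vector_derivative_real_field[OF this]
    show "((\<lambda>u. F (of_real u)) has_vector_derivative of_real ((1 - u)\<^sup>2) * iexp (u * y)) (at u within {0..1})"
      by (auto simp: mult_ac intro: has_vector_derivative_at_within)
  qed (auto intro!: continuous_intros)
  also have "F (of_real 1) - F (of_real 0) = \<i> / y + 2 / y\<^sup>2 - 2 * \<i> / y ^ 3 + 2 * \<i> * exp (\<i> * y) / y ^ 3"
    unfolding F_def using False by (simp add: field_simps power2_eq_square power3_eq_cube)
  finally show ?thesis using False by simp
qed

lemma bump_fourier: "(\<integral>u. of_real (bump u) * iexp (u * y) \<partial>lborel) = of_real (bump_hat y)"
proof -
  let ?h = "\<lambda>y u. indicator {0..1} u *\<^sub>R (of_real ((1 - u)\<^sup>2) * iexp (u * y))"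
  have int: "integrable lborel (?h y)" for y
    by (intro borel_integrable_atLeastAtMost' continuous_intros | simp add: set_integrable_def[symmetric])+
  have ref: "(\<integral>u. ?h (-y) u \<partial>lborel) = (\<integral>u. ?h (-y) (- u) \<partial>lborel)"
    using lborel_integral_real_affine[of "-1" "?h (-y)" 0] by simp
  have int': "integrable lborel (\<lambda>u. ?h (-y) (- u))"
    using lborel_integrable_real_affine[OF int[of "-y"], of "-1" 0] by simp
  have "(\<integral>u. of_real (bump u) * iexp (u * y) \<partial>lborel) = (\<integral>u. ?h y u + ?h (-y) (- u) \<partial>lborel)"
  proof (rule integral_cong_AE)
    show "AE u in lborel. of_real (bump u) * iexp (u * y) = ?h y u + ?h (-y) (- u)"
      using AE_lborel_singleton[of 0]
      by eventually_elim (auto simp: bump_def indicator_def max_def abs_if scaleR_conv_of_real)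
  qed auto
  also have "\<dots> = (\<integral>u. ?h y u \<partial>lborel) + (\<integral>u. ?h (-y) u \<partial>lborel)"
    unfolding ref by (rule Bochner_Integration.integral_add[OF int int'])
  also have "\<dots> = of_real (bump_hat y)"
  proof (cases "y = 0")
    case True
    then show ?thesis unfolding half_bump_integral by (simp add: bump_hat_def)
  next
    case False
    have "(\<integral>u. ?h y u \<partial>lborel) + (\<integral>u. ?h (-y) u \<partial>lborel)
      = 4 / y\<^sup>2 + 2 * \<i> * (exp (\<i> * y) - exp (- (\<i> * y))) / y ^ 3"
      unfolding half_bump_integral using False by (simp add: field_simps)
    also have "exp (\<i> * y) - exp (- (\<i> * y)) = 2 * \<i> * of_real (sin y)"
      by (simp add: sin_of_real[symmetric] sin_exp_eq)
    also have "4 / y\<^sup>2 + 2 * \<i> * (2 * \<i> * of_real (sin y)) / y ^ 3 = of_real (bump_hat y)"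
      using False by (simp add: bump_hat_def field_simps power2_eq_square power3_eq_cube)
    finally show ?thesis .
  qed
  finally show ?thesis .
qed

text \<open>
  Positivity everywhere is what allows division by \<open>bump_hat\<close> when test functions are changed.
\<close>

lemma bump_hat_pos: "bump_hat y > 0"
proof -
  have *: "sin x < x" if "x > 0" for x :: real 
  proof (cases "x < pi")
    case True
    have "sin x = 2 * sin (x / 2) * cos (x / 2)" using sin_double[of "x / 2"] by simp
    also have "\<dots> < 2 * sin (x / 2) * 1"
      using True that cos_monotone_0_pi[of 0 "x / 2"] sin_gt_zero[of "x / 2"] by (intro mult_strict_left_mono) auto
    also have "\<dots> \<le> x" using sin_x_le_x[of "x / 2"] that by simp
    finally show ?thesis .
  next
    case False
    then show ?thesis using sin_le_one[of x] pi_gt3 by linarith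
  qed
  show ?thesis
    using *[of y] *[of "-y"] by (cases "y = 0"; cases "y > 0")
     (auto simp: bump_hat_def zero_less_divide_iff zero_less_power_eq power_less_zero_eq)
qed

lemma isCont_bump_hat: "isCont bump_hat y"
proof (cases "y = 0")
  case True
  have "((\<lambda>y::real. 4 * (y - sin y) / y ^ 3) \<longlongrightarrow> 2 / 3) (at 0)" by real_asymp
  then have "(bump_hat \<longlongrightarrow> 2 / 3) (at 0)"
    by (rule Lim_transform_eventually) (auto simp: bump_hat_def eventually_at_filter)
  then show ?thesis using True by (simp add: isCont_def bump_hat_def)
next
  case False
  have "isCont (\<lambda>y::real. 4 * (y - sin y) / y ^ 3) y" using False by (intro continuous_intros) auto
  moreover have "eventually (\<lambda>z. 4 * (z - sin z) / z ^ 3 = bump_hat z) (nhds y)"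
    using t1_space_nhds[OF False] by eventually_elim (auto simp: bump_hat_def)
  ultimately show ?thesis by (simp cong: isCont_cong add: isCont_cong)
qed

lemma bump_hat_measurable [measurable]: "bump_hat \<in> borel_measurable borel"
  by (rule borel_measurable_continuous_onI) (simp add: continuous_at_imp_continuous_on isCont_bump_hat)

lemma bump_hat_le_2: "bump_hat y \<le> 2"
proof -
  have "norm (complex_of_real (bump_hat y)) \<le> (\<integral>u. norm (of_real (bump u) * iexp (u * y)) \<partial>lborel)"
    unfolding bump_fourier[symmetric] by (rule integral_norm_bound)
  also have "\<dots> = (\<integral>u. bump u \<partial>lborel)" by (simp add: norm_mult)
  also have "\<dots> \<le> (\<integral>u. indicator {-1..1::real} u \<partial>lborel)"
    by (rule integral_mono[OF integrable_bump]) (use bump_le_indicator in auto)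
  also have "\<dots> = 2" by simp
  finally show ?thesis by simp
qed

lemma integrable_bump_hat: "integrable lborel bump_hat"
proof (rule Bochner_Integration.integrable_bound)
  show "integrable lborel (\<lambda>y::real. 16 * inverse (1 + y\<^sup>2))"
    using integrable_inverse_1_plus_square by (auto simp: set_integrable_def)
  have "\<bar>bump_hat y\<bar> \<le> 16 * inverse (1 + y\<^sup>2)" for y
  proof (cases "\<bar>y\<bar> \<le> 1")
    case True
    then have "1 + y\<^sup>2 \<le> 2" using abs_square_le_1[of y] by simp
    then have "inverse (1 + y\<^sup>2) \<ge> inverse 2" by (intro le_imp_inverse_le) (auto simp: add_pos_nonneg)
    then show ?thesis using bump_hat_le_2[of y] bump_hat_pos[of y] by simp
  next
    case False
    then have y0: "y \<noteq> 0" "1 \<le> y\<^sup>2" using abs_square_le_1[of y] by (auto simp: not_le intro: less_imp_le)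
    have "\<bar>y - sin y\<bar> \<le> \<bar>y\<bar> + \<bar>y\<bar>" using abs_sin_x_le_abs_x[of y] abs_triangle_ineq4[of y "sin y"] by linarith
    then have "\<bar>bump_hat y\<bar> \<le> 4 * (2 * \<bar>y\<bar>) / \<bar>y\<bar> ^ 3"
      using y0 by (auto simp: bump_hat_def abs_mult power_abs intro!: divide_right_mono)
    also have "\<dots> = 8 / y\<^sup>2" using y0 by (simp add: field_simps power2_eq_square power3_eq_cube abs_if)
    also have "\<dots> \<le> 16 * inverse (1 + y\<^sup>2)"
      using y0 by (simp add: field_simps add_pos_nonneg)
    finally show ?thesis .
  qed
  then show "AE y in lborel. norm (bump_hat y) \<le> norm (16 * inverse (1 + y\<^sup>2))"
    by (auto intro: order_trans[OF _ abs_ge_self])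
qed simp

text \<open>
  Since \<open>bump_hat\<close> decays only like \<open>4 / y\<^sup>2\<close>, it dominates exponentially small functions on a half line.
\<close>

lemma exp_le_bump_hat:
  assumes "a > 0"
  shows "\<exists>C. \<forall>y\<ge>0. (1 + y) * exp (- a * y) \<le> C * bump_hat y"
proof -
  define f where "f = (\<lambda>y. (1 + y) * exp (- a * y) / bump_hat y)"
  have "((\<lambda>y. (1 + y) * exp (- a * y) * (y ^ 3 / (4 * (y - sin y)))) \<longlongrightarrow> 0) at_top"
    using assms by real_asymp
  moreover have "eventually (\<lambda>y. (1 + y) * exp (- a * y) * (y ^ 3 / (4 * (y - sin y))) = f y) at_top"
    using eventually_gt_at_top[of 0] by eventually_elim (simp add: f_def bump_hat_def)
  ultimately have "(f \<longlongrightarrow> 0) at_top" by (rule Lim_transform_eventually)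
  then have "eventually (\<lambda>y. f y < 1) at_top" by (rule order_tendstoD) simp
  then obtain Y where Y: "\<And>y. y \<ge> Y \<Longrightarrow> f y < 1" unfolding eventually_at_top_linorder by blast
  have "continuous_on {0..Y} f" unfolding f_def
    using bump_hat_pos by (intro continuous_intros continuous_at_imp_continuous_on ballI isCont_bump_hat) (auto simp: less_imp_neq[symmetric])
  then have "bounded (f ` {0..Y})" by (intro compact_imp_bounded compact_continuous_image) auto
  then obtain B where B: "\<And>y. y \<in> {0..Y} \<Longrightarrow> \<bar>f y\<bar> \<le> B" unfolding bounded_iff by fastforce
  have "f y \<le> max B 1" if "y \<ge> 0" for y
    using B[of y] Y[of y] that by (cases "y \<le> Y") auto
  then show ?thesis using bump_hat_pos
    by (intro exI[of _ "max B 1"]) (auto simp: f_def pos_divide_le_eq)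
qed

section \<open>A local limit theorem from Fourier data\<close>

text \<open>
  Fubini: only frequencies in \<open>[v - 1, v + 1]\<close> of the transform of \<open>\<nu>\<close> enter.
\<close>

lemma integral_bump_hat_iexp:
  assumes "finite_measure \<nu>" and sets [measurable_cong]: "sets \<nu> = sets borel"
  shows "(\<integral>y. of_real (bump_hat y) * iexp (v * y) \<partial>\<nu>)
     = (\<integral>u. of_real (bump u) * (\<integral>y. iexp ((u + v) * y) \<partial>\<nu>) \<partial>lborel)"
proof -
  interpret \<nu>: finite_measure \<nu> by fact
  interpret P: pair_sigma_finite lborel \<nu> ..
  let ?f = "\<lambda>u y. complex_of_real (bump u) * iexp ((u + v) * y)"
  have "(\<integral>y. of_real (bump_hat y) * iexp (v * y) \<partial>\<nu>) = (\<integral>y. (\<integral>u. ?f u y \<partial>lborel) \<partial>\<nu>)"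
    unfolding bump_fourier[symmetric] integral_mult_left_zero[symmetric]
    by (simp add: mult.assoc ring_distribs flip: exp_add)
  also have "\<dots> = (\<integral>u. (\<integral>y. ?f u y \<partial>\<nu>) \<partial>lborel)"
  proof (rule P.Fubini_integral, rule P.Fubini_integrable)
    show "integrable lborel (\<lambda>u. \<integral>y. norm (case (u, y) of (u, y) \<Rightarrow> ?f u y) \<partial>\<nu>)"
      using integrable_bump by (simp add: norm_mult)
    show "AE u in lborel. integrable \<nu> (\<lambda>y. case (u, y) of (u, y) \<Rightarrow> ?f u y)"
    proof (rule AE_I2)
      fix u
      show "integrable \<nu> (\<lambda>y. case (u, y) of (u, y) \<Rightarrow> ?f u y)"
        by (rule \<nu>.integrable_const_bound[where B=1]) (auto simp: norm_mult bump_le_1)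
    qed
  qed measurable
  finally show ?thesis by simp
qed

text \<open>
  The Fourier transform of the density \<open>exp (- y\<^sup>2 / (2 \<sigma>\<^sup>2))\<close>.
\<close>

abbreviation gaussian_hat :: "real \<Rightarrow> real \<Rightarrow> real" where
  "gaussian_hat \<sigma> u \<equiv> \<sigma> * (sqrt (2 * pi) * exp (- ((\<sigma> * u)\<^sup>2 / 2)))"

lemma gaussian_eq_std_normal: "sqrt (2 * pi) * exp (- (r\<^sup>2 / 2)) = 2 * pi * std_normal_density r"
  by (simp add: std_normal_density_def field_simps)

text \<open>
  The measures \<open>\<nu> n\<close> are normalised so that they look like \<open>c\<close> times Lebesgue measure: the
  approximating transform with \<open>Q = 1\<close> belongs to the density \<open>exp (- y\<^sup>2 / (2 \<sigma>\<^sup>2))\<close>, which tends to 1.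
\<close>

locale mod_gaussian_char =
  fixes \<nu> :: "nat \<Rightarrow> real measure" and \<sigma> :: "nat \<Rightarrow> real" and Q :: "nat \<Rightarrow> real \<Rightarrow> complex" and c :: complex
  assumes fin: "\<And>n. finite_measure (\<nu> n)" and sets [measurable_cong]: "\<And>n. sets (\<nu> n) = sets borel"
    and \<sigma>_pos: "\<And>n. \<sigma> n > 0" and \<sigma>_lim: "filterlim \<sigma> at_top sequentially"
    and Q_meas [measurable]: "\<And>n. Q n \<in> borel_measurable borel"
    and Q_bdd: "\<And>U. \<exists>B. \<forall>n u. \<bar>u\<bar> \<le> U \<longrightarrow> norm (Q n u) \<le> B"
    and Q_lim: "\<And>r. (\<lambda>n. Q n (r / \<sigma> n)) \<longlonglongrightarrow> c"
    and approx: "\<And>U. \<exists>\<eta>. \<eta> \<longlonglongrightarrow> 0 \<and> (\<forall>\<^sub>F n in sequentially. \<forall>u. \<bar>u\<bar> \<le> U \<longrightarrow>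
        norm ((\<integral>y. iexp (u * y) \<partial>\<nu> n) - of_real (gaussian_hat (\<sigma> n) u) * Q n u) \<le> \<eta> n)"
begin

text \<open>
  After the substitution \<open>u = r / \<sigma> - v\<close> the Gaussian factor becomes a fixed integrable majorant, and
  \<open>Q\<close> is evaluated at points tending to 0.
\<close>

lemma main_term_limit:
  "(\<lambda>n. \<integral>u. of_real (bump u) * (of_real (gaussian_hat (\<sigma> n) (u + v)) * Q n (u + v)) \<partial>lborel)
    \<longlonglongrightarrow> 2 * pi * bump v * c"
proof -
  obtain B where B: "\<And>n u. \<bar>u\<bar> \<le> 1 + \<bar>v\<bar> \<Longrightarrow> norm (Q n u) \<le> B" using Q_bdd by blast
  have B0: "B \<ge> 0" using B[of 0 undefined] norm_ge_zero[of "Q undefined 0"] by linarith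
  let ?g = "\<lambda>n u. complex_of_real (bump u) * (of_real (gaussian_hat (\<sigma> n) (u + v)) * Q n (u + v))"
  define h where "h = (\<lambda>n r. complex_of_real (bump (r / \<sigma> n - v)) * (of_real (2 * pi * std_normal_density r) * Q n (r / \<sigma> n)))"
  have eq: "(\<integral>u. ?g n u \<partial>lborel) = (\<integral>r. h n r \<partial>lborel)" for n
  proof -
    have "(\<integral>u. ?g n u \<partial>lborel) = \<bar>1 / \<sigma> n\<bar> *\<^sub>R (\<integral>r. ?g n (- v + 1 / \<sigma> n * r) \<partial>lborel)"
      by (rule lborel_integral_real_affine) (use \<sigma>_pos[of n] in simp)
    also have "\<dots> = (\<integral>r. \<bar>1 / \<sigma> n\<bar> *\<^sub>R ?g n (- v + 1 / \<sigma> n * r) \<partial>lborel)" by simp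
    also have "\<dots> = (\<integral>r. h n r \<partial>lborel)"
    proof (intro Bochner_Integration.integral_cong refl)
      fix r
      have "\<sigma> n * (- v + 1 / \<sigma> n * r + v) = r" using \<sigma>_pos[of n] by simp
      then show "\<bar>1 / \<sigma> n\<bar> *\<^sub>R ?g n (- v + 1 / \<sigma> n * r) = h n r"
        unfolding h_def gaussian_eq_std_normal using \<sigma>_pos[of n] by (simp add: scaleR_conv_of_real)
    qed
    finally show ?thesis .
  qed
  have "(\<lambda>n. \<integral>r. h n r \<partial>lborel) \<longlonglongrightarrow> (\<integral>r. of_real (bump v) * (of_real (2 * pi * std_normal_density r) * c) \<partial>lborel)"
  proof (rule integral_dominated_convergence)
    show "integrable lborel (\<lambda>r. 2 * pi * B * std_normal_density r)"
      by (intro integrable_mult_right) simp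
    show "AE r in lborel. (\<lambda>n. h n r) \<longlonglongrightarrow> of_real (bump v) * (of_real (2 * pi * std_normal_density r) * c)"
    proof (rule AE_I2)
      fix r
      have "(\<lambda>n. r / \<sigma> n - v) \<longlonglongrightarrow> 0 - v"
        by (intro tendsto_intros tendsto_divide_0[OF tendsto_const] filterlim_at_top_imp_at_infinity \<sigma>_lim)
      moreover have "isCont bump (0 - v)"
        using continuous_on_bump[of UNIV] by (simp add: continuous_on_eq_continuous_at)
      ultimately have "(\<lambda>n. bump (r / \<sigma> n - v)) \<longlonglongrightarrow> bump (0 - v)" by (metis isCont_tendsto_compose)
      then show "(\<lambda>n. h n r) \<longlonglongrightarrow> of_real (bump v) * (of_real (2 * pi * std_normal_density r) * c)"
        unfolding h_def by (intro tendsto_intros Q_lim) simp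
    qed
    fix n
    show "AE r in lborel. norm (h n r) \<le> 2 * pi * B * std_normal_density r"
    proof (rule AE_I2)
      fix r
      show "norm (h n r) \<le> 2 * pi * B * std_normal_density r"
      proof (cases "\<bar>r / \<sigma> n - v\<bar> \<le> 1")
        case True
        then have "norm (Q n (r / \<sigma> n)) \<le> B" by (intro B) linarith
        then have "bump (r / \<sigma> n - v) * ((2 * pi * std_normal_density r) * norm (Q n (r / \<sigma> n))) \<le> 1 * ((2 * pi * std_normal_density r) * B)"
          by (intro mult_mono bump_le_1) auto
        then show ?thesis unfolding h_def norm_mult norm_of_real by (simp add: mult_ac)
      next
        case False
        then show ?thesis using B0 by (simp add: h_def bump_eq_0)
      qed
    qed
  qed (unfold h_def, measurable)
  also have "(\<integral>r. of_real (bump v) * (of_real (2 * pi * std_normal_density r) * c) \<partial>lborel)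
     = of_real (bump v) * (2 * pi * of_real (\<integral>r. std_normal_density r \<partial>lborel) * c)"
    by (simp add: mult.assoc)
  also have "(\<integral>r. std_normal_density r \<partial>lborel) = 1"
    using integral_std_normal_moment_even[of 0] by simp
  finally show ?thesis unfolding eq by (simp add: mult_ac)
qed

lemma char_measurable: "(\<lambda>u. \<integral>y. iexp (u * y) \<partial>\<nu> n) \<in> borel_measurable borel"
proof -
  interpret finite_measure "\<nu> n" by (rule fin)
  show ?thesis by (rule borel_measurable_lebesgue_integral) measurable
qed

theorem bump_hat_transform_limit:
  "(\<lambda>n. \<integral>y. of_real (bump_hat y) * iexp (v * y) \<partial>\<nu> n) \<longlonglongrightarrow> 2 * pi * bump v * c"
proof -
  let ?ch = "\<lambda>n u. \<integral>y. iexp (u * y) \<partial>\<nu> n"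
  let ?G = "\<lambda>n u. of_real (gaussian_hat (\<sigma> n) u) * Q n u"
  let ?A = "\<lambda>n u. of_real (bump u) * ?ch n (u + v)" and ?B = "\<lambda>n u. of_real (bump u) * ?G n (u + v)"
  obtain \<eta> where \<eta>: "\<eta> \<longlonglongrightarrow> 0" "\<forall>\<^sub>F n in sequentially. \<forall>u. \<bar>u\<bar> \<le> 1 + \<bar>v\<bar> \<longrightarrow> norm (?ch n u - ?G n u) \<le> \<eta> n"
    using approx[of "1 + \<bar>v\<bar>"] by blast
  obtain B where B: "\<And>n u. \<bar>u\<bar> \<le> 1 + \<bar>v\<bar> \<Longrightarrow> norm (Q n u) \<le> B" using Q_bdd by blast
  have B0: "B \<ge> 0" using B[of 0 undefined] norm_ge_zero[of "Q undefined 0"] by linarith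
  have [measurable]: "?ch n \<in> borel_measurable borel" for n by (rule char_measurable)
  have int1: "integrable lborel (\<lambda>u. ?A n u)" for n
  proof (rule Bochner_Integration.integrable_bound)
    interpret finite_measure "\<nu> n" by (rule fin)
    show "integrable lborel (\<lambda>u. bump u * measure (\<nu> n) (space (\<nu> n)))"
      using integrable_bump by simp
    have "norm (?ch n u) \<le> measure (\<nu> n) (space (\<nu> n))" for u
      using integral_norm_bound[of "\<nu> n" "\<lambda>y. iexp (u * y)"] by simp
    then have "bump u * norm (?ch n (u + v)) \<le> bump u * measure (\<nu> n) (space (\<nu> n))" for u
      by (rule mult_left_mono) simp
    then show "AE u in lborel. norm (?A n u) \<le> norm (bump u * measure (\<nu> n) (space (\<nu> n)))"
      unfolding norm_mult norm_of_real by (intro AE_I2) simp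
  qed measurable
  have int2: "integrable lborel (\<lambda>u. ?B n u)" for n
  proof (rule Bochner_Integration.integrable_bound)
    show "integrable lborel (\<lambda>u. bump u * (\<sigma> n * sqrt (2 * pi) * B))"
      using integrable_bump by simp
    show "AE u in lborel. norm (?B n u) \<le> norm (bump u * (\<sigma> n * sqrt (2 * pi) * B))"
    proof (rule AE_I2)
      fix u
      show "norm (?B n u) \<le> norm (bump u * (\<sigma> n * sqrt (2 * pi) * B))"
      proof (cases "\<bar>u\<bar> \<le> 1")
        case True
        then have "norm (Q n (u + v)) \<le> B" by (intro B) linarith
        moreover have "exp (- ((\<sigma> n * (u + v))\<^sup>2 / 2)) \<le> 1" by simp
        ultimately have "exp (- ((\<sigma> n * (u + v))\<^sup>2 / 2)) * norm (Q n (u + v)) \<le> 1 * B"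
          by (intro mult_mono) auto
        then have "bump u * (\<sigma> n * sqrt (2 * pi) * (exp (- ((\<sigma> n * (u + v))\<^sup>2 / 2)) * norm (Q n (u + v)))) \<le> bump u * (\<sigma> n * sqrt (2 * pi) * B)"
          using \<sigma>_pos[of n] by (intro mult_left_mono) auto
        then show ?thesis using \<sigma>_pos[of n] B0 by (simp add: norm_mult abs_mult mult.assoc)
      qed (simp add: bump_eq_0)
    qed
  qed measurable
  have diff: "(\<lambda>n. (\<integral>u. ?A n u \<partial>lborel) - (\<integral>u. ?B n u \<partial>lborel)) \<longlonglongrightarrow> 0"
  proof (rule Lim_null_comparison)
    show "(\<lambda>n. (\<integral>u. bump u \<partial>lborel) * \<eta> n) \<longlonglongrightarrow> 0"
      using tendsto_mult_right_zero[OF \<eta>(1)] .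
    show "\<forall>\<^sub>F n in sequentially. norm ((\<integral>u. ?A n u \<partial>lborel) - (\<integral>u. ?B n u \<partial>lborel)) \<le> (\<integral>u. bump u \<partial>lborel) * \<eta> n"
      using \<eta>(2)
    proof eventually_elim
      case (elim n)
      have "norm ((\<integral>u. ?A n u \<partial>lborel) - (\<integral>u. ?B n u \<partial>lborel))
         = norm (\<integral>u. ?A n u - ?B n u \<partial>lborel)"
        by (subst Bochner_Integration.integral_diff[OF int1 int2]) simp
      also have "\<dots> \<le> (\<integral>u. norm (?A n u - ?B n u) \<partial>lborel)"
        by (rule integral_norm_bound)
      also have "\<dots> \<le> (\<integral>u. bump u * \<eta> n \<partial>lborel)"
      proof (rule integral_mono)
        show "integrable lborel (\<lambda>u. norm (?A n u - ?B n u))"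
          using int1 int2 by (intro integrable_norm Bochner_Integration.integrable_diff)
        show "integrable lborel (\<lambda>u. bump u * \<eta> n)" using integrable_bump by simp
        fix u
        show "norm (?A n u - ?B n u) \<le> bump u * \<eta> n"
        proof (cases "\<bar>u\<bar> \<le> 1")
          case True
          then have "\<bar>u + v\<bar> \<le> 1 + \<bar>v\<bar>" by linarith
          then have "norm (?ch n (u + v) - ?G n (u + v)) \<le> \<eta> n" using elim by blast
          then have "bump u * norm (?ch n (u + v) - ?G n (u + v)) \<le> bump u * \<eta> n" by (intro mult_left_mono) auto
          then show ?thesis unfolding right_diff_distrib[symmetric] norm_mult norm_of_real by simp
        qed (simp add: bump_eq_0)
      qed
      finally show ?case by simp
    qed
  qed
  show ?thesis
    unfolding integral_bump_hat_iexp[OF fin sets] by (rule Lim_transform[OF main_term_limit diff])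
qed

end

text \<open>
  A multiple of a centred Gaussian law, scaled to have density 1 at the origin.
\<close>

definition gaussian_reference :: "real \<Rightarrow> real measure" where
  "gaussian_reference \<sigma> = density lborel (\<lambda>y. ennreal (exp (- ((y / \<sigma>)\<^sup>2 / 2))))"

lemma integral_gaussian_reference:
  fixes f :: "real \<Rightarrow> 'b::{banach, second_countable_topology}"
  assumes "f \<in> borel_measurable borel"
  shows "integral\<^sup>L (gaussian_reference \<sigma>) f = (\<integral>y. exp (- ((y / \<sigma>)\<^sup>2 / 2)) *\<^sub>R f y \<partial>lborel)"
  unfolding gaussian_reference_def using assms by (subst integral_density) auto

lemma finite_measure_gaussian_reference:
  assumes "\<sigma> > 0"
  shows "finite_measure (gaussian_reference \<sigma>)"
proof (rule finite_measureI)
  have "integrable lborel (\<lambda>y. sqrt (2 * pi) * std_normal_density (0 + 1 / \<sigma> * y))"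
    by (intro integrable_mult_right lborel_integrable_real_affine) (use assms in auto)
  then have "integrable lborel (\<lambda>y. exp (- ((y / \<sigma>)\<^sup>2 / 2)))" by (simp add: std_normal_density_def)
  then show "emeasure (gaussian_reference \<sigma>) (space (gaussian_reference \<sigma>)) \<noteq> \<infinity>"
    by (simp add: gaussian_reference_def emeasure_density nn_integral_eq_integral)
qed

lemma integral_gaussian_reference_iexp:
  assumes "\<sigma> > 0"
  shows "(\<integral>y. iexp (u * y) \<partial>gaussian_reference \<sigma>) = of_real (gaussian_hat \<sigma> u)"
proof -
  let ?g = "\<lambda>y. exp (- ((y / \<sigma>)\<^sup>2 / 2))"
  have "(\<integral>y. iexp (u * y) \<partial>gaussian_reference \<sigma>) = (\<integral>y. ?g y *\<^sub>R iexp (u * y) \<partial>lborel)"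
    by (rule integral_gaussian_reference) measurable
  also have "\<dots> = \<bar>\<sigma>\<bar> *\<^sub>R (\<integral>x. ?g (0 + \<sigma> * x) *\<^sub>R iexp (u * (0 + \<sigma> * x)) \<partial>lborel)"
    by (rule lborel_integral_real_affine) (use assms in simp)
  also have "\<dots> = \<sigma> *\<^sub>R (\<integral>x. sqrt (2 * pi) *\<^sub>R (std_normal_density x *\<^sub>R iexp (\<sigma> * u * x)) \<partial>lborel)"
    using assms by (simp add: std_normal_density_def mult_ac)
  also have "\<dots> = \<sigma> *\<^sub>R sqrt (2 * pi) *\<^sub>R (\<integral>x. std_normal_density x *\<^sub>R iexp (\<sigma> * u * x) \<partial>lborel)"
    by (simp only: integral_scaleR_right)
  also have "(\<integral>x. std_normal_density x *\<^sub>R iexp (\<sigma> * u * x) \<partial>lborel) = char std_normal_distribution (\<sigma> * u)"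
    unfolding char_def by (subst integral_density) auto
  finally show ?thesis by (simp add: char_std_normal_distribution scaleR_conv_of_real)
qed

lemma mod_gaussian_char_gaussian_reference:
  assumes "\<And>n. \<sigma> n > 0" "filterlim \<sigma> at_top sequentially"
  shows "mod_gaussian_char (\<lambda>n. gaussian_reference (\<sigma> n)) \<sigma> (\<lambda>_ _. 1) 1"
proof (rule mod_gaussian_char.intro)
  show "finite_measure (gaussian_reference (\<sigma> n))" for n by (rule finite_measure_gaussian_reference[OF assms(1)])
  show "\<exists>\<eta>. \<eta> \<longlonglongrightarrow> 0 \<and> (\<forall>\<^sub>F n in sequentially. \<forall>u. \<bar>u\<bar> \<le> U \<longrightarrow>
      norm ((\<integral>y. iexp (u * y) \<partial>gaussian_reference (\<sigma> n)) - of_real (gaussian_hat (\<sigma> n) u) * 1) \<le> \<eta> n)" for U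
    by (intro exI[of _ "\<lambda>_. 0"]) (simp only: integral_gaussian_reference_iexp[OF assms(1)] mult_1_right diff_self norm_zero order_refl, simp)
qed (auto simp: gaussian_reference_def assms)

text \<open>
  Fourier inversion, obtained by applying the limit theorem to the Gaussian reference measures,
  whose densities increase to 1.
\<close>

theorem integral_lborel_bump_hat:
  "(\<integral>y. of_real (bump_hat y) * iexp (v * y) \<partial>lborel) = of_real (2 * pi * bump v)"
proof -
  define \<sigma> where "\<sigma> = (\<lambda>n. real n + 1)"
  have "\<sigma> n > 0" for n by (simp add: \<sigma>_def)
  moreover have "filterlim \<sigma> at_top sequentially" unfolding \<sigma>_def by real_asymp
  ultimately interpret mod_gaussian_char "\<lambda>n. gaussian_reference (\<sigma> n)" \<sigma> "\<lambda>_ _. 1" 1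
    by (rule mod_gaussian_char_gaussian_reference)
  let ?f = "\<lambda>y. complex_of_real (bump_hat y) * iexp (v * y)"
  let ?g = "\<lambda>n y. exp (- ((y / \<sigma> n)\<^sup>2 / 2))"
  have "(\<lambda>n. \<integral>y. ?g n y *\<^sub>R ?f y \<partial>lborel) \<longlonglongrightarrow> 2 * pi * bump v * 1"
    using bump_hat_transform_limit[of v] by (subst (asm) integral_gaussian_reference) auto
  moreover have "(\<lambda>n. \<integral>y. ?g n y *\<^sub>R ?f y \<partial>lborel) \<longlonglongrightarrow> (\<integral>y. ?f y \<partial>lborel)"
  proof (rule integral_dominated_convergence[where w=bump_hat])
    show "AE y in lborel. (\<lambda>n. ?g n y *\<^sub>R ?f y) \<longlonglongrightarrow> ?f y"
    proof (rule AE_I2)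
      fix y
      have "(\<lambda>n. y / \<sigma> n) \<longlonglongrightarrow> 0"
        by (intro tendsto_divide_0[OF tendsto_const] filterlim_at_top_imp_at_infinity \<sigma>_lim)
      then have "(\<lambda>n. ?g n y) \<longlonglongrightarrow> exp (- (0\<^sup>2 / 2))" by (intro tendsto_intros) simp_all
      then have "(\<lambda>n. ?g n y) \<longlonglongrightarrow> 1" by simp
      from tendsto_scaleR[OF this tendsto_const] show "(\<lambda>n. ?g n y *\<^sub>R ?f y) \<longlonglongrightarrow> ?f y" by simp
    qed
    show "AE y in lborel. norm (?g n y *\<^sub>R ?f y) \<le> bump_hat y" for n
      using bump_hat_pos by (intro AE_I2) (auto simp: norm_mult less_imp_le mult_left_le_one_le)
  qed (use integrable_bump_hat in auto)
  ultimately show ?thesis using LIMSEQ_unique by fastforce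
qed

lemma integrable_bump_hat_finite:
  assumes "finite_measure \<nu>" "sets \<nu> = sets borel"
  shows "integrable \<nu> bump_hat"
proof -
  interpret finite_measure \<nu> by fact
  note [measurable_cong] = assms(2)
  show ?thesis
    by (rule integrable_const_bound[where B=2])
       (use bump_hat_le_2 bump_hat_pos in \<open>auto simp: less_imp_le intro!: AE_I2\<close>)
qed

lemma real_distribution_density_bump_hat:
  fixes m :: real
  assumes sets: "sets \<nu> = sets borel" and int: "integrable \<nu> bump_hat" and m: "integral\<^sup>L \<nu> bump_hat = m" "m > 0"
  shows "real_distribution (density \<nu> (\<lambda>y. ennreal (bump_hat y / m)))"
proof -
  note [measurable_cong] = sets
  have "emeasure (density \<nu> (\<lambda>y. ennreal (bump_hat y / m))) (space \<nu>) = (\<integral>\<^sup>+y. ennreal (bump_hat y / m) \<partial>\<nu>)"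
    by (subst emeasure_density) (auto intro!: nn_integral_cong)
  also have "\<dots> = ennreal (\<integral>y. bump_hat y / m \<partial>\<nu>)"
    using int m bump_hat_pos by (intro nn_integral_eq_integral) (auto simp: less_imp_le)
  also have "\<dots> = 1" using m by simp
  finally have "prob_space (density \<nu> (\<lambda>y. ennreal (bump_hat y / m)))"
    by (intro prob_spaceI) simp
  then show ?thesis
    using sets sets_eq_imp_space_eq[OF sets] by (simp add: real_distribution_def real_distribution_axioms_def)
qed

lemma integral_density_bump_hat:
  fixes f :: "real \<Rightarrow> 'b::{banach, second_countable_topology}"
  assumes sets: "sets \<nu> = sets borel" and m: "m > 0" and f: "f \<in> borel_measurable borel"
  shows "integral\<^sup>L (density \<nu> (\<lambda>y. ennreal (bump_hat y / m))) f = (1 / m) *\<^sub>R (\<integral>y. bump_hat y *\<^sub>R f y \<partial>\<nu>)"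
proof -
  note [measurable_cong] = sets
  have "integral\<^sup>L (density \<nu> (\<lambda>y. ennreal (bump_hat y / m))) f = (\<integral>y. (bump_hat y / m) *\<^sub>R f y \<partial>\<nu>)"
    using m bump_hat_pos f by (intro integral_density) (auto simp: less_imp_le)
  also have "\<dots> = (\<integral>y. (1 / m) *\<^sub>R (bump_hat y *\<^sub>R f y) \<partial>\<nu>)" by simp
  finally show ?thesis by (simp only: integral_scaleR_right)
qed

context mod_gaussian_char
begin

lemma total_mass_limit: "(\<lambda>n. of_real (integral\<^sup>L (\<nu> n) bump_hat)) \<longlonglongrightarrow> 2 * pi * c"
  using bump_hat_transform_limit[of 0] by simp

text \<open>
  After multiplication by \<open>bump_hat\<close> and normalisation, the \<open>\<nu> n\<close> become probability measures whose
  characteristic functions converge, so the Levy continuity theorem gives weak convergence.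
\<close>

theorem vague_limit:
  fixes h :: "real \<Rightarrow> real"
  assumes c: "c = of_real c'" "c' > 0"
    and h [measurable]: "h \<in> borel_measurable borel" and h_bdd: "\<And>y. \<bar>h y\<bar> \<le> B"
    and h_cont: "emeasure lborel {y. \<not> isCont h y} = 0"
  shows "(\<lambda>n. \<integral>y. bump_hat y * h y \<partial>\<nu> n) \<longlonglongrightarrow> c' * (\<integral>y. bump_hat y * h y \<partial>lborel)"
proof -
  define m where "m = (\<lambda>n. integral\<^sup>L (\<nu> n) bump_hat)"
  have m_lim: "m \<longlonglongrightarrow> 2 * pi * c'"
  proof -
    have "(\<lambda>n. complex_of_real (m n)) \<longlonglongrightarrow> of_real (2 * pi * c')"
      using total_mass_limit by (simp add: m_def c)
    then show ?thesis by (simp only: tendsto_of_real_iff)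
  qed
  have ev: "\<forall>\<^sub>F n in sequentially. m n > 0"
    using order_tendstoD(1)[OF m_lim, of 0] c by simp
  have mL: "integral\<^sup>L lborel bump_hat = 2 * pi"
  proof -
    have "complex_of_real (integral\<^sup>L lborel bump_hat) = of_real (2 * pi)"
      using integral_lborel_bump_hat[of 0] by simp
    then show ?thesis by (simp only: of_real_eq_iff)
  qed
  define M' where "M' = density lborel (\<lambda>y. ennreal (bump_hat y / (2 * pi)))"
  \<comment> \<open>The finitely many \<open>\<nu> n\<close> without mass cannot be normalised; the limit law stands in for them.\<close>
  define M where "M = (\<lambda>n. if m n > 0 then density (\<nu> n) (\<lambda>y. ennreal (bump_hat y / m n)) else M')"
  have M': "real_distribution M'"
    unfolding M'_def by (rule real_distribution_density_bump_hat) (use integrable_bump_hat mL in auto)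
  have M: "real_distribution (M n)" for n
    unfolding M_def using real_distribution_density_bump_hat[OF sets integrable_bump_hat_finite[OF fin sets], of n "m n"] M'
    by (simp add: m_def)
  have ch': "char M' t = of_real (bump t)" for t
  proof -
    have "char M' t = (1 / (2 * pi)) *\<^sub>R (\<integral>y. bump_hat y *\<^sub>R iexp (t * y) \<partial>lborel)"
      unfolding char_def M'_def by (rule integral_density_bump_hat) auto
    also have "(\<integral>y. bump_hat y *\<^sub>R iexp (t * y) \<partial>lborel) = of_real (2 * pi * bump t)"
      unfolding integral_lborel_bump_hat[symmetric] by (simp add: scaleR_conv_of_real)
    finally show ?thesis by (simp add: scaleR_conv_of_real)
  qed
  have ch: "(\<lambda>n. char (M n) t) \<longlonglongrightarrow> char M' t" for t
  proof (rule Lim_transform_eventually)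
    have "(\<lambda>n. (1 / m n) *\<^sub>R (\<integral>y. of_real (bump_hat y) * iexp (t * y) \<partial>\<nu> n)) \<longlonglongrightarrow> (1 / (2 * pi * c')) *\<^sub>R (2 * pi * bump t * c)"
      using c by (intro tendsto_intros m_lim bump_hat_transform_limit) simp
    then show "(\<lambda>n. (1 / m n) *\<^sub>R (\<integral>y. of_real (bump_hat y) * iexp (t * y) \<partial>\<nu> n)) \<longlonglongrightarrow> char M' t"
      using c by (simp add: ch' scaleR_conv_of_real)
    show "\<forall>\<^sub>F n in sequentially. (1 / m n) *\<^sub>R (\<integral>y. of_real (bump_hat y) * iexp (t * y) \<partial>\<nu> n) = char (M n) t"
      using ev
    proof eventually_elim
      case (elim n)
      have "char (M n) t = (1 / m n) *\<^sub>R (\<integral>y. bump_hat y *\<^sub>R iexp (t * y) \<partial>\<nu> n)"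
        unfolding char_def M_def using elim by (simp only: if_True) (rule integral_density_bump_hat[OF sets], auto)
      then show ?case by (simp add: scaleR_conv_of_real)
    qed
  qed
  have weak: "weak_conv_m M M'" by (rule levy_continuity[OF M M' ch])
  have null: "emeasure M' {y. \<not> isCont h y} = 0"
  proof -
    have "AE y in lborel. isCont h y"
      using h_cont by (intro AE_I[of _ _ "{y. \<not> isCont h y}"]) (auto simp: null_sets_def)
    then have "AE y in M'. isCont h y" unfolding M'_def by (subst AE_density) auto
    then show ?thesis using emeasure_eq_0_AE[of "\<lambda>y. \<not> isCont h y" M'] by (simp add: M'_def)
  qed
  have "(\<lambda>n. integral\<^sup>L (M n) h) \<longlonglongrightarrow> integral\<^sup>L M' h"
    by (rule weak_conv_imp_bdd_ae_continuous_conv[OF M M' weak null, of B]) (use h_bdd in auto)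
  then have "(\<lambda>n. m n * integral\<^sup>L (M n) h) \<longlonglongrightarrow> 2 * pi * c' * integral\<^sup>L M' h"
    by (intro tendsto_mult m_lim)
  moreover have "\<forall>\<^sub>F n in sequentially. m n * integral\<^sup>L (M n) h = (\<integral>y. bump_hat y * h y \<partial>\<nu> n)"
    using ev
  proof eventually_elim
    case (elim n)
    have "integral\<^sup>L (M n) h = (1 / m n) *\<^sub>R (\<integral>y. bump_hat y *\<^sub>R h y \<partial>\<nu> n)"
      unfolding M_def using elim by (simp only: if_True) (rule integral_density_bump_hat[OF sets], auto)
    then show ?case using elim by simp
  qed
  moreover have "integral\<^sup>L M' h = (1 / (2 * pi)) *\<^sub>R (\<integral>y. bump_hat y *\<^sub>R h y \<partial>lborel)"
    unfolding M'_def by (rule integral_density_bump_hat) auto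
  ultimately show ?thesis by (auto intro: Lim_transform_eventually)
qed

lemma mass_bounded: "\<exists>C. \<forall>n. integral\<^sup>L (\<nu> n) bump_hat \<le> C"
proof -
  have "Bseq (\<lambda>n. complex_of_real (integral\<^sup>L (\<nu> n) bump_hat))"
    using total_mass_limit by (intro convergent_imp_Bseq convergentI)
  then show ?thesis unfolding Bseq_def by (auto intro: order_trans[OF abs_ge_self])
qed

text \<open>
  The test function \<open>exp (- k y)\<close> on the half line is \<open>bump_hat\<close> times a bounded function with one
  discontinuity.  Moving the rate from \<open>k\<close> to \<open>s n\<close> changes it by a small multiple of \<open>bump_hat\<close>.
\<close>

theorem one_sided_exponential_limit:
  fixes s :: "nat \<Rightarrow> real"
  assumes c: "c = of_real c'" "c' > 0" and s: "s \<longlonglongrightarrow> k" and k: "k > 0"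
  shows "(\<lambda>n. \<integral>y. indicator {0..} y * exp (- s n * y) \<partial>\<nu> n) \<longlonglongrightarrow> c' / k"
proof -
  let ?I = "\<lambda>a n. \<integral>y. indicator {0..} y * exp (- a * y) \<partial>\<nu> n"
  obtain C where C: "\<And>y. y \<ge> 0 \<Longrightarrow> (1 + y) * exp (- (k / 2) * y) \<le> C * bump_hat y"
    using exp_le_bump_hat[of "k / 2"] k by auto
  obtain D where D: "\<And>n. integral\<^sup>L (\<nu> n) bump_hat \<le> D" using mass_bounded by blast
  define h where "h = (\<lambda>y. indicator {0..} y * exp (- k * y) / bump_hat y)"
  have bk: "bump_hat y * h y = indicator {0..} y * exp (- k * y)" for y
    using bump_hat_pos[of y] by (simp add: h_def)
  have h_meas [measurable]: "h \<in> borel_measurable borel" unfolding h_def by measurable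
  have C0: "C \<ge> 0"
  proof -
    have "0 < C * bump_hat 0" using C[of 0] by simp
    then show ?thesis using bump_hat_pos[of 0] by (simp add: zero_less_mult_iff)
  qed
  have h_bdd: "\<bar>h y\<bar> \<le> C" for y
  proof (cases "y \<ge> 0")
    case True
    have "exp (- k * y) \<le> 1 * exp (- (k / 2) * y)" using True k by simp
    also have "\<dots> \<le> (1 + y) * exp (- (k / 2) * y)" using True by (intro mult_right_mono) auto
    also have "\<dots> \<le> C * bump_hat y" by (rule C[OF True])
    finally have "exp (- k * y) \<le> C * bump_hat y" .
    then show ?thesis using True bump_hat_pos[of y] by (simp add: h_def pos_divide_le_eq)
  next
    case False
    then show ?thesis using C0 by (simp add: h_def)
  qed
  have h_cont: "emeasure lborel {y. \<not> isCont h y} = 0"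
  proof -
    have "isCont h y" if "y \<noteq> 0" for y
    proof -
      have "isCont (\<lambda>y. (if y > 0 then 1 else 0) * exp (- k * y) / bump_hat y) y" (is "isCont ?g y")
      proof -
        have "isCont (\<lambda>y. d * exp (- k * y) / bump_hat y) y" for d
          using bump_hat_pos[of y] by (intro continuous_intros isCont_bump_hat) auto
        moreover have "\<forall>\<^sub>F z in nhds y. ?g z = (if y > 0 then 1 else 0) * exp (- k * z) / bump_hat z"
        proof (cases "y > 0")
          case True
          then have "\<forall>\<^sub>F z in nhds y. z > 0" by (rule order_tendstoD(1)[OF filterlim_ident])
          then show ?thesis by eventually_elim (use True in auto)
        next
          case False
          then have "\<forall>\<^sub>F z in nhds y. z < 0" using that by (intro order_tendstoD(2)[OF filterlim_ident]) auto
          then show ?thesis by eventually_elim (use False in auto)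
        qed
        ultimately show ?thesis using isCont_cong[of ?g "\<lambda>z. (if y > 0 then 1 else 0) * exp (- k * z) / bump_hat z" y] by blast
      qed
      moreover have "\<forall>\<^sub>F z in nhds y. h z = ?g z"
        using t1_space_nhds[OF that] by eventually_elim (auto simp: h_def indicator_def)
      ultimately show ?thesis using isCont_cong[of h ?g y] by blast
    qed
    then have "{y. \<not> isCont h y} \<subseteq> {0}" by auto
    then show ?thesis using emeasure_mono[of "{y. \<not> isCont h y}" "{0}" lborel] by simp
  qed
  have lim: "(\<lambda>n. \<integral>y. indicator {0..} y * exp (- k * y) \<partial>\<nu> n) \<longlonglongrightarrow> c' * (\<integral>y. indicator {0..} y * exp (- k * y) \<partial>lborel)"
    using vague_limit[OF c h_meas h_bdd h_cont] by (simp only: bk)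
  have val: "(\<integral>y. indicator {0..} y * exp (- k * y) \<partial>lborel) = 1 / k"
  proof -
    interpret E: prob_space "density lborel (exponential_density k)"
      by (rule prob_space_exponential_density[OF k])
    have "1 = integral\<^sup>L (density lborel (exponential_density k)) (\<lambda>_. 1 :: real)"
      using E.prob_space by simp
    also have "\<dots> = (\<integral>y. exponential_density k y *\<^sub>R 1 \<partial>lborel)"
      by (rule integral_density) (use exponential_density_nonneg[OF k] in auto)
    also have "\<dots> = (\<integral>y. k * (indicator {0..} y * exp (- k * y)) \<partial>lborel)"
      by (intro Bochner_Integration.integral_cong) (auto simp: exponential_density_def indicator_def mult_ac)
    finally show ?thesis using k by (simp add: field_simps)
  qed
  have int_exp: "integrable (\<nu> n) (\<lambda>y. indicator {0..} y * exp (- a * y))" if "a \<ge> 0" for n a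
  proof -
    interpret finite_measure "\<nu> n" by (rule fin)
    show ?thesis
      by (rule integrable_const_bound[where B=1]) (use that in \<open>auto simp: indicator_def\<close>)
  qed
  have close: "(\<lambda>n. ?I (s n) n - ?I k n) \<longlonglongrightarrow> 0"
  proof (rule Lim_null_comparison)
    show "(\<lambda>n. \<bar>s n - k\<bar> * (C * D)) \<longlonglongrightarrow> 0"
      using s by (intro tendsto_mult_left_zero) (simp add: tendsto_rabs_zero_iff LIM_zero_iff)
    have "\<forall>\<^sub>F n in sequentially. s n > k / 2" using order_tendstoD(1)[OF s, of "k / 2"] k by simp
    then show "\<forall>\<^sub>F n in sequentially. norm (?I (s n) n - ?I k n) \<le> \<bar>s n - k\<bar> * (C * D)"
    proof eventually_elim
      case (elim n)
      have pt: "\<bar>exp (- a * y) - exp (- b * y)\<bar> \<le> \<bar>a - b\<bar> * (C * bump_hat y)"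
        if "a \<le> b" "a \<ge> k / 2" "y \<ge> 0" for a b y
      proof -
        have "exp (- a * y) - exp (- b * y) = exp (- a * y) * (1 - exp (- ((b - a) * y)))"
          by (simp add: algebra_simps flip: exp_add)
        also have "\<dots> \<le> exp (- (k / 2) * y) * ((b - a) * y)"
        proof (rule mult_mono)
          show "exp (- a * y) \<le> exp (- (k / 2) * y)" using mult_right_mono[OF that(2,3)] by simp
          show "1 - exp (- ((b - a) * y)) \<le> (b - a) * y" using exp_ge_add_one_self[of "- ((b - a) * y)"] by simp
        qed (use that in auto)
        also have "\<dots> \<le> (b - a) * ((1 + y) * exp (- (k / 2) * y))"
          using that by (auto simp: algebra_simps intro!: mult_left_mono)
        also have "\<dots> \<le> (b - a) * (C * bump_hat y)" using that by (intro mult_left_mono C) auto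
        finally have "exp (- a * y) - exp (- b * y) \<le> \<bar>a - b\<bar> * (C * bump_hat y)" using that by simp
        moreover have "exp (- a * y) - exp (- b * y) \<ge> 0" using mult_right_mono[OF that(1,3)] by simp
        ultimately show ?thesis by simp
      qed
      have pt': "\<bar>indicator {0..} y * exp (- s n * y) - indicator {0..} y * exp (- k * y)\<bar> \<le> \<bar>s n - k\<bar> * (C * bump_hat y)" for y
      proof (cases "y \<ge> 0")
        case True
        then show ?thesis using pt[of "s n" k y] pt[of k "s n" y] elim k
          by (cases "s n \<le> k") (auto simp: abs_minus_commute)
      next
        case False
        then show ?thesis using C0 bump_hat_pos[of y] by simp
      qed
      have "norm (?I (s n) n - ?I k n)
         = \<bar>\<integral>y. indicator {0..} y * exp (- s n * y) - indicator {0..} y * exp (- k * y) \<partial>\<nu> n\<bar>"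
        using elim k by (subst Bochner_Integration.integral_diff[OF int_exp int_exp]) auto
      also have "\<dots> \<le> (\<integral>y. \<bar>indicator {0..} y * exp (- s n * y) - indicator {0..} y * exp (- k * y)\<bar> \<partial>\<nu> n)"
        by (rule integral_abs_bound)
      also have "\<dots> \<le> (\<integral>y. \<bar>s n - k\<bar> * (C * bump_hat y) \<partial>\<nu> n)"
        using elim k pt' by (intro integral_mono integrable_abs Bochner_Integration.integrable_diff int_exp
          integrable_mult_right integrable_bump_hat_finite[OF fin sets]) auto
      also have "\<dots> \<le> \<bar>s n - k\<bar> * (C * D)"
        using D[of n] C0 by (simp add: mult_left_mono)
      finally show ?case .
    qed
  qed
  show ?thesis using Lim_transform[OF lim[unfolded val] close] by simp
qed

end

section \<open>Large deviations under mod-Gaussian convergence\<close>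

abbreviation gaussian_tail :: "real \<Rightarrow> real" where
  "gaussian_tail D \<equiv> (LBINT u:{D..}. exp (- u\<^sup>2 / 2) / sqrt (2 * pi))"

text \<open>
  The substitution \<open>u = \<Delta> + y / \<sigma>\<close> turns the Gaussian tail into the one-sided exponential integral
  against the Gaussian reference measure.
\<close>

theorem gaussian_tail_limit:
  fixes \<sigma> s :: "nat \<Rightarrow> real"
  assumes \<sigma>: "\<And>n. \<sigma> n > 0" "filterlim \<sigma> at_top sequentially" and s: "s \<longlonglongrightarrow> k" "k > 0"
  shows "(\<lambda>n. sqrt (2 * pi) * \<sigma> n * exp ((s n * \<sigma> n)\<^sup>2 / 2) *
           gaussian_tail (s n * \<sigma> n)) \<longlonglongrightarrow> 1 / k"
proof -
  interpret mod_gaussian_char "\<lambda>n. gaussian_reference (\<sigma> n)" \<sigma> "\<lambda>_ _. 1" 1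
    by (rule mod_gaussian_char_gaussian_reference[OF \<sigma>])
  have "(\<lambda>n. \<integral>y. indicator {0..} y * exp (- s n * y) \<partial>gaussian_reference (\<sigma> n)) \<longlonglongrightarrow> 1 / k"
    by (rule one_sided_exponential_limit) (use s in auto)
  also have "(\<lambda>n. \<integral>y. indicator {0..} y * exp (- s n * y) \<partial>gaussian_reference (\<sigma> n))
    = (\<lambda>n. sqrt (2 * pi) * \<sigma> n * exp ((s n * \<sigma> n)\<^sup>2 / 2) * gaussian_tail (s n * \<sigma> n))"
  proof
    fix n
    define D where "D = s n * \<sigma> n"
    let ?f = "\<lambda>u. indicator {D..} u *\<^sub>R (exp (- u\<^sup>2 / 2) / sqrt (2 * pi))"
    have pt: "sqrt (2 * pi) * exp (D\<^sup>2 / 2) * ?f (D + 1 / \<sigma> n * y) = exp (- ((y / \<sigma> n)\<^sup>2 / 2)) *\<^sub>R (indicator {0..} y * exp (- s n * y))" for y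
    proof -
      have i: "indicator {D..} (D + 1 / \<sigma> n * y) = (indicator {0..} y :: real)"
        using \<sigma>(1)[of n] by (simp add: indicator_def zero_le_divide_iff)
      have "D\<^sup>2 / 2 + - (D + 1 / \<sigma> n * y)\<^sup>2 / 2 = - ((y / \<sigma> n)\<^sup>2 / 2) + - s n * y"
        using \<sigma>(1)[of n] by (simp add: D_def power2_eq_square field_simps)
      then have "exp (D\<^sup>2 / 2) * exp (- (D + 1 / \<sigma> n * y)\<^sup>2 / 2) = exp (- ((y / \<sigma> n)\<^sup>2 / 2)) * exp (- s n * y)"
        by (simp only: exp_add[symmetric])
      then show ?thesis unfolding i by (simp add: field_simps)
    qed
    have "(\<integral>u. ?f u \<partial>lborel) = \<bar>1 / \<sigma> n\<bar> *\<^sub>R (\<integral>y. ?f (D + 1 / \<sigma> n * y) \<partial>lborel)"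
      by (rule lborel_integral_real_affine) (use \<sigma>(1)[of n] in simp)
    then have "sqrt (2 * pi) * \<sigma> n * exp (D\<^sup>2 / 2) * (\<integral>u. ?f u \<partial>lborel) = sqrt (2 * pi) * exp (D\<^sup>2 / 2) * (\<integral>y. ?f (D + 1 / \<sigma> n * y) \<partial>lborel)"
      using \<sigma>(1)[of n] by simp
    also have "\<dots> = (\<integral>y. sqrt (2 * pi) * exp (D\<^sup>2 / 2) * ?f (D + 1 / \<sigma> n * y) \<partial>lborel)"
      by (simp only: integral_mult_right_zero)
    also have "\<dots> = (\<integral>y. indicator {0..} y * exp (- s n * y) \<partial>gaussian_reference (\<sigma> n))"
      unfolding pt by (rule integral_gaussian_reference[symmetric]) measurable
    finally show "(\<integral>y. indicator {0..} y * exp (- s n * y) \<partial>gaussian_reference (\<sigma> n))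
      = sqrt (2 * pi) * \<sigma> n * exp ((s n * \<sigma> n)\<^sup>2 / 2) * gaussian_tail (s n * \<sigma> n)"
      unfolding D_def set_lebesgue_integral_def by simp
  qed
  finally show ?thesis .
qed

text \<open>
  The measure \<open>\<nu> n\<close> below is the law of \<open>S - s \<sigma>\<^sup>2\<close>, restricted to \<open>\<bar>S\<bar> \<le> R\<close>, tilted by \<open>exp (s S)\<close> and
  multiplied by \<open>sqrt (2 pi) \<sigma> exp (- s\<^sup>2 \<sigma>\<^sup>2 / 2)\<close>.  The centring at \<open>s \<sigma>\<^sup>2\<close> cancels the oscillation of
  \<open>exp ((s + i u)\<^sup>2 \<sigma>\<^sup>2 / 2)\<close> and leaves \<open>exp (- u\<^sup>2 \<sigma>\<^sup>2 / 2)\<close>.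
\<close>

theorem mod_gaussian_tail:
  fixes M :: "nat \<Rightarrow> 'a measure" and S :: "nat \<Rightarrow> 'a \<Rightarrow> real" and R \<sigma> s :: "nat \<Rightarrow> real"
    and Q :: "nat \<Rightarrow> complex \<Rightarrow> complex" and k c :: real
  assumes prob: "\<And>n. prob_space (M n)" and S_meas [measurable]: "\<And>n. S n \<in> borel_measurable (M n)"
    and \<sigma>_pos: "\<And>n. \<sigma> n > 0" and \<sigma>_lim: "filterlim \<sigma> at_top sequentially"
    and s: "s \<longlonglongrightarrow> k" and k: "k > 0" and c: "c > 0"
    and Q_cont: "\<And>n. continuous_on UNIV (Q n)"
    and Q_bdd: "\<And>K. \<exists>B. \<forall>n z. norm z \<le> K \<longrightarrow> norm (Q n z) \<le> B"
    and Q_lim: "\<And>z. z \<longlonglongrightarrow> of_real k \<Longrightarrow> (\<lambda>n. Q n (z n)) \<longlonglongrightarrow> of_real c"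
    and approx: "\<And>K. \<exists>\<eta>. (\<lambda>n. \<sigma> n * \<eta> n) \<longlonglongrightarrow> 0 \<and> (\<forall>\<^sub>F n in sequentially. \<forall>z. norm z \<le> K \<longrightarrow>
        norm (truncated_mgf (M n) (S n) (R n) z - exp (z\<^sup>2 * of_real ((\<sigma> n)\<^sup>2) / 2) * Q n z) \<le> \<eta> n)"
  shows "(\<lambda>n. sqrt (2 * pi) * \<sigma> n * exp ((s n * \<sigma> n)\<^sup>2 / 2) *
            measure (M n) {t \<in> space (M n). S n t \<in> {-R n..R n} \<and> S n t \<ge> s n * (\<sigma> n)\<^sup>2}) \<longlonglongrightarrow> c / k"
proof -
  define V where "V = (\<lambda>n. s n * (\<sigma> n)\<^sup>2)"
  define A where "A = (\<lambda>n. sqrt (2 * pi) * \<sigma> n * exp (- ((s n * \<sigma> n)\<^sup>2 / 2)))"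
  define W where "W = (\<lambda>n t. A n * exp (s n * S n t) * indicator {-R n..R n} (S n t))"
  define \<nu> where "\<nu> = (\<lambda>n. distr (density (M n) (\<lambda>t. ennreal (W n t))) borel (\<lambda>t. S n t - V n))"
  have A_pos: "A n > 0" for n using \<sigma>_pos[of n] by (simp add: A_def)
  have W_nonneg: "W n t \<ge> 0" for n t using A_pos[of n] by (simp add: W_def)
  have W_meas [measurable]: "W n \<in> borel_measurable (M n)" for n unfolding W_def by measurable
  have W_int: "integrable (M n) (W n)" for n
  proof -
    interpret prob_space "M n" by (rule prob)
    have "W n t \<le> A n * exp (\<bar>s n\<bar> * R n)" for t
    proof (cases "S n t \<in> {-R n..R n}")
      case True
      have "s n * S n t \<le> \<bar>s n\<bar> * \<bar>S n t\<bar>" by (metis abs_ge_self abs_mult)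
      also have "\<dots> \<le> \<bar>s n\<bar> * R n" using True by (intro mult_left_mono) auto
      finally show ?thesis using True A_pos[of n] by (simp add: W_def)
    qed (use A_pos[of n] in \<open>simp add: W_def\<close>)
    then show ?thesis
      by (intro integrable_const_bound[where B="A n * exp (\<bar>s n\<bar> * R n)"]) (auto simp: W_nonneg)
  qed
  have int_nu: "integral\<^sup>L (\<nu> n) f = (\<integral>t. W n t *\<^sub>R f (S n t - V n) \<partial>M n)"
    if f: "f \<in> borel_measurable borel" for n and f :: "real \<Rightarrow> 'b::{banach,second_countable_topology}"
  proof -
    note [measurable] = f
    have "integral\<^sup>L (\<nu> n) f = integral\<^sup>L (density (M n) (\<lambda>t. ennreal (W n t))) (\<lambda>t. f (S n t - V n))"
      unfolding \<nu>_def by (rule integral_distr) measurable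
    also have "\<dots> = (\<integral>t. W n t *\<^sub>R f (S n t - V n) \<partial>M n)"
      by (rule integral_density) (use W_nonneg in auto)
    finally show ?thesis .
  qed
  have fin: "finite_measure (\<nu> n)" for n
  proof -
    have "finite_measure (density (M n) (\<lambda>t. ennreal (W n t)))"
    proof (rule finite_measureI)
      show "emeasure (density (M n) (\<lambda>t. ennreal (W n t))) (space (density (M n) (\<lambda>t. ennreal (W n t)))) \<noteq> \<infinity>"
        using W_int[of n] W_nonneg[of n] nn_integral_eq_integral[OF W_int[of n]]
        by (auto simp: emeasure_density cong: nn_integral_cong)
    qed
    then show ?thesis unfolding \<nu>_def by (rule finite_measure.finite_measure_distr) measurable
  qed
  obtain K0 where K0: "\<And>n. \<bar>s n\<bar> \<le> K0"
    using convergent_imp_Bseq[OF convergentI[OF s]] unfolding Bseq_def by auto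
  have norm_le: "norm (Complex (s n) u) \<le> K0 + U" if "\<bar>u\<bar> \<le> U" for n u U
    using cmod_le[of "Complex (s n) u"] K0[of n] that by simp
  interpret mod_gaussian_char \<nu> \<sigma> "\<lambda>n u. Q n (Complex (s n) u)" "of_real c"
  proof (rule mod_gaussian_char.intro)
    show "finite_measure (\<nu> n)" for n by (rule fin)
    show "sets (\<nu> n) = sets borel" for n by (simp add: \<nu>_def)
    show "(\<lambda>u. Q n (Complex (s n) u)) \<in> borel_measurable borel" for n
      unfolding Complex_eq
      by (intro borel_measurable_continuous_onI continuous_on_compose2[OF Q_cont]) (auto intro!: continuous_intros)
    show "\<exists>B. \<forall>n u. \<bar>u\<bar> \<le> U \<longrightarrow> norm (Q n (Complex (s n) u)) \<le> B" for U
    proof -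
      obtain B where "\<forall>n z. norm z \<le> K0 + U \<longrightarrow> norm (Q n z) \<le> B" using Q_bdd by blast
      then show ?thesis using norm_le by blast
    qed
    show "(\<lambda>n. Q n (Complex (s n) (r / \<sigma> n))) \<longlonglongrightarrow> of_real c" for r
    proof (rule Q_lim)
      have "(\<lambda>n. r / \<sigma> n) \<longlonglongrightarrow> 0"
        by (intro tendsto_divide_0[OF tendsto_const] filterlim_at_top_imp_at_infinity \<sigma>_lim)
      from tendsto_Complex[OF s this] show "(\<lambda>n. Complex (s n) (r / \<sigma> n)) \<longlonglongrightarrow> of_real k"
        by (simp add: complex_of_real_def)
    qed
    show "\<exists>\<eta>. \<eta> \<longlonglongrightarrow> 0 \<and> (\<forall>\<^sub>F n in sequentially. \<forall>u. \<bar>u\<bar> \<le> U \<longrightarrow>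
        norm ((\<integral>y. iexp (u * y) \<partial>\<nu> n) - of_real (gaussian_hat (\<sigma> n) u) * Q n (Complex (s n) u)) \<le> \<eta> n)" for U
    proof -
      obtain \<eta> where \<eta>: "(\<lambda>n. \<sigma> n * \<eta> n) \<longlonglongrightarrow> 0" "\<forall>\<^sub>F n in sequentially. \<forall>z. norm z \<le> K0 + U \<longrightarrow>
        norm (truncated_mgf (M n) (S n) (R n) z - exp (z\<^sup>2 * of_real ((\<sigma> n)\<^sup>2) / 2) * Q n z) \<le> \<eta> n"
        using approx[of "K0 + U"] by blast
      show ?thesis
      proof (intro exI conjI)
        show "(\<lambda>n. sqrt (2 * pi) * (\<sigma> n * \<bar>\<eta> n\<bar>)) \<longlonglongrightarrow> 0"
        proof (rule tendsto_mult_right_zero)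
          have "\<sigma> n * \<bar>\<eta> n\<bar> = \<bar>\<sigma> n * \<eta> n\<bar>" for n using \<sigma>_pos[of n] by (simp add: abs_mult)
          then show "(\<lambda>n. \<sigma> n * \<bar>\<eta> n\<bar>) \<longlonglongrightarrow> 0" using \<eta>(1) by (simp add: tendsto_rabs_zero_iff)
        qed
        show "\<forall>\<^sub>F n in sequentially. \<forall>u. \<bar>u\<bar> \<le> U \<longrightarrow>
          norm ((\<integral>y. iexp (u * y) \<partial>\<nu> n) - of_real (gaussian_hat (\<sigma> n) u) * Q n (Complex (s n) u))
            \<le> sqrt (2 * pi) * (\<sigma> n * \<bar>\<eta> n\<bar>)"
          using \<eta>(2)
        proof (eventually_elim, intro allI impI)
          fix n u
          assume H: "\<forall>z. norm z \<le> K0 + U \<longrightarrow>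
            norm (truncated_mgf (M n) (S n) (R n) z - exp (z\<^sup>2 * of_real ((\<sigma> n)\<^sup>2) / 2) * Q n z) \<le> \<eta> n" and u: "\<bar>u\<bar> \<le> U"
          define z where "z = Complex (s n) u"
          define a where "a = of_real (A n) * exp (- (\<i> * of_real (u * V n)))"
          have z: "norm z \<le> K0 + U" unfolding z_def by (rule norm_le[OF u])
          have z_eq: "z = of_real (s n) + \<i> * of_real u" by (simp add: z_def Complex_eq)
          have "(\<integral>y. iexp (u * y) \<partial>\<nu> n) = (\<integral>t. W n t *\<^sub>R iexp (u * (S n t - V n)) \<partial>M n)"
            by (rule int_nu) measurable
          also have "\<dots> = (\<integral>t. a * (exp (z * of_real (S n t)) * indicator {-R n..R n} (S n t)) \<partial>M n)"
          proof (intro Bochner_Integration.integral_cong refl)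
            fix t
            have "exp (of_real (s n * S n t)) * iexp (u * (S n t - V n)) = exp (- (\<i> * of_real (u * V n))) * exp (z * of_real (S n t))"
              unfolding exp_add[symmetric] z_eq by (simp add: algebra_simps)
            then show "W n t *\<^sub>R iexp (u * (S n t - V n)) = a * (exp (z * of_real (S n t)) * indicator {-R n..R n} (S n t))"
              unfolding W_def a_def scaleR_conv_of_real of_real_mult exp_of_real[symmetric]
              by (cases "S n t \<in> {-R n..R n}") (simp_all add: mult.assoc)
          qed
          also have "\<dots> = a * truncated_mgf (M n) (S n) (R n) z"
            unfolding truncated_mgf_def by (rule integral_mult_right_zero)
          finally have 1: "(\<integral>y. iexp (u * y) \<partial>\<nu> n) = \<dots>" .
          have "- ((s n * \<sigma> n)\<^sup>2 / 2) + - (\<i> * of_real (u * V n)) + z\<^sup>2 * of_real ((\<sigma> n)\<^sup>2) / 2 = complex_of_real (- ((\<sigma> n * u)\<^sup>2 / 2))"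
            unfolding z_eq V_def by (simp add: power2_eq_square field_simps)
          then have "exp (- complex_of_real ((s n * \<sigma> n)\<^sup>2 / 2)) * exp (- (\<i> * of_real (u * V n))) * exp (z\<^sup>2 * of_real ((\<sigma> n)\<^sup>2) / 2)
             = exp (complex_of_real (- ((\<sigma> n * u)\<^sup>2 / 2)))"
            unfolding exp_add[symmetric] by simp
          then have 2: "a * exp (z\<^sup>2 * of_real ((\<sigma> n)\<^sup>2) / 2) = of_real (gaussian_hat (\<sigma> n) u)"
            unfolding a_def A_def of_real_mult exp_of_real[symmetric] of_real_minus by (simp add: mult_ac)
          have na: "norm a \<le> sqrt (2 * pi) * \<sigma> n"
          proof -
            have "norm a = A n" using A_pos[of n] by (simp add: a_def norm_mult)
            also have "\<dots> \<le> sqrt (2 * pi) * \<sigma> n" using \<sigma>_pos[of n] by (simp add: A_def)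
            finally show ?thesis .
          qed
          have "norm ((\<integral>y. iexp (u * y) \<partial>\<nu> n) - of_real (gaussian_hat (\<sigma> n) u) * Q n z)
            = norm a * norm (truncated_mgf (M n) (S n) (R n) z - exp (z\<^sup>2 * of_real ((\<sigma> n)\<^sup>2) / 2) * Q n z)"
            unfolding 1 2[symmetric] norm_mult[symmetric] by (simp only: right_diff_distrib mult.assoc)
          also have "\<dots> \<le> sqrt (2 * pi) * \<sigma> n * \<bar>\<eta> n\<bar>"
          proof (rule mult_mono[OF na])
            show "norm (truncated_mgf (M n) (S n) (R n) z - exp (z\<^sup>2 * of_real ((\<sigma> n)\<^sup>2) / 2) * Q n z) \<le> \<bar>\<eta> n\<bar>"
              using H z by (meson abs_ge_self order_trans)
          qed (use \<sigma>_pos[of n] in auto)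
          finally show "norm ((\<integral>y. iexp (u * y) \<partial>\<nu> n) - of_real (gaussian_hat (\<sigma> n) u) * Q n (Complex (s n) u))
            \<le> sqrt (2 * pi) * (\<sigma> n * \<bar>\<eta> n\<bar>)" unfolding z_def by (simp only: mult.assoc)
        qed
      qed
    qed
  qed (use \<sigma>_pos \<sigma>_lim in auto)
  have "(\<lambda>n. \<integral>y. indicator {0..} y * exp (- s n * y) \<partial>\<nu> n) \<longlonglongrightarrow> c / k"
    by (rule one_sided_exponential_limit[OF refl c s k])
  also have "(\<lambda>n. \<integral>y. indicator {0..} y * exp (- s n * y) \<partial>\<nu> n) = (\<lambda>n. sqrt (2 * pi) * \<sigma> n * exp ((s n * \<sigma> n)\<^sup>2 / 2) *
            measure (M n) {t \<in> space (M n). S n t \<in> {-R n..R n} \<and> S n t \<ge> s n * (\<sigma> n)\<^sup>2})"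
  proof
    fix n
    interpret prob_space "M n" by (rule prob)
    let ?E = "{t \<in> space (M n). S n t \<in> {-R n..R n} \<and> S n t \<ge> s n * (\<sigma> n)\<^sup>2}"
    have "(\<integral>y. indicator {0..} y * exp (- s n * y) \<partial>\<nu> n) = (\<integral>t. W n t *\<^sub>R (indicator {0..} (S n t - V n) * exp (- s n * (S n t - V n))) \<partial>M n)"
      by (rule int_nu) measurable
    also have "\<dots> = (\<integral>t. sqrt (2 * pi) * \<sigma> n * exp ((s n * \<sigma> n)\<^sup>2 / 2) * indicator ?E t \<partial>M n)"
    proof (rule Bochner_Integration.integral_cong[OF refl])
      fix t assume t: "t \<in> space (M n)"
      have "- ((s n * \<sigma> n)\<^sup>2 / 2) + s n * S n t + - s n * (S n t - V n) = (s n * \<sigma> n)\<^sup>2 / 2"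
        unfolding V_def by (simp add: power2_eq_square field_simps)
      then have e: "exp (- ((s n * \<sigma> n)\<^sup>2 / 2)) * exp (s n * S n t) * exp (- s n * (S n t - V n)) = exp ((s n * \<sigma> n)\<^sup>2 / 2)"
        by (simp only: exp_add[symmetric])
      have i: "indicator {-R n..R n} (S n t) * indicator {0..} (S n t - V n) = (indicator ?E t :: real)"
        using t by (auto simp: indicator_def V_def)
      have "W n t *\<^sub>R (indicator {0..} (S n t - V n) * exp (- s n * (S n t - V n)))
        = sqrt (2 * pi) * \<sigma> n * (exp (- ((s n * \<sigma> n)\<^sup>2 / 2)) * exp (s n * S n t) * exp (- s n * (S n t - V n)))
          * (indicator {-R n..R n} (S n t) * indicator {0..} (S n t - V n))"
        unfolding W_def A_def by (simp add: mult_ac)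
      then show "W n t *\<^sub>R (indicator {0..} (S n t - V n) * exp (- s n * (S n t - V n)))
        = sqrt (2 * pi) * \<sigma> n * exp ((s n * \<sigma> n)\<^sup>2 / 2) * indicator ?E t"
        unfolding e i .
    qed
    also have "\<dots> = sqrt (2 * pi) * \<sigma> n * exp ((s n * \<sigma> n)\<^sup>2 / 2) * measure (M n) (?E \<inter> space (M n))"
      by simp
    also have "?E \<inter> space (M n) = ?E" by auto
    finally show "(\<integral>y. indicator {0..} y * exp (- s n * y) \<partial>\<nu> n) = sqrt (2 * pi) * \<sigma> n * exp ((s n * \<sigma> n)\<^sup>2 / 2) * measure (M n) ?E" .
  qed
  finally show ?thesis .
qed

section \<open>The large deviations of the prime sum\<close>

definition loglog :: "real \<Rightarrow> real" where "loglog T = ln (ln T)"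

text \<open>
  With \<open>L = ln ln T\<close>, moments of order up to \<open>o(L\<^sup>2)\<close> match up to a negligible error.  The order
  \<open>2 L^(3/2)\<close> is in that range and eventually exceeds every multiple of \<open>L\<close>.
\<close>

definition moment_order :: "real \<Rightarrow> nat" where
  "moment_order L = 2 * nat \<lfloor>L powr (3 / 2)\<rfloor>"

text \<open>
  The level \<open>R\<close> with \<open>2 e K R = N\<close> for \<open>K = L^(1/5)\<close>.  The exponent \<open>1/5\<close> is small enough for
  \<open>K\<^sup>2 L = L^(7/5)\<close> to be negligible against \<open>N\<close>, and \<open>K\<close> still exceeds every constant eventually.
\<close>

definition trunc_level :: "real \<Rightarrow> real" where
  "trunc_level L = real (moment_order L) / (2 * exp 1 * L powr (1 / 5))"

text \<open>
  For \<open>x = T^(1/L\<^sup>2)\<close> and \<open>l \<le> 2 L^(3/2)\<close> this bounds \<open>2 x^(2l) / T\<close>, because \<open>ln T = exp L\<close>.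
\<close>

definition moment_error :: "real \<Rightarrow> real" where
  "moment_error L = 2 * exp (4 * exp L / sqrt L - exp L)"

text \<open>
  A majorant for both estimates of \<open>moment_match\<close>; \<open>162 = 4 * 3^4 / 2\<close> comes from \<open>(2 e\<^sup>2 K)\<^sup>2 / 2\<close> and
  \<open>e \<le> 3\<close>.
\<close>

definition error_bound :: "real \<Rightarrow> real" where
  "error_bound L = 5 * exp (1 - L powr (3 / 2) + 162 * L powr (7 / 5))
     + moment_error L * (exp (L powr (3 / 2)) + exp (L powr (1 / 5)))"

lemma moment_order_bounds:
  assumes "L \<ge> 0"
  shows "real (moment_order L) \<le> 2 * L powr (3 / 2)" "real (moment_order L) \<ge> 2 * L powr (3 / 2) - 2"
  unfolding moment_order_def using assms by (auto, linarith+)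

text \<open>
  Here \<open>ln ln x = L - 2 ln L\<close>, so replacing \<open>T\<close> by the much smaller cutoff does not change the
  leading order of the variance.
\<close>

lemma
  shows filterlim_cutoff: "filterlim cutoff at_top at_top"
    and prime_variance_cutoff_asymp: "((\<lambda>T. prime_variance (cutoff T) / loglog T) \<longlongrightarrow> 1 / 2) at_top"
proof -
  show c: "filterlim cutoff at_top at_top" unfolding cutoff_def[abs_def] by real_asymp
  have "((\<lambda>T. (\<Sum>p\<in>primes_le (cutoff T). 1 / real p) / ln (ln (cutoff T))) \<longlongrightarrow> 1) at_top"
    by (rule filterlim_compose[OF sum_inverse_primes_asymp c])
  moreover have "((\<lambda>T. ln (ln (cutoff T)) / loglog T) \<longlongrightarrow> 1) at_top"
    unfolding cutoff_def loglog_def by real_asymp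
  ultimately have "((\<lambda>T. 1 / 2 * ((\<Sum>p\<in>primes_le (cutoff T). 1 / real p) / ln (ln (cutoff T)) * (ln (ln (cutoff T)) / loglog T))) \<longlongrightarrow> 1 / 2 * (1 * 1)) at_top"
    by (intro tendsto_intros)
  moreover have "\<forall>\<^sub>F T in at_top. ln (ln (cutoff T)) > 0"
    unfolding cutoff_def by real_asymp
  then have "\<forall>\<^sub>F T in at_top. 1 / 2 * ((\<Sum>p\<in>primes_le (cutoff T). 1 / real p) / ln (ln (cutoff T)) * (ln (ln (cutoff T)) / loglog T))
     = prime_variance (cutoff T) / loglog T"
    by eventually_elim (simp add: prime_variance_def)
  ultimately show "((\<lambda>T. prime_variance (cutoff T) / loglog T) \<longlongrightarrow> 1 / 2) at_top"
    by (simp add: Lim_transform_eventually)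
qed

lemma two_cutoff_power_le:
  assumes "T > 1" "loglog T > 0" "real l \<le> 2 * loglog T powr (3 / 2)"
  shows "2 * cutoff T ^ (2 * l) / T \<le> moment_error (loglog T)"
proof -
  define L where "L = loglog T"
  have L: "L > 0" using assms by (simp add: L_def)
  have "ln T > 0" using assms(1) by (rule ln_gt_zero)
  then have lnT: "ln T = exp L" unfolding L_def loglog_def by (rule exp_ln[symmetric])
  have T: "exp (exp L) = T" unfolding lnT[symmetric] using assms(1) by (intro exp_ln) linarith
  have "cutoff T = exp (1 / L\<^sup>2 * ln T)"
    using assms(1) by (simp only: cutoff_def powr_def L_def loglog_def) simp
  then have cut: "cutoff T = exp (exp L / L\<^sup>2)" unfolding lnT by simp
  have "cutoff T ^ (2 * l) = exp (real (2 * l) * (exp L / L\<^sup>2))" unfolding cut by (simp only: exp_of_nat_mult)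
  also have "\<dots> \<le> exp (4 * exp L / sqrt L)"
  proof -
    have "real (2 * l) * (exp L / L\<^sup>2) \<le> (4 * L powr (3 / 2)) * (exp L / L\<^sup>2)"
      using assms(3) by (intro mult_right_mono) (auto simp: L_def)
    also have "(4 * L powr (3 / 2)) * (exp L / L\<^sup>2) = (4 * L powr (3 / 2)) * (exp L / L powr 2)"
      using L by (simp add: powr_numeral)
    also have "(4 * L powr (3 / 2)) * (exp L / L powr 2) = 4 * exp L * (L powr (3 / 2) / L powr 2)" by simp
    also have "L powr (3 / 2) / L powr 2 = L powr (- (1 / 2))" by (simp flip: powr_diff)
    also have "4 * exp L * L powr (- (1 / 2)) = 4 * exp L / sqrt L"
      using L by (simp add: powr_minus powr_half_sqrt field_simps)
    finally show ?thesis by simp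
  qed
  finally have "2 * cutoff T ^ (2 * l) / T \<le> 2 * exp (4 * exp L / sqrt L) / T"
    using assms(1) by (intro divide_right_mono mult_left_mono) linarith+
  also have "\<dots> = 2 * exp (4 * exp L / sqrt L - exp L)" unfolding exp_diff T by simp
  finally show ?thesis by (simp add: L_def moment_error_def)
qed

definition prime_sum :: "real \<Rightarrow> real \<Rightarrow> real" where
  "prime_sum T t = prime_cos_sum (cutoff T) (\<lambda>p. t * ln p)"

lemma prime_sum_measurable [measurable]: "prime_sum T \<in> borel_measurable borel"
  unfolding prime_sum_def[abs_def] prime_cos_sum_def by measurable

lemma moment_match_primes:
  assumes "T > 1" "loglog T > 0" "cutoff T \<ge> 1"
  shows "moment_match (interval_unif T (2 * T)) (phase_space (cutoff T)) (prime_sum T) (prime_cos_sum (cutoff T))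
      (moment_order (loglog T)) (moment_error (loglog T))
      (prime_variance (cutoff T)) (\<Sum>p\<in>primes_le (cutoff T). 1 / sqrt p) (\<Sum>p\<in>primes_le (cutoff T). 1 / sqrt p)"
proof (intro moment_match.intro moment_match_axioms.intro)
  show "prob_space (interval_unif T (2 * T))" by (rule prob_space_interval_unif) (use assms in simp)
  show "prob_space (phase_space (cutoff T))" by (rule prob_space_phase_space)
  show "prime_sum T \<in> borel_measurable (interval_unif T (2 * T))" by measurable
  show "prime_cos_sum (cutoff T) \<in> borel_measurable (phase_space (cutoff T))" by measurable
  show "\<bar>prime_sum T t\<bar> \<le> (\<Sum>p\<in>primes_le (cutoff T). 1 / sqrt p)" for t
    unfolding prime_sum_def by (rule abs_prime_cos_sum_le)
  show "\<bar>prime_cos_sum (cutoff T) \<omega>\<bar> \<le> (\<Sum>p\<in>primes_le (cutoff T). 1 / sqrt p)" for \<omega>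
    by (rule abs_prime_cos_sum_le)
  show "integral\<^sup>L (phase_space (cutoff T)) (\<lambda>\<omega>. exp (r * prime_cos_sum (cutoff T) \<omega>)) \<le> exp (r\<^sup>2 * prime_variance (cutoff T) / 2)" for r
    by (rule prime_cos_sum_subgaussian)
  show "even (moment_order (loglog T))" by (simp add: moment_order_def)
  show "prime_variance (cutoff T) \<ge> 0" unfolding prime_variance_def by (simp add: sum_nonneg)
  fix l assume "l \<le> moment_order (loglog T)"
  then have "real l \<le> 2 * loglog T powr (3 / 2)"
    using moment_order_bounds(1)[of "loglog T"] assms by linarith
  then show "\<bar>integral\<^sup>L (interval_unif T (2 * T)) (\<lambda>t. prime_sum T t ^ l) - integral\<^sup>L (phase_space (cutoff T)) (\<lambda>\<omega>. prime_cos_sum (cutoff T) \<omega> ^ l)\<bar>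
      \<le> moment_error (loglog T)"
    unfolding prime_sum_def using moments_close[of "cutoff T" T l] two_cutoff_power_le[of T l] assms by auto
qed

lemma eventually_comparison:
  "\<forall>\<^sub>F T in at_top.
     (\<forall>z. norm z \<le> loglog T powr (1 / 5) \<longrightarrow>
        norm (truncated_mgf (interval_unif T (2 * T)) (prime_sum T) (trunc_level (loglog T)) z
          - exp (z\<^sup>2 * of_real (prime_variance (cutoff T)) / 2) * prime_product (cutoff T) z) \<le> error_bound (loglog T)) \<and>
     measure (interval_unif T (2 * T)) {t. prime_sum T t \<notin> {-trunc_level (loglog T)..trunc_level (loglog T)}} \<le> error_bound (loglog T)"
proof -
  have 1: "filterlim loglog at_top at_top" unfolding loglog_def[abs_def] by real_asymp
  have e1: "\<forall>\<^sub>F L in at_top. L powr (1 / 5) > (0::real) \<and> L > 0" by (intro eventually_conj; real_asymp)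
  have e2: "\<forall>\<^sub>F L in at_top. (2 * L powr (3 / 2) - 2) / (2 * exp 1 * L powr (1 / 5)) \<ge> (1::real)" by real_asymp
  have e3: "\<forall>\<^sub>F T in at_top. cutoff T \<ge> 1" using filterlim_cutoff by (simp add: filterlim_at_top)
  have e4: "\<forall>\<^sub>F T in at_top. prime_variance (cutoff T) / loglog T < 1"
    using order_tendstoD(2)[OF prime_variance_cutoff_asymp, of 1] by simp
  show ?thesis
    using eventually_compose_filterlim[OF e1 1] eventually_compose_filterlim[OF e2 1] e3 e4 eventually_gt_at_top[of 1]
  proof eventually_elim
    case (elim T)
    define L where "L = loglog T"
    define K where "K = L powr (1 / 5)"
    define v where "v = prime_variance (cutoff T)"
    define N where "N = moment_order L"
    define \<epsilon> where "\<epsilon> = moment_error L"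
    have L: "L > 0" and K: "K > 0" using elim by (auto simp: L_def K_def)
    have vL: "v \<le> L" using elim L by (simp add: v_def L_def divide_less_eq)
    have v0: "v \<ge> 0" unfolding v_def prime_variance_def by (simp add: sum_nonneg)
    have R1: "trunc_level L \<ge> 1"
    proof -
      have "1 \<le> (2 * L powr (3 / 2) - 2) / (2 * exp 1 * L powr (1 / 5))" using elim by (simp add: L_def)
      also have "\<dots> \<le> trunc_level L"
        unfolding trunc_level_def using moment_order_bounds(2)[of L] L by (intro divide_right_mono) auto
      finally show ?thesis .
    qed
    have R2: "2 * exp 1 * K * trunc_level L = real N"
      using K by (simp add: trunc_level_def K_def N_def)
    interpret mm: moment_match "interval_unif T (2 * T)" "phase_space (cutoff T)" "prime_sum T" "prime_cos_sum (cutoff T)"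
      N \<epsilon> v "\<Sum>p\<in>primes_le (cutoff T). 1 / sqrt p" "\<Sum>p\<in>primes_le (cutoff T). 1 / sqrt p"
      unfolding N_def \<epsilon>_def v_def L_def by (rule moment_match_primes) (use elim in auto)
    have ex: "exp (- real N / 2) * mm.growth K \<le> exp (1 - L powr (3 / 2) + 162 * L powr (7 / 5))"
    proof -
      have "(2 * (exp 1)\<^sup>2 * K)\<^sup>2 = 4 * (exp (1::real)) ^ 4 * K\<^sup>2" by (simp add: power_mult_distrib flip: power_mult)
      also have "\<dots> \<le> 4 * 3 ^ 4 * K\<^sup>2" by (intro mult_right_mono mult_left_mono power_mono exp_le) auto
      finally have "(2 * (exp 1)\<^sup>2 * K)\<^sup>2 * v / 2 \<le> (4 * 3 ^ 4 * K\<^sup>2) * L / 2"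
        using vL v0 by (intro divide_right_mono mult_mono) auto
      also have "\<dots> = 162 * (L powr (2 / 5) * L powr 1)" using L by (simp add: K_def power2_eq_square flip: powr_add)
      also have "L powr (2 / 5) * L powr 1 = L powr (7 / 5)" by (subst powr_add[symmetric]) simp
      finally have "(2 * (exp 1)\<^sup>2 * K)\<^sup>2 * v / 2 \<le> 162 * L powr (7 / 5)" .
      moreover have "- real N / 2 \<le> 1 - L powr (3 / 2)" using moment_order_bounds(2)[of L] L by (simp add: N_def)
      ultimately show ?thesis unfolding exp_add[symmetric] by simp
    qed
    have N_le: "exp (real N / 2) \<le> exp (L powr (3 / 2))" using moment_order_bounds(1)[of L] L by (simp add: N_def)
    have \<epsilon>0: "\<epsilon> \<ge> 0" by (simp add: \<epsilon>_def moment_error_def)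
    have bd: "5 * exp (- real N / 2) * mm.growth K + \<epsilon> * (exp (real N / 2) + exp K) \<le> error_bound L"
      unfolding error_bound_def \<epsilon>_def[symmetric] K_def[symmetric]
      using ex N_le \<epsilon>0 by (intro add_mono mult_left_mono) auto
    have "\<epsilon> + 2 * exp (- real N) * mm.growth K \<le> 5 * exp (- real N / 2) * mm.growth K + \<epsilon> * (exp (real N / 2) + exp K)"
    proof -
      have "\<epsilon> * 1 \<le> \<epsilon> * (exp (real N / 2) + exp K)"
        using \<epsilon>0 K by (intro mult_left_mono) (auto intro: order_trans[of 1 "exp K"] simp: add_increasing)
      moreover have "2 * exp (- real N) * mm.growth K \<le> 5 * exp (- real N / 2) * mm.growth K"
        by (intro mult_right_mono mult_mono) auto
      ultimately show ?thesis by linarith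
    qed
    then have "measure (interval_unif T (2 * T)) {t. prime_sum T t \<notin> {-trunc_level L..trunc_level L}} \<le> error_bound L"
      using mm.prob_gt_le[OF K R2 R1] bd by simp
    moreover have "norm (truncated_mgf (interval_unif T (2 * T)) (prime_sum T) (trunc_level L) z
          - exp (z\<^sup>2 * of_real v / 2) * prime_product (cutoff T) z) \<le> error_bound L" if "norm z \<le> K" for z
      using mm.truncated_exp_moment_close[OF K that R2 R1] bd
      unfolding expectation_exp_prime_cos_sum v_def[symmetric] by linarith
    ultimately show ?case unfolding L_def K_def v_def by blast
  qed
qed

text \<open>
  The Gaussian tail at the threshold decays no faster than a power of \<open>exp (- L)\<close>, so an error
  below every such power is harmless.
\<close>

lemma error_bound_negligible:
  assumes "C > 0"
  shows "((\<lambda>L. exp (C * L) * error_bound L) \<longlongrightarrow> 0) at_top"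
proof -
  have 1: "((\<lambda>L. exp (C * L) * (5 * exp (1 - L powr (3 / 2) + 162 * L powr (7 / 5)))) \<longlongrightarrow> 0) at_top"
    using assms by real_asymp
  have 2: "((\<lambda>L. exp (C * L) * (2 * exp (4 * exp L / sqrt L - exp L) * exp (L powr (3 / 2)))) \<longlongrightarrow> 0) at_top"
    using assms by real_asymp
  have 3: "((\<lambda>L. exp (C * L) * (2 * exp (4 * exp L / sqrt L - exp L) * exp (L powr (1 / 5)))) \<longlongrightarrow> 0) at_top"
    using assms by real_asymp
  show ?thesis
    using tendsto_add[OF 1 tendsto_add[OF 2 3]] by (simp add: error_bound_def moment_error_def algebra_simps)
qed

lemma continuous_on_prime_product: "continuous_on A (prime_product x)"
  unfolding prime_product_def[abs_def] by (intro continuous_on_prod continuous_on_local_factor)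

text \<open>
  Both the probability and the Gaussian tail are multiplied by \<open>sqrt (2 pi) \<sigma> exp (\<Delta>\<^sup>2 / 2)\<close>, after which
  they converge to \<open>c / k\<close> and \<open>1 / k\<close>.
\<close>

theorem large_deviation_along_sequence:
  fixes X :: "nat \<Rightarrow> real" and \<Delta> :: "real \<Rightarrow> real"
  assumes X: "filterlim X at_top sequentially"
    and X_large: "\<And>n. X n > 1 \<and> loglog (X n) > 0 \<and> prime_variance (cutoff (X n)) > 0"
    and k: "k > 0" and c: "c > 0"
    and c_lim: "\<And>x z. filterlim x at_top sequentially \<Longrightarrow> z \<longlonglongrightarrow> complex_of_real k \<Longrightarrow>
                  (\<lambda>n::nat. prime_product (x n) (z n)) \<longlonglongrightarrow> of_real c"
    and \<Delta>: "((\<lambda>T. \<Delta> T / sqrt (1 / 2 * loglog T)) \<longlongrightarrow> k) at_top"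
  shows "(\<lambda>n. measure (interval_unif (X n) (2 * X n)) {t. prime_sum (X n) t \<ge> \<Delta> (X n) * sqrt (prime_variance (cutoff (X n)))}
            / (c * gaussian_tail (\<Delta> (X n)))) \<longlonglongrightarrow> 1"
proof -
  define L where "L = (\<lambda>n. loglog (X n))"
  define v where "v = (\<lambda>n. prime_variance (cutoff (X n)))"
  define \<sigma> where "\<sigma> = (\<lambda>n. sqrt (v n))"
  define s where "s = (\<lambda>n. \<Delta> (X n) / \<sigma> n)"
  define M where "M = (\<lambda>n. interval_unif (X n) (2 * X n))"
  define S where "S = (\<lambda>n. prime_sum (X n))"
  define R where "R = (\<lambda>n. trunc_level (L n))"
  define H where "H = (\<lambda>n. sqrt (2 * pi) * \<sigma> n * exp ((s n * \<sigma> n)\<^sup>2 / 2))"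
  have v_pos: "v n > 0" and L_pos: "L n > 0" and X1: "X n > 1" for n using X_large[of n] by (auto simp: v_def L_def)
  have \<sigma>_pos: "\<sigma> n > 0" for n using v_pos[of n] by (simp add: \<sigma>_def)
  have \<sigma>2: "(\<sigma> n)\<^sup>2 = v n" for n using v_pos[of n] by (simp add: \<sigma>_def)
  have prob: "prob_space (M n)" for n unfolding M_def by (rule prob_space_interval_unif) (use X1[of n] in simp)
  have L_lim: "filterlim L at_top sequentially"
    unfolding L_def by (rule filterlim_compose[OF _ X]) (unfold loglog_def, real_asymp)
  have vL: "(\<lambda>n. v n / L n) \<longlonglongrightarrow> 1 / 2"
    unfolding v_def L_def by (rule filterlim_compose[OF prime_variance_cutoff_asymp X])
  have v_lim: "filterlim v at_top sequentially"
  proof -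
    have "filterlim (\<lambda>n. v n / L n * L n) at_top sequentially"
      by (rule filterlim_tendsto_pos_mult_at_top[OF vL _ L_lim]) simp
    then show ?thesis using L_pos by (simp add: less_imp_neq[symmetric])
  qed
  have \<sigma>_lim: "filterlim \<sigma> at_top sequentially"
    unfolding \<sigma>_def by (rule filterlim_compose[OF sqrt_at_top v_lim])
  have s_lim: "s \<longlonglongrightarrow> k"
  proof -
    have "(\<lambda>n. \<Delta> (X n) / sqrt (1 / 2 * L n)) \<longlonglongrightarrow> k"
      unfolding L_def by (rule filterlim_compose[OF \<Delta> X])
    moreover have "(\<lambda>n. sqrt (1 / 2 / (v n / L n))) \<longlonglongrightarrow> sqrt (1 / 2 / (1 / 2))"
      by (intro tendsto_intros vL) simp
    ultimately have "(\<lambda>n. \<Delta> (X n) / sqrt (1 / 2 * L n) * sqrt (1 / 2 / (v n / L n))) \<longlonglongrightarrow> k * sqrt (1 / 2 / (1 / 2))"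
      by (rule tendsto_mult)
    moreover have "\<Delta> (X n) / sqrt (1 / 2 * L n) * sqrt (1 / 2 / (v n / L n)) = s n" for n
    proof -
      have "sqrt (1 / 2 / (v n / L n)) = sqrt (1 / 2 * L n) / sqrt (v n)"
        unfolding real_sqrt_divide[symmetric] by simp
      then show ?thesis using L_pos[of n] by (simp add: s_def \<sigma>_def)
    qed
    ultimately show ?thesis by simp
  qed
  have ev_cmp: "\<forall>\<^sub>F n in sequentially.
     (\<forall>z. norm z \<le> L n powr (1 / 5) \<longrightarrow>
        norm (truncated_mgf (M n) (S n) (R n) z
          - exp (z\<^sup>2 * of_real (v n) / 2) * prime_product (cutoff (X n)) z) \<le> error_bound (L n)) \<and>
     measure (M n) {t. S n t \<notin> {-R n..R n}} \<le> error_bound (L n)"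
    unfolding L_def M_def S_def R_def v_def by (rule eventually_compose_filterlim[OF eventually_comparison X])
  have err: "(\<lambda>n. exp (C * L n) * error_bound (L n)) \<longlonglongrightarrow> 0" if "C > 0" for C
    by (rule filterlim_compose[OF error_bound_negligible[OF that] L_lim])
  have ev_vL: "\<forall>\<^sub>F n in sequentially. v n \<le> L n"
  proof -
    have "\<forall>\<^sub>F n in sequentially. v n / L n < 1" using order_tendstoD(2)[OF vL, of 1] by simp
    then show ?thesis
    proof eventually_elim
      case (elim n)
      then show ?case using L_pos[of n] by simp
    qed
  qed
  have eb_nonneg: "error_bound l \<ge> 0" for l by (simp add: error_bound_def moment_error_def add_nonneg_nonneg)
  have \<sigma>_le: "\<sigma> n \<le> exp (L n)" if "v n \<le> L n" for n
  proof -
    have "\<sigma> n \<le> sqrt ((exp (L n))\<^sup>2)"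
      unfolding \<sigma>_def
    proof (rule real_sqrt_le_mono)
      have "v n \<le> exp (L n)" using that exp_ge_add_one_self[of "L n"] by linarith
      also have "exp (L n) \<le> (exp (L n))\<^sup>2" using L_pos[of n] by (simp add: power2_eq_square flip: exp_add)
      finally show "v n \<le> (exp (L n))\<^sup>2" .
    qed
    then show ?thesis by simp
  qed
  have main: "(\<lambda>n. sqrt (2 * pi) * \<sigma> n * exp ((s n * \<sigma> n)\<^sup>2 / 2) *
            measure (M n) {t \<in> space (M n). S n t \<in> {-R n..R n} \<and> S n t \<ge> s n * (\<sigma> n)\<^sup>2}) \<longlonglongrightarrow> c / k"
  proof (rule mod_gaussian_tail[OF prob _ \<sigma>_pos \<sigma>_lim s_lim k c])
    show "S n \<in> borel_measurable (M n)" for n unfolding S_def M_def by measurable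
    show "continuous_on UNIV (prime_product (cutoff (X n)))" for n by (rule continuous_on_prime_product)
    show "\<exists>B. \<forall>n z. norm z \<le> K \<longrightarrow> norm (prime_product (cutoff (X n)) z) \<le> B" for K
      using prime_product_bounded[of K] by blast
    show "(\<lambda>n. prime_product (cutoff (X n)) (z n)) \<longlonglongrightarrow> of_real c" if "z \<longlonglongrightarrow> of_real k" for z
      by (rule c_lim[OF filterlim_compose[OF filterlim_cutoff X] that])
    show "\<exists>\<eta>. (\<lambda>n. \<sigma> n * \<eta> n) \<longlonglongrightarrow> 0 \<and> (\<forall>\<^sub>F n in sequentially. \<forall>z. norm z \<le> K \<longrightarrow>
        norm (truncated_mgf (M n) (S n) (R n) z
          - exp (z\<^sup>2 * of_real ((\<sigma> n)\<^sup>2) / 2) * prime_product (cutoff (X n)) z) \<le> \<eta> n)" for K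
    proof (intro exI conjI)
      show "(\<lambda>n. \<sigma> n * error_bound (L n)) \<longlonglongrightarrow> 0"
      proof (rule Lim_null_comparison[OF _ err[of 1]])
        show "\<forall>\<^sub>F n in sequentially. norm (\<sigma> n * error_bound (L n)) \<le> exp (1 * L n) * error_bound (L n)"
          using ev_vL
        proof eventually_elim
          case (elim n)
          then show ?case using \<sigma>_le[OF elim] \<sigma>_pos[of n] eb_nonneg[of "L n"] by (simp add: abs_mult mult_right_mono)
        qed
      qed simp
      have "filterlim (\<lambda>n. L n powr (1 / 5)) at_top sequentially"
        by (rule filterlim_compose[OF _ L_lim]) real_asymp
      then have "\<forall>\<^sub>F n in sequentially. K \<le> L n powr (1 / 5)" by (simp add: filterlim_at_top)
      with ev_cmp show "\<forall>\<^sub>F n in sequentially. \<forall>z. norm z \<le> K \<longrightarrow>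
        norm (truncated_mgf (M n) (S n) (R n) z
          - exp (z\<^sup>2 * of_real ((\<sigma> n)\<^sup>2) / 2) * prime_product (cutoff (X n)) z) \<le> error_bound (L n)"
        unfolding \<sigma>2
      proof eventually_elim
        case (elim n)
        then show ?case using order_trans[of _ K "L n powr (1 / 5)"] by simp
      qed
    qed
  qed
  define P where "P = (\<lambda>n. measure (M n) {t. S n t \<ge> \<Delta> (X n) * \<sigma> n})"
  define P1 where "P1 = (\<lambda>n. measure (M n) {t. S n t \<in> {-R n..R n} \<and> S n t \<ge> \<Delta> (X n) * \<sigma> n})"
  have thr: "s n * (\<sigma> n)\<^sup>2 = \<Delta> (X n) * \<sigma> n" for n
    using \<sigma>_pos[of n] by (simp add: s_def power2_eq_square)
  have s\<sigma>: "s n * \<sigma> n = \<Delta> (X n)" for n using \<sigma>_pos[of n] by (simp add: s_def)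
  have H1: "(\<lambda>n. H n * P1 n) \<longlonglongrightarrow> c / k"
    using main unfolding thr H_def P1_def by (simp add: M_def)
  have diff: "(\<lambda>n. H n * P n - H n * P1 n) \<longlonglongrightarrow> 0"
  proof (rule Lim_null_comparison)
    \<comment> \<open>Eventually \<open>\<sigma> \<le> exp L\<close>, and \<open>s \<le> k + 1\<close> with \<open>v \<le> L\<close> bounds \<open>(s \<sigma>)\<^sup>2 / 2\<close>.\<close>
    define C where "C = 1 + (k + 1)\<^sup>2 / 2"
    have C: "C > 0" by (simp add: C_def add_pos_nonneg)
    show "(\<lambda>n. sqrt (2 * pi) * (exp (C * L n) * error_bound (L n))) \<longlonglongrightarrow> 0"
      by (rule tendsto_mult_right_zero[OF err[OF C]])
    have "\<forall>\<^sub>F n in sequentially. s n < k + 1" "\<forall>\<^sub>F n in sequentially. s n > 0"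
      using order_tendstoD[OF s_lim] k by auto
    then show "\<forall>\<^sub>F n in sequentially. norm (H n * P n - H n * P1 n) \<le> sqrt (2 * pi) * (exp (C * L n) * error_bound (L n))"
      using ev_cmp ev_vL
    proof eventually_elim
      case (elim n)
      interpret prob_space "M n" by (rule prob)
      have [measurable]: "S n \<in> borel_measurable borel" unfolding S_def by measurable
      have sM: "sets (M n) = sets borel" by (simp add: M_def)
      have ms: "{t. S n t \<in> {-R n..R n} \<and> S n t \<ge> \<Delta> (X n) * \<sigma> n} \<in> sets (M n)"
        "{t. S n t \<notin> {-R n..R n}} \<in> sets (M n)" "{t. S n t \<ge> \<Delta> (X n) * \<sigma> n} \<in> sets (M n)"
        unfolding sM by measurable
      have "P1 n \<le> P n" unfolding P1_def P_def by (rule finite_measure_mono) (use ms in auto)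
      have "P n \<le> prob ({t. S n t \<in> {-R n..R n} \<and> S n t \<ge> \<Delta> (X n) * \<sigma> n} \<union> {t. S n t \<notin> {-R n..R n}})"
        unfolding P_def by (rule finite_measure_mono) (use ms in auto)
      also have "\<dots> \<le> P1 n + prob {t. S n t \<notin> {-R n..R n}}"
        unfolding P1_def by (rule measure_Un_le[OF ms(1,2)])
      finally have PP: "\<bar>P n - P1 n\<bar> \<le> error_bound (L n)" using \<open>P1 n \<le> P n\<close> elim by linarith
      have Hn: "H n \<le> sqrt (2 * pi) * exp (C * L n)"
      proof -
        have "(s n * \<sigma> n)\<^sup>2 / 2 = (s n)\<^sup>2 * v n / 2" by (simp add: power_mult_distrib \<sigma>2)
        also have "\<dots> \<le> (k + 1)\<^sup>2 * L n / 2"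
          using elim v_pos[of n] by (intro divide_right_mono mult_mono power_mono) auto
        finally have "\<sigma> n * exp ((s n * \<sigma> n)\<^sup>2 / 2) \<le> exp (L n) * exp ((k + 1)\<^sup>2 * L n / 2)"
          using \<sigma>_le[of n] \<sigma>_pos[of n] elim by (intro mult_mono) auto
        also have "\<dots> = exp (C * L n)" by (simp add: C_def algebra_simps flip: exp_add)
        finally show ?thesis unfolding H_def mult.assoc by (intro mult_left_mono) auto
      qed
      have H0: "H n \<ge> 0" using \<sigma>_pos[of n] by (simp add: H_def)
      have "norm (H n * P n - H n * P1 n) = H n * \<bar>P n - P1 n\<bar>"
        using H0 by (simp add: abs_mult flip: right_diff_distrib)
      also have "\<dots> \<le> (sqrt (2 * pi) * exp (C * L n)) * error_bound (L n)"
        using Hn PP H0 by (intro mult_mono) auto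
      finally show ?case by (simp only: mult.assoc)
    qed
  qed
  have HP: "(\<lambda>n. H n * P n) \<longlonglongrightarrow> c / k" by (rule Lim_transform[OF H1 diff])
  have HG: "(\<lambda>n. H n * gaussian_tail (\<Delta> (X n))) \<longlonglongrightarrow> 1 / k"
    using gaussian_tail_limit[OF \<sigma>_pos \<sigma>_lim s_lim k] unfolding s\<sigma> H_def .
  have "(\<lambda>n. H n * P n / (c * (H n * gaussian_tail (\<Delta> (X n))))) \<longlonglongrightarrow> (c / k) / (c * (1 / k))"
    using c k by (intro tendsto_intros HP HG) auto
  moreover have H_nz: "H n \<noteq> 0" for n using \<sigma>_pos[of n] by (simp add: H_def)
  have "H n * P n / (c * (H n * gaussian_tail (\<Delta> (X n))))
     = P n / (c * gaussian_tail (\<Delta> (X n)))" for n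
    unfolding mult.left_commute[of c "H n"] by (rule mult_divide_mult_cancel_left[OF H_nz])
  ultimately show ?thesis using c k by (simp add: P_def M_def S_def \<sigma>_def v_def)
qed

lemma measure_prime_poly_ge:
  assumes "T > 0"
  shows "1 / T * measure lebesgue {t \<in> {T..2 * T}. Re (prime_poly (cutoff T) t) \<ge> D}
     = measure (interval_unif T (2 * T)) {t. prime_sum T t \<ge> D}"
proof -
  have B: "{t. prime_sum T t \<ge> D} \<in> sets borel" by measurable
  have eq: "{t \<in> {T..2 * T}. Re (prime_poly (cutoff T) t) \<ge> D} = {t. prime_sum T t \<ge> D} \<inter> {T..2 * T}"
    by (auto simp: Re_prime_poly prime_sum_def)
  have "measure lebesgue ({t. prime_sum T t \<ge> D} \<inter> {T..2 * T}) = measure lborel ({t. prime_sum T t \<ge> D} \<inter> {T..2 * T})"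
    using B by (intro measure_completion) auto
  then show ?thesis unfolding eq using prob_interval_unif[OF _ B, of T "2 * T"] assms by simp
qed

theorem proposition2:
  fixes k :: real
  assumes "k > 0"
  shows "\<exists>c::real. 0 < c \<and> c \<noteq> 1 \<and>
    (\<forall>\<Delta> :: real \<Rightarrow> real.
      ((\<lambda>T. \<Delta> T / sqrt (1 / 2 * ln (ln T))) \<longlongrightarrow> k) at_top \<longrightarrow>
      (\<lambda>T. 1 / T * measure lebesgue
          {t \<in> {T..2 * T}. Re (prime_poly (cutoff T) t)
             \<ge> \<Delta> T * sqrt (1 / 2 * (\<Sum>p\<in>primes_le (cutoff T). 1 / real p))})
      \<sim>[at_top]
      (\<lambda>T. c * (LBINT u:{\<Delta> T..}. exp (- u\<^sup>2 / 2) / sqrt (2 * pi))))"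
proof -
  obtain c :: real where c: "0 < c" "c < 1"
    and c_lim: "\<forall>(F :: nat filter) x z. filterlim x at_top F \<longrightarrow> (z \<longlongrightarrow> of_real k) F \<longrightarrow>
            ((\<lambda>n. prime_product (x n) (z n)) \<longlongrightarrow> of_real c) F"
    using prime_product_limit[OF assms, where 'f=nat] by (elim exE conjE)
  show ?thesis
  proof (intro exI[of _ c] conjI allI impI asymp_equivI')
    fix \<Delta> :: "real \<Rightarrow> real"
    assume \<Delta>: "((\<lambda>T. \<Delta> T / sqrt (1 / 2 * ln (ln T))) \<longlongrightarrow> k) at_top"
    let ?f = "\<lambda>T. 1 / T * measure lebesgue {t \<in> {T..2 * T}. Re (prime_poly (cutoff T) t)
             \<ge> \<Delta> T * sqrt (1 / 2 * (\<Sum>p\<in>primes_le (cutoff T). 1 / real p))}"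
    let ?g = "\<lambda>T. c * (LBINT u:{\<Delta> T..}. exp (- u\<^sup>2 / 2) / sqrt (2 * pi))"
    have ll: "\<forall>\<^sub>F T in at_top. loglog T > 0" unfolding loglog_def by real_asymp
    have "\<forall>\<^sub>F T in at_top. prime_variance (cutoff T) / loglog T > 0"
      using order_tendstoD(1)[OF prime_variance_cutoff_asymp, of 0] by simp
    with ll eventually_gt_at_top[of 1]
    have large: "\<forall>\<^sub>F T in at_top. T > 1 \<and> loglog T > 0 \<and> prime_variance (cutoff T) > 0"
      by eventually_elim (simp add: zero_less_divide_iff)
    show "((\<lambda>T. ?f T / ?g T) \<longlongrightarrow> 1) at_top"
    proof (rule tendsto_at_topI_sequentially)
      fix X :: "nat \<Rightarrow> real" assume X: "filterlim X at_top sequentially"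
      obtain N0 where N0: "\<And>n. n \<ge> N0 \<Longrightarrow> X n > 1 \<and> loglog (X n) > 0 \<and> prime_variance (cutoff (X n)) > 0"
        using eventually_compose_filterlim[OF large X] unfolding eventually_sequentially by blast
      \<comment> \<open>Dropping finitely many members makes the size conditions hold at every index.\<close>
      define Y where "Y = (\<lambda>n. X (n + N0))"
      have Y: "filterlim Y at_top sequentially"
        unfolding Y_def by (rule filterlim_compose[OF X filterlim_add_const_nat_at_top])
      have Y1: "Y n > 1 \<and> loglog (Y n) > 0 \<and> prime_variance (cutoff (Y n)) > 0" for n
        using N0[of "n + N0"] by (simp add: Y_def)
      have "(\<lambda>n. measure (interval_unif (Y n) (2 * Y n)) {t. prime_sum (Y n) t \<ge> \<Delta> (Y n) * sqrt (prime_variance (cutoff (Y n)))} / ?g (Y n)) \<longlonglongrightarrow> 1"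
        by (rule large_deviation_along_sequence[OF Y Y1 assms c(1) c_lim[rule_format] \<Delta>[folded loglog_def]])
      moreover have "?f (Y n) = measure (interval_unif (Y n) (2 * Y n)) {t. prime_sum (Y n) t \<ge> \<Delta> (Y n) * sqrt (prime_variance (cutoff (Y n)))}" for n
        unfolding prime_variance_def using Y1[of n] by (intro measure_prime_poly_ge) simp
      ultimately have "(\<lambda>n. ?f (Y n) / ?g (Y n)) \<longlonglongrightarrow> 1" by (simp only:)
      then show "(\<lambda>n. ?f (X n) / ?g (X n)) \<longlonglongrightarrow> 1"
        unfolding Y_def by (rule LIMSEQ_offset)
    qed
  qed (use c in auto)
qed

end
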